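(* For $\theta\in\mathbb{R}^d$ let $P_\theta=\frac12N(-\theta,I_d)+\frac12N(\theta,I_d)$, and let $\ell(\hat\theta,\theta)=\min\{\|\hat\theta-\theta\|,\|\hat\theta+\theta\|\}$. For any $d\ge2$, $n\in\mathbb{N}$ and $s\ge0$, $$\inf_{\hat\theta}\sup_{\|\theta_*\|=s}\mathbb{E}_{\theta_*}[\ell(\hat\theta,\theta_* )]\asymp\min\left\{\frac1s\left(\frac dn+\sqrt{\frac dn}\right)+\sqrt{\frac dn},\ s\right\}.$$ Furthermore, for any $d,n\in\mathbb{N}$ and $r\ge0$, $$\inf_{\hat\theta}\sup_{\|\theta_*\|\le r}\mathbb{E}_{\theta_*}[\ell(\hat\theta,\theta_* )]\asymp\min\left\{\left(\frac dn\right)^{1/4}+\sqrt{\frac dn},\ r\right\}.$$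
   Context: $\theta_*\in\mathbb{R}^d$, $\|\cdot\|$ is the Euclidean norm, $\mathbb{N}=\{1,2,\dots\}$. The infimum is over all estimators $\hat\theta$, i.e. measurable functions of $Y_1,\dots,Y_n$ with values in $\mathbb{R}^d$, and $\mathbb{E}_{\theta_*}$ is expectation under $Y_1,\dots,Y_n$ i.i.d. from $P_{\theta_*}$. $A\asymp B$ means $cB\le A\le c'B$ for universal constants $0<c\le c'<\infty$ (independent of $d,n,s,r$). For $s=0$ the first term in the minimum is read as $+\infty$. *)

theory Defs
  imports "HOL-Probability.Probability"
begin

text \<open>
  The dimension is universally quantified underneath the existentially quantified absolute
  constants, so it cannot be a type. Vectors of dimension \<open>d\<close> are therefore extensional functions
  on the index set \<open>{..<d}\<close>, that is, elements of \<open>space (euclid d)\<close>.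
\<close>

definition euclid :: "nat \<Rightarrow> (nat \<Rightarrow> real) measure" where
  "euclid d = (\<Pi>\<^sub>M i\<in>{..<d}. lborel)"

definition vnorm :: "nat \<Rightarrow> (nat \<Rightarrow> real) \<Rightarrow> real" where
  "vnorm d x = L2_set x {..<d}"

text \<open>
  The Gaussian \<open>N(\<theta>, I\<^sub>d)\<close>, given by its Lebesgue density.
  Only the values \<open>\<theta> i\<close> with \<open>i < d\<close> matter.
\<close>

definition gauss :: "nat \<Rightarrow> (nat \<Rightarrow> real) \<Rightarrow> (nat \<Rightarrow> real) measure" where
  "gauss d \<theta> = density (euclid d)
     (\<lambda>x. ennreal (exp (- (vnorm d (\<lambda>i. x i - \<theta> i))\<^sup>2 / 2) / sqrt (2 * pi) ^ d))"

definition gmix :: "nat \<Rightarrow> (nat \<Rightarrow> real) \<Rightarrow> (nat \<Rightarrow> real) measure" where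
  "gmix d \<theta> = measure_of (space (euclid d)) (sets (euclid d))
     (\<lambda>A. 1 / 2 * emeasure (gauss d (\<lambda>i. - \<theta> i)) A + 1 / 2 * emeasure (gauss d \<theta>) A)"

definition sample :: "nat \<Rightarrow> nat \<Rightarrow> (nat \<Rightarrow> real) \<Rightarrow> (nat \<Rightarrow> nat \<Rightarrow> real) measure" where
  "sample d n \<theta> = (\<Pi>\<^sub>M j\<in>{..<n}. gmix d \<theta>)"

definition estimators :: "nat \<Rightarrow> nat \<Rightarrow> ((nat \<Rightarrow> nat \<Rightarrow> real) \<Rightarrow> nat \<Rightarrow> real) set" where
  "estimators d n = (\<Pi>\<^sub>M j\<in>{..<n}. euclid d) \<rightarrow>\<^sub>M euclid d"

definition loss :: "nat \<Rightarrow> (nat \<Rightarrow> real) \<Rightarrow> (nat \<Rightarrow> real) \<Rightarrow> real" where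
  "loss d t \<theta> = min (vnorm d (\<lambda>i. t i - \<theta> i)) (vnorm d (\<lambda>i. t i + \<theta> i))"

text \<open>
  The risk is a nonnegative Lebesgue integral, hence it is \<open>\<infinity>\<close> for estimators
  whose loss is not integrable.
\<close>

definition minimax_risk :: "nat \<Rightarrow> nat \<Rightarrow> (nat \<Rightarrow> real) set \<Rightarrow> ennreal" where
  "minimax_risk d n \<Theta> =
     (INF est\<in>estimators d n. SUP \<theta>\<in>\<Theta>. \<integral>\<^sup>+ Y. ennreal (loss d (est Y) \<theta>) \<partial>sample d n \<theta>)"

definition vsphere :: "nat \<Rightarrow> real \<Rightarrow> (nat \<Rightarrow> real) set" where
  "vsphere d s = {\<theta> \<in> space (euclid d). vnorm d \<theta> = s}"

definition vball :: "nat \<Rightarrow> real \<Rightarrow> (nat \<Rightarrow> real) set" where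
  "vball d r = {\<theta> \<in> space (euclid d). vnorm d \<theta> \<le> r}"

text \<open>
  The rate over the sphere is computed in \<open>ennreal\<close>, where \<open>1 / 0 = \<infinity>\<close>: for \<open>s = 0\<close> the first
  argument of the minimum is \<open>\<infinity>\<close>.
\<close>

definition sphere_rate :: "nat \<Rightarrow> nat \<Rightarrow> real \<Rightarrow> ennreal" where
  "sphere_rate d n s =
     min (1 / ennreal s * ennreal (real d / real n + sqrt (real d / real n))
            + ennreal (sqrt (real d / real n)))
         (ennreal s)"

definition ball_rate :: "nat \<Rightarrow> nat \<Rightarrow> real \<Rightarrow> ennreal" where
  "ball_rate d n r =
     ennreal (min ((real d / real n) powr (1 / 4) + sqrt (real d / real n)) r)"

lemma sets_gauss [simp, measurable_cong]: "sets (gauss d \<theta>) = sets (euclid d)"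
  and space_gauss [simp]: "space (gauss d \<theta>) = space (euclid d)"
  by (simp_all add: gauss_def)

lemma sets_gmix [simp, measurable_cong]: "sets (gmix d \<theta>) = sets (euclid d)"
  and space_gmix [simp]: "space (gmix d \<theta>) = space (euclid d)"
  by (simp_all add: gmix_def)

lemma gauss_eq_PiM:
  "gauss d \<theta> = (\<Pi>\<^sub>M i\<in>{..<d}. density lborel (\<lambda>x. ennreal (normal_density (\<theta> i) 1 x)))"
proof -
  interpret L: product_sigma_finite "\<lambda>_::nat. lborel :: real measure"
    by unfold_locales
  have ps: "prob_space (density lborel (\<lambda>x. ennreal (normal_density (\<theta> i) 1 x)))" for i
    by (rule prob_space_normal_density) simp
  interpret N: product_prob_space
    "\<lambda>i. density lborel (\<lambda>x. ennreal (normal_density (\<theta> i) 1 x))"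
    using ps by (intro product_prob_spaceI)
  have dens: "exp (- (vnorm d (\<lambda>i. x i - \<theta> i))\<^sup>2 / 2) / sqrt (2 * pi) ^ d
      = (\<Prod>i<d. normal_density (\<theta> i) 1 (x i))" for x
  proof -
    have "(vnorm d (\<lambda>i. x i - \<theta> i))\<^sup>2 = (\<Sum>i<d. (x i - \<theta> i)\<^sup>2)"
      unfolding vnorm_def L2_set_def by (simp add: sum_nonneg)
    then show ?thesis
      by (simp add: normal_density_def prod_dividef sum_divide_distrib
          flip: exp_sum sum_negf)
  qed
  show ?thesis
  proof (rule N.PiM_eqI)
    show "sets (gauss d \<theta>) =
        sets (\<Pi>\<^sub>M i\<in>{..<d}. density lborel (\<lambda>x. ennreal (normal_density (\<theta> i) 1 x)))"
      unfolding sets_gauss euclid_def by (rule sets_PiM_cong) simp_all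
  next
    fix A assume A: "\<And>i. i \<in> {..<d} \<Longrightarrow>
      A i \<in> sets (density lborel (\<lambda>x. ennreal (normal_density (\<theta> i) 1 x)))"
    then have A': "\<And>i. i \<in> {..<d} \<Longrightarrow> A i \<in> sets borel" by simp
    have PA: "Pi\<^sub>E {..<d} A \<in> sets (\<Pi>\<^sub>M i\<in>{..<d}. (lborel :: real measure))"
      using A' by (intro sets_PiM_I_finite) auto
    have "emeasure (gauss d \<theta>) (Pi\<^sub>E {..<d} A)
      = (\<integral>\<^sup>+ x. ennreal (\<Prod>i<d. normal_density (\<theta> i) 1 (x i)) * indicator (Pi\<^sub>E {..<d} A) x
           \<partial>(\<Pi>\<^sub>M i\<in>{..<d}. lborel))"
      unfolding gauss_def euclid_def dens using PA by (subst emeasure_density) auto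
    also have "\<dots> = (\<integral>\<^sup>+ x. (\<Prod>i<d. ennreal (normal_density (\<theta> i) 1 (x i)) * indicator (A i) (x i))
           \<partial>(\<Pi>\<^sub>M i\<in>{..<d}. lborel))"
    proof (rule nn_integral_cong)
      fix x assume "x \<in> space (\<Pi>\<^sub>M i\<in>{..<d}. (lborel :: real measure))"
      then have x: "x \<in> extensional {..<d}" by (auto simp: space_PiM PiE_def)
      have "indicator (Pi\<^sub>E {..<d} A) x = (\<Prod>i<d. indicator (A i) (x i) :: ennreal)"
      proof (cases "x \<in> Pi\<^sub>E {..<d} A")
        case True
        then show ?thesis by (auto simp: PiE_def Pi_def intro!: prod.neutral[symmetric])
      next
        case False
        then obtain i where "i < d" "x i \<notin> A i" using x by (auto simp: PiE_def)
        then have "(\<Prod>i<d. indicator (A i) (x i) :: ennreal) = 0"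
          by (intro prod_zero bexI[of _ i]) auto
        with False show ?thesis by simp
      qed
      then show "ennreal (\<Prod>i<d. normal_density (\<theta> i) 1 (x i)) * indicator (Pi\<^sub>E {..<d} A) x
        = (\<Prod>i<d. ennreal (normal_density (\<theta> i) 1 (x i)) * indicator (A i) (x i))"
        by (simp add: prod.distrib prod_ennreal)
    qed
    also have "\<dots> = (\<Prod>i<d. \<integral>\<^sup>+ y. ennreal (normal_density (\<theta> i) 1 y) * indicator (A i) y \<partial>lborel)"
      using A' by (intro L.product_nn_integral_prod) auto
    also have "\<dots> = (\<Prod>i<d. emeasure (density lborel (\<lambda>x. ennreal (normal_density (\<theta> i) 1 x))) (A i))"
      using A' by (intro prod.cong) (auto simp: emeasure_density)
    finally show "emeasure (gauss d \<theta>) (Pi\<^sub>E {..<d} A)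
      = (\<Prod>i\<in>{..<d}. emeasure (density lborel (\<lambda>x. ennreal (normal_density (\<theta> i) 1 x))) (A i))" .
  qed simp
qed

lemma prob_space_gauss: "prob_space (gauss d \<theta>)"
  unfolding gauss_eq_PiM by (intro prob_space_PiM prob_space_normal_density) simp

lemma emeasure_gmix:
  assumes "A \<in> sets (euclid d)"
  shows "emeasure (gmix d \<theta>) A =
    1 / 2 * emeasure (gauss d (\<lambda>i. - \<theta> i)) A + 1 / 2 * emeasure (gauss d \<theta>) A"
proof (rule emeasure_measure_of[OF gmix_def])
  show "sets (euclid d) \<subseteq> Pow (space (euclid d))" by (rule sets.space_closed)
  show "countably_additive (sets (gmix d \<theta>))
     (\<lambda>A. 1 / 2 * emeasure (gauss d (\<lambda>i. - \<theta> i)) A + 1 / 2 * emeasure (gauss d \<theta>) A)"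
  proof (rule countably_additiveI)
    fix B :: "nat \<Rightarrow> (nat \<Rightarrow> real) set"
    assume "range B \<subseteq> sets (gmix d \<theta>)" "disjoint_family B"
    then have "(\<Sum>i. emeasure (gauss d t) (B i)) = emeasure (gauss d t) (\<Union>i. B i)" for t
      by (intro suminf_emeasure) auto
    then show "(\<Sum>i. 1 / 2 * emeasure (gauss d (\<lambda>i. - \<theta> i)) (B i) + 1 / 2 * emeasure (gauss d \<theta>) (B i))
      = 1 / 2 * emeasure (gauss d (\<lambda>i. - \<theta> i)) (\<Union>i. B i) + 1 / 2 * emeasure (gauss d \<theta>) (\<Union>i. B i)"
      by (simp add: ennreal_suminf_cmult flip: suminf_add)
  qed
qed (use assms in \<open>auto simp: positive_def\<close>)

lemma prob_space_gmix: "prob_space (gmix d \<theta>)"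
proof
  have "emeasure (gauss d t) (space (euclid d)) = 1" for t
    using prob_space.emeasure_space_1[OF prob_space_gauss, of d t] by simp
  then have "emeasure (gmix d \<theta>) (space (euclid d)) = 1 / 2 + 1 / 2"
    by (simp add: emeasure_gmix)
  also have "\<dots> = (1 :: ennreal)"
    by (simp flip: add_divide_distrib_ennreal)
  finally show "emeasure (gmix d \<theta>) (space (gmix d \<theta>)) = 1" by simp
qed

lemma prob_space_sample: "prob_space (sample d n \<theta>)"
  unfolding sample_def by (intro prob_space_PiM prob_space_gmix)

end

theory Submission
  imports Defs
begin

text \<open>
  Write \<open>\<rho> = d / n\<close> and \<open>s = \<parallel>\<theta>\<parallel>\<close>.

  \<^bold>\<open>Upper bounds.\<close> For a direction \<open>v\<close> the mean of \<open>(v \<bullet> Y)\<^sup>2\<close> is \<open>\<parallel>v\<parallel>\<^sup>2 + (v \<bullet> \<theta>)\<^sup>2\<close>, so the data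
  estimate the quadratic form \<open>v \<mapsto> (v \<bullet> \<theta>)\<^sup>2\<close>, which determines \<open>\<theta>\<close> exactly up to sign. The
  dependence is quantitative: \<open>(v \<bullet> a)\<^sup>2 - (v \<bullet> b)\<^sup>2 = (v \<bullet> (a - b)) (v \<bullet> (a + b))\<close>, and the direction
  bisecting \<open>a - b\<close> and \<open>\<plusminus>(a + b)\<close> makes both factors large at once. Hence a fit of the two
  forms up to \<open>D\<close> on a finite net of directions bounds \<open>\<parallel>a - b\<parallel> \<parallel>a + b\<parallel>\<close> by \<open>4 D\<close>, and as one of
  the two factors is the loss and the other is at least \<open>s\<close> and at least the loss, it bounds both
  \<open>s\<close> times the loss and the squared loss (\<open>loss_times_max_le\<close>). The form is fitted uniformly over
  the net with expected error of order \<open>\<rho> + \<surd>\<rho> (1 + s)\<close>: under \<open>P\<^sub>\<theta>\<close> the variable \<open>(v \<bullet> Y)\<^sup>2\<close> is a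
  multiple of a noncentral chi-square variable, whose centred moment generating function is sub-Gaussian near
  \<open>0\<close> with variance factor of order \<open>1 + s\<^sup>2\<close>, and the net has only exponentially many points
  (\<open>uniform_deviation_bound\<close>). Dividing by \<open>s\<close> gives the rate on the sphere. On the ball the same
  estimator, which does not know \<open>s\<close>, is analysed through the squared loss when \<open>s\<close> is small.
  The radius itself is attained by the estimator \<open>0\<close>.

  \<^bold>\<open>Lower bound on the sphere.\<close> The hard means have a large common first coordinate and
  coordinates \<open>\<plusminus>h\<close> elsewhere. The first coordinate fixes the sign, so the loss dominates a
  multiple of the Hamming distance of the sign patterns, and Assouad's argument (\<open>assouad\<close>) reduces
  the bound to testing between two means \<open>m - h e\<^sub>i\<close> and \<open>m + h e\<^sub>i\<close> with \<open>m\<^sub>i = 0\<close>. These have the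
  same norm, so the likelihood ratio of the mixtures is a quotient of two hyperbolic cosines, and
  its chi-square divergence is of order \<open>h\<^sup>2 min {1, \<parallel>m\<parallel>\<^sup>2}\<close>: the factor \<open>h\<^sup>2\<close> is the Fisher
  information bound of the Gaussian location model, and the factor \<open>\<parallel>m\<parallel>\<^sup>2\<close> is what the unknown
  sign costs when the signal is weak (\<open>likelihood_ratio_second_moment_le\<close>). Choosing \<open>h\<^sup>2\<close> of order
  \<open>min {s\<^sup>2 / d, 1 / (n min {1, s\<^sup>2})}\<close> keeps \<open>n\<close> samples indistinguishable.

  \<^bold>\<open>Lower bound on the ball.\<close> For \<open>d \<ge> 2\<close> it is the bound on the sphere whose radius is the
  smaller of \<open>r\<close> and \<open>\<rho>\<^bsup>1/4\<^esup> + \<surd>\<rho>\<close>, up to which the sphere rate is of order \<open>s\<close>. On the line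
  a sphere is a single point up to sign, and the mean \<open>0\<close> is tested against a mean of norm of order
  \<open>min {r, n\<^bsup>-1/4\<^esup>}\<close> instead.
\<close>

section \<open>Inner product and norm of coordinate vectors\<close>

definition vdot :: "nat \<Rightarrow> (nat \<Rightarrow> real) \<Rightarrow> (nat \<Rightarrow> real) \<Rightarrow> real" where
  "vdot d x y = (\<Sum>i<d. x i * y i)"

lemma vnorm_nonneg [simp]: "0 \<le> vnorm d x"
  by (simp add: vnorm_def)

lemma vnorm_power2: "(vnorm d x)\<^sup>2 = (\<Sum>i<d. (x i)\<^sup>2)"
  by (simp add: vnorm_def L2_set_def sum_nonneg)

lemma vdot_self: "vdot d x x = (vnorm d x)\<^sup>2"
  unfolding vnorm_power2 by (simp add: vdot_def power2_eq_square)

lemma vdot_commute: "vdot d x y = vdot d y x"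
  by (simp add: vdot_def mult.commute)

lemma vdot_add_left: "vdot d (\<lambda>i. x i + y i) z = vdot d x z + vdot d y z"
  and vdot_diff_left: "vdot d (\<lambda>i. x i - y i) z = vdot d x z - vdot d y z"
  and vdot_minus_left: "vdot d (\<lambda>i. - x i) z = - vdot d x z"
  and vdot_divide_left: "vdot d (\<lambda>i. x i / c) z = vdot d x z / c"
  by (simp_all add: vdot_def algebra_simps sum.distrib sum_subtractf sum_negf sum_divide_distrib)

lemma vdot_add_right: "vdot d z (\<lambda>i. x i + y i) = vdot d z x + vdot d z y"
  and vdot_diff_right: "vdot d z (\<lambda>i. x i - y i) = vdot d z x - vdot d z y"
  and vdot_minus_right: "vdot d z (\<lambda>i. - x i) = - vdot d z x"
  and vdot_divide_right: "vdot d z (\<lambda>i. x i / c) = vdot d z x / c"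
  by (simp_all add: vdot_def algebra_simps sum.distrib sum_subtractf sum_negf sum_divide_distrib)

lemma abs_vdot_le: "\<bar>vdot d x y\<bar> \<le> vnorm d x * vnorm d y"
proof -
  have "\<bar>vdot d x y\<bar> \<le> (\<Sum>i<d. \<bar>x i\<bar> * \<bar>y i\<bar>)"
    unfolding vdot_def by (rule order_trans[OF sum_abs]) (simp add: abs_mult)
  also have "\<dots> \<le> vnorm d x * vnorm d y"
    unfolding vnorm_def by (rule L2_set_mult_ineq)
  finally show ?thesis .
qed

lemma vnorm_add_le: "vnorm d (\<lambda>i. x i + y i) \<le> vnorm d x + vnorm d y"
  unfolding vnorm_def by (rule L2_set_triangle_ineq)

lemma vnorm_minus [simp]: "vnorm d (\<lambda>i. - x i) = vnorm d x"
  by (simp add: vnorm_def L2_set_def)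

lemma vnorm_diff_le: "vnorm d (\<lambda>i. x i - y i) \<le> vnorm d x + vnorm d y"
  using vnorm_add_le[of d x "\<lambda>i. - y i"] by simp

lemma vnorm_divide: "vnorm d (\<lambda>i. x i / c) = vnorm d x / \<bar>c\<bar>"
  by (simp add: vnorm_def L2_set_def power_divide real_sqrt_divide flip: sum_divide_distrib)

lemma component_le_vnorm: "i < d \<Longrightarrow> \<bar>x i\<bar> \<le> vnorm d x"
  using member_le_L2_set[of "{..<d}" i "\<lambda>i. \<bar>x i\<bar>"]
  by (simp add: vnorm_def L2_set_def)

lemma vnorm_le_componentwise:
  assumes "\<And>i. i < d \<Longrightarrow> \<bar>x i\<bar> \<le> c" "0 \<le> c"
  shows "vnorm d x \<le> sqrt (real d) * c"
proof -
  have "(\<Sum>i<d. (x i)\<^sup>2) \<le> (\<Sum>i<d. c\<^sup>2)"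
    using assms by (intro sum_mono) (metis abs_ge_zero lessThan_iff power2_abs power_mono)
  then have "vnorm d x \<le> sqrt (real d * c\<^sup>2)"
    by (simp add: vnorm_def L2_set_def)
  then show ?thesis using assms by (simp add: real_sqrt_mult)
qed

section \<open>Distance up to sign and quadratic forms\<close>

text \<open>
  The normalised sum of \<open>x\<close> and \<open>y\<close> serves when their angle is at most a right angle; otherwise
  \<open>y\<close> is replaced by \<open>-y\<close>, which leaves the absolute value of the product unchanged.
\<close>

lemma unit_direction_bisecting:
  assumes x: "vnorm d x = 1" and y: "vnorm d y = 1"
  obtains u where "vnorm d u = 1" "\<bar>vdot d u x * vdot d u y\<bar> \<ge> 1 / 2"
proof -
  have main: "\<exists>u. vnorm d u = 1 \<and> \<bar>vdot d u x * vdot d u z\<bar> \<ge> 1 / 2"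
    if z: "vnorm d z = 1" and nn: "vdot d x z \<ge> 0" for z
  proof -
    define c where "c = vdot d x z"
    define w where "w = vnorm d (\<lambda>i. x i + z i)"
    have w2: "w\<^sup>2 = 2 + 2 * c"
      unfolding w_def vdot_self[symmetric] vdot_add_left vdot_add_right
      using x z by (simp add: vdot_self vdot_commute[of d z x] c_def)
    have w: "w > 0"
      using w2 nn by (metis c_def w_def add_pos_nonneg less_eq_real_def mult_nonneg_nonneg
          power_zero_numeral vnorm_nonneg zero_less_numeral order_less_irrefl)
    define u where "u = (\<lambda>i. (x i + z i) / w)"
    have "vdot d u x * vdot d u z = ((1 + c) / w) * ((1 + c) / w)"
      unfolding u_def vdot_divide_left vdot_add_left
      using x z by (simp add: vdot_self vdot_commute[of d z x] c_def)
    also have "\<dots> = (1 + c)\<^sup>2 / (2 + 2 * c)"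
      by (simp add: power2_eq_square flip: w2)
    also have "\<dots> = (1 + c) / 2"
      using nn by (simp add: c_def power2_eq_square field_simps)
    finally have "\<bar>vdot d u x * vdot d u z\<bar> \<ge> 1 / 2" using nn by (simp add: c_def)
    moreover have "vnorm d u = 1"
      using w by (simp add: u_def vnorm_divide flip: w_def)
    ultimately show ?thesis by blast
  qed
  show ?thesis
  proof (cases "vdot d x y \<ge> 0")
    case True
    then show ?thesis using main[OF y] that by blast
  next
    case False
    then show ?thesis
      using main[of "\<lambda>i. - y i"] y that by (auto simp: vdot_minus_right)
  qed
qed

text \<open>
  The points lie in the closed unit ball rather than on the sphere, because this is what rounding
  to a lattice produces. The origin is excluded so that every projection \<open>v \<bullet> Y\<close> is a nondegenerate
  Gaussian.
\<close>

definition sphere_net :: "nat \<Rightarrow> (nat \<Rightarrow> real) set \<Rightarrow> bool" where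
  "sphere_net d N \<longleftrightarrow> finite N \<and> (\<forall>v\<in>N. 0 < vnorm d v \<and> vnorm d v \<le> 1) \<and>
     (\<forall>u. vnorm d u = 1 \<longrightarrow> (\<exists>v\<in>N. vnorm d (\<lambda>i. u i - v i) \<le> 1 / 8))"

text \<open>
  The difference of the two squares is \<open>(v \<bullet> (a - b)) (v \<bullet> (a + b))\<close>. On the unit directions \<open>x\<close>, \<open>y\<close>
  of the two vectors some unit \<open>u\<close> makes the product of the projections at least \<open>1/2\<close>, and moving
  \<open>u\<close> to a net point at distance \<open>1/8\<close> loses at most \<open>1/4\<close> of it.
\<close>

lemma net_controls_sign_invariant_distance:
  assumes N: "sphere_net d N" and D: "0 \<le> D"
    and le: "\<And>v. v \<in> N \<Longrightarrow> \<bar>(vdot d v a)\<^sup>2 - (vdot d v b)\<^sup>2\<bar> \<le> D"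
  shows "vnorm d (\<lambda>i. a i - b i) * vnorm d (\<lambda>i. a i + b i) \<le> 4 * D"
proof -
  define p where "p = vnorm d (\<lambda>i. a i - b i)"
  define q where "q = vnorm d (\<lambda>i. a i + b i)"
  show ?thesis
  proof (cases "p = 0 \<or> q = 0")
    case True
    then show ?thesis using D by (auto simp: p_def q_def)
  next
    case False
    then have pq: "p > 0" "q > 0"
      using vnorm_nonneg by (auto simp: p_def q_def less_le)
    define x where "x = (\<lambda>i. (a i - b i) / p)"
    define y where "y = (\<lambda>i. (a i + b i) / q)"
    have x1: "vnorm d x = 1" and y1: "vnorm d y = 1"
      using pq by (simp_all add: x_def y_def vnorm_divide flip: p_def q_def)
    obtain u where u: "vnorm d u = 1" "\<bar>vdot d u x * vdot d u y\<bar> \<ge> 1 / 2"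
      using unit_direction_bisecting[OF x1 y1] .
    obtain v where v: "v \<in> N" "vnorm d (\<lambda>i. u i - v i) \<le> 1 / 8"
      using N u(1) unfolding sphere_net_def by blast
    \<comment> \<open>Replacing \<open>u\<close> by \<open>v\<close> changes each projection by at most \<open>1/8\<close>, and all projections are at most \<open>1\<close>.\<close>
    have vx: "\<bar>vdot d u x - vdot d v x\<bar> \<le> 1 / 8" and vy: "\<bar>vdot d u y - vdot d v y\<bar> \<le> 1 / 8"
      using abs_vdot_le[of d "\<lambda>i. u i - v i" x] abs_vdot_le[of d "\<lambda>i. u i - v i" y] v(2) x1 y1
      by (simp_all add: vdot_diff_left)
    have ux: "\<bar>vdot d u x\<bar> \<le> 1" and vy1: "\<bar>vdot d v y\<bar> \<le> 1"
      using abs_vdot_le[of d u x] abs_vdot_le[of d v y] u(1) x1 y1 N v(1)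
      by (auto simp: sphere_net_def intro: order_trans)
    have "vdot d u x * vdot d u y - vdot d v x * vdot d v y
      = vdot d u x * (vdot d u y - vdot d v y) + vdot d v y * (vdot d u x - vdot d v x)"
      by (simp add: algebra_simps)
    also have "\<bar>\<dots>\<bar> \<le> 1 * (1 / 8) + 1 * (1 / 8)"
      by (rule order_trans[OF abs_triangle_ineq], unfold abs_mult)
        (intro add_mono mult_mono ux vy vx vy1; simp)
    finally have "\<bar>vdot d v x * vdot d v y\<bar> \<ge> 1 / 4" using u(2) by linarith
    moreover have "(vdot d v a)\<^sup>2 - (vdot d v b)\<^sup>2 = p * q * (vdot d v x * vdot d v y)"
      unfolding x_def y_def vdot_divide_right vdot_add_right vdot_diff_right
      using pq by (simp add: power2_eq_square square_diff_square_factored)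
    then have "p * q * \<bar>vdot d v x * vdot d v y\<bar> \<le> D"
      using le[OF v(1)] pq by (simp add: abs_mult)
    ultimately have "p * q * (1 / 4) \<le> D"
      using pq by (meson mult_left_mono mult_nonneg_nonneg order_trans less_imp_le)
    then show ?thesis by (simp add: p_def q_def)
  qed
qed

lemma loss_nonneg [simp]: "0 \<le> loss d t \<theta>"
  by (simp add: loss_def)

text \<open>
  The loss is the smaller of \<open>\<parallel>t - \<theta>\<parallel>\<close> and \<open>\<parallel>t + \<theta>\<parallel>\<close>, while the larger is at least \<open>\<parallel>\<theta>\<parallel>\<close> because
  \<open>2 \<theta>\<close> is the difference of \<open>t + \<theta>\<close> and \<open>t - \<theta>\<close>.
\<close>

lemma loss_times_max_le:
  assumes "sphere_net d N" "0 \<le> D"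
    and "\<And>v. v \<in> N \<Longrightarrow> \<bar>(vdot d v t)\<^sup>2 - (vdot d v \<theta>)\<^sup>2\<bar> \<le> D"
  shows "vnorm d \<theta> * loss d t \<theta> \<le> 4 * D" and "(loss d t \<theta>)\<^sup>2 \<le> 4 * D"
proof -
  define p where "p = vnorm d (\<lambda>i. t i - \<theta> i)"
  define q where "q = vnorm d (\<lambda>i. t i + \<theta> i)"
  have pq: "p * q \<le> 4 * D" "0 \<le> p" "0 \<le> q"
    using net_controls_sign_invariant_distance[OF assms] by (simp_all add: p_def q_def)
  have "2 * vnorm d \<theta> = vnorm d (\<lambda>i. 2 * \<theta> i)"
    using vnorm_divide[of d \<theta> "1/2"] by (simp add: mult.commute)
  also have "\<dots> = vnorm d (\<lambda>i. (t i + \<theta> i) - (t i - \<theta> i))" by (simp add: algebra_simps)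
  also have "\<dots> \<le> q + p" unfolding p_def q_def by (rule vnorm_diff_le)
  finally have s: "vnorm d \<theta> \<le> max p q" by linarith
  have l: "loss d t \<theta> = min p q" by (simp add: loss_def p_def q_def)
  have mm: "min p q * max p q = p * q" by (simp add: min_def max_def)
  show "vnorm d \<theta> * loss d t \<theta> \<le> 4 * D"
    using mult_right_mono[OF s, of "min p q"] pq mm l by (simp add: mult.commute)
  have "min p q * min p q \<le> min p q * max p q" using pq by (intro mult_left_mono) auto
  then show "(loss d t \<theta>)\<^sup>2 \<le> 4 * D" using pq mm l by (simp add: power2_eq_square)
qed

section \<open>A net of the unit sphere\<close>

lemma sum_half_power_abs_le: "(\<Sum>k\<in>{- int m..int m}. (1 / 2) ^ nat \<bar>k\<bar>) \<le> (3 :: real)"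
proof -
  have "(\<Sum>k\<in>{- int m..int m}. (1 / 2) ^ nat \<bar>k\<bar>) = 3 - 2 * (1 / 2 :: real) ^ m"
  proof (induction m)
    case (Suc m)
    have "{- int (Suc m)..int (Suc m)} = insert (- int (Suc m)) (insert (int (Suc m)) {- int m..int m})"
      by auto
    then show ?case using Suc by (simp add: nat_add_distrib)
  qed simp
  then show ?thesis by simp
qed

text \<open>
  Each lattice point \<open>k\<close> of the ball has weight \<open>2\<^bsup>b - \<parallel>k\<parallel>\<^sub>1\<^esup> \<ge> 1\<close>, and the sum of these weights over
  the whole box factorises over the coordinates. This replaces a volume comparison.
\<close>

lemma card_l1_lattice_ball_le:
  "card {k \<in> (\<Pi>\<^sub>E i\<in>{..<d}. {- int m..int m}). (\<Sum>i<d. nat \<bar>k i\<bar>) \<le> b} \<le> 2 ^ b * 3 ^ d"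
proof -
  let ?P = "\<Pi>\<^sub>E i\<in>{..<d}. {- int m..int m}"
  let ?K = "{k \<in> ?P. (\<Sum>i<d. nat \<bar>k i\<bar>) \<le> b}"
  have fin: "finite ?P" by (intro finite_PiE) auto
  have ge1: "1 \<le> 2 ^ b * (\<Prod>i<d. (1 / 2 :: real) ^ nat \<bar>k i\<bar>)" if "k \<in> ?K" for k
  proof -
    have "(1 / 2 :: real) ^ b \<le> (1 / 2) ^ (\<Sum>i<d. nat \<bar>k i\<bar>)"
      using that by (intro power_decreasing) auto
    then have "2 ^ b * (1 / 2 :: real) ^ b \<le> 2 ^ b * (\<Prod>i<d. (1 / 2 :: real) ^ nat \<bar>k i\<bar>)"
      by (intro mult_left_mono) (simp_all add: power_sum)
    then show ?thesis by (simp add: power_divide)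
  qed
  have "real (card ?K) = (\<Sum>k\<in>?K. 1)" by simp
  also have "\<dots> \<le> (\<Sum>k\<in>?K. 2 ^ b * (\<Prod>i<d. (1 / 2 :: real) ^ nat \<bar>k i\<bar>))"
    by (intro sum_mono ge1)
  also have "\<dots> \<le> (\<Sum>k\<in>?P. 2 ^ b * (\<Prod>i<d. (1 / 2 :: real) ^ nat \<bar>k i\<bar>))"
  proof (rule sum_mono2[OF fin])
    show "?K \<subseteq> ?P" by blast
    show "0 \<le> 2 ^ b * (\<Prod>i<d. (1 / 2 :: real) ^ nat \<bar>k i\<bar>)" for k
      by (simp add: prod_nonneg)
  qed
  also have "\<dots> = 2 ^ b * (\<Prod>i<d. \<Sum>k\<in>{- int m..int m}. (1 / 2 :: real) ^ nat \<bar>k\<bar>)"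
    by (subst prod_sum_PiE) (auto simp: sum_distrib_left)
  also have "\<dots> \<le> 2 ^ b * (\<Prod>i<d. 3)"
    by (intro mult_left_mono prod_mono conjI sum_half_power_abs_le sum_nonneg) auto
  finally have "real (card ?K) \<le> real (2 ^ b * 3 ^ d)" by simp
  then show ?thesis by (simp only: of_nat_le_iff)
qed

text \<open>
  The net consists of points of the lattice with mesh \<open>1 / (8 \<surd>d)\<close>. By Cauchy--Schwarz a unit
  vector rounds to a lattice point whose integer coordinates have absolute sum at most \<open>8 d\<close>, so
  there are at most \<open>2\<^bsup>8d\<^esup> 3\<^sup>d\<close> of them.
\<close>

lemma sphere_net_exists:
  assumes d: "d \<ge> 1"
  shows "\<exists>N. sphere_net d N \<and> card N \<le> 768 ^ d"
proof -
  define K where "K = 8 * sqrt (real d)"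
  have K: "K > 0" using d by (simp add: K_def)
  define KS where "KS = {k \<in> (\<Pi>\<^sub>E i\<in>{..<d}. {- int (8 * d)..int (8 * d)}). (\<Sum>i<d. nat \<bar>k i\<bar>) \<le> 8 * d}"
  define N where "N = {v \<in> (\<lambda>k i. real_of_int (k i) / K) ` KS. 0 < vnorm d v \<and> vnorm d v \<le> 1}"
  have finKS: "finite KS" unfolding KS_def
    by (rule finite_subset[OF _ finite_PiE[of "{..<d}" "\<lambda>_. {- int (8 * d)..int (8 * d)}"]]) auto
  have "card N \<le> card ((\<lambda>k i. real_of_int (k i) / K) ` KS)"
    unfolding N_def using finKS by (intro card_mono) auto
  also have "\<dots> \<le> card KS" using finKS by (rule card_image_le)
  also have "\<dots> \<le> 2 ^ (8 * d) * 3 ^ d" unfolding KS_def by (rule card_l1_lattice_ball_le)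
  also have "\<dots> = 768 ^ d" unfolding power_mult power_mult_distrib[symmetric] by simp
  finally have card: "card N \<le> 768 ^ d" .
  have "\<exists>v\<in>N. vnorm d (\<lambda>i. u i - v i) \<le> 1 / 8" if u: "vnorm d u = 1" for u
  proof -
    \<comment> \<open>Rounding towards zero keeps the lattice point inside the unit ball.\<close>
    define k :: "nat \<Rightarrow> int" where
      "k = (\<lambda>i\<in>{..<d}. if u i \<ge> 0 then \<lfloor>u i * K\<rfloor> else - \<lfloor>- u i * K\<rfloor>)"
    have absk: "real_of_int \<bar>k i\<bar> \<le> \<bar>u i\<bar> * K" if "i < d" for i
    proof (cases "u i \<ge> 0")
      case True
      then have "0 \<le> \<lfloor>u i * K\<rfloor>" using K by simp
      then show ?thesis using that True by (simp add: k_def)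
    next
      case False
      then have "0 \<le> \<lfloor>- u i * K\<rfloor>" using K by (simp add: mult_nonpos_nonneg)
      moreover have "real_of_int \<lfloor>- u i * K\<rfloor> \<le> - u i * K" by (rule of_int_floor_le)
      ultimately show ?thesis using that False by (simp add: k_def)
    qed
    have diff: "\<bar>u i * K - real_of_int (k i)\<bar> \<le> 1" if "i < d" for i
    proof -
      have "\<bar>y - real_of_int \<lfloor>y\<rfloor>\<bar> \<le> 1" for y :: real by linarith
      from this[of "u i * K"] this[of "- u i * K"] show ?thesis
        using that by (auto simp: k_def) linarith
    qed
    have "real (\<Sum>i<d. nat \<bar>k i\<bar>) = (\<Sum>i<d. real_of_int \<bar>k i\<bar>)" by simp
    also have "\<dots> \<le> (\<Sum>i<d. \<bar>u i\<bar> * \<bar>1\<bar>) * K"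
      unfolding sum_distrib_right using absk by (intro sum_mono) simp
    also have "\<dots> \<le> (vnorm d u * L2_set (\<lambda>_. 1) {..<d}) * K"
      unfolding vnorm_def using K by (intro mult_right_mono L2_set_mult_ineq) auto
    also have "\<dots> = real (8 * d)"
      using u by (simp add: L2_set_constant K_def)
    finally have sum: "(\<Sum>i<d. nat \<bar>k i\<bar>) \<le> 8 * d" by (simp only: of_nat_le_iff)
    have "\<bar>k i\<bar> \<le> int (8 * d)" if "i < d" for i
    proof -
      have "nat \<bar>k i\<bar> \<le> (\<Sum>i<d. nat \<bar>k i\<bar>)" using that by (intro member_le_sum) auto
      then show ?thesis using sum by linarith
    qed
    then have kKS: "k \<in> KS" using sum by (auto simp: KS_def k_def abs_le_iff minus_le_iff)
    define v where "v = (\<lambda>i. real_of_int (k i) / K)"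
    have "vnorm d v \<le> vnorm d u"
      unfolding vnorm_def L2_set_def
    proof (intro real_sqrt_le_mono sum_mono)
      fix i assume "i \<in> {..<d}"
      then have "\<bar>v i\<bar> \<le> \<bar>u i\<bar>" using absk[of i] K by (simp add: v_def field_simps)
      then show "(v i)\<^sup>2 \<le> (u i)\<^sup>2" by (simp add: abs_le_square_iff)
    qed
    moreover have near: "vnorm d (\<lambda>i. u i - v i) \<le> 1 / 8"
    proof -
      have "vnorm d (\<lambda>i. u i - v i) \<le> sqrt (real d) * (1 / K)"
      proof (rule vnorm_le_componentwise)
        fix i assume "i < d"
        have "u i - v i = (u i * K - real_of_int (k i)) / K"
          using K by (simp add: v_def field_simps)
        then have "\<bar>u i - v i\<bar> = \<bar>u i * K - real_of_int (k i)\<bar> / K"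
          using K by (simp add: abs_divide)
        also have "\<dots> \<le> 1 / K" using diff[OF \<open>i < d\<close>] K by (simp add: divide_right_mono)
        finally show "\<bar>u i - v i\<bar> \<le> 1 / K" .
      qed (use K in simp)
      also have "\<dots> = 1 / 8" using d by (simp add: K_def)
      finally show ?thesis .
    qed
    moreover have "vnorm d u \<le> vnorm d (\<lambda>i. u i - v i) + vnorm d v"
      using vnorm_add_le[of d "\<lambda>i. u i - v i" v] by simp
    ultimately have "v \<in> N" using u kKS by (auto simp: N_def v_def)
    with near show ?thesis by blast
  qed
  then have "sphere_net d N" using finKS unfolding sphere_net_def by (auto simp: N_def)
  with card show ?thesis by blast
qed

section \<open>Gaussian projections and the density of the mixture\<close>

lemma measurable_component_euclid [measurable]: "i < d \<Longrightarrow> (\<lambda>x. x i) \<in> borel_measurable (euclid d)"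
  using measurable_component_singleton[of i "{..<d}" "\<lambda>_. lborel :: real measure"]
  by (simp add: euclid_def)

lemma borel_measurable_vdot [measurable]: "vdot d v \<in> borel_measurable (euclid d)"
  unfolding vdot_def[abs_def] by (intro borel_measurable_sum borel_measurable_times) simp_all

text \<open>
  Only the coordinates with \<open>v i \<noteq> 0\<close> are summed, since the convolution theorem for normal
  densities asks for positive variances.
\<close>

lemma distributed_vdot_gauss:
  assumes v: "0 < vnorm d v"
  shows "distributed (gauss d \<theta>) lborel (vdot d v)
    (\<lambda>y. ennreal (normal_density (vdot d v \<theta>) (vnorm d v) y))"
proof -
  define G where "G i = density lborel (\<lambda>x. ennreal (normal_density (\<theta> i) 1 x))" for i
  have pG: "prob_space (G i)" for i
    unfolding G_def by (rule prob_space_normal_density) simp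
  interpret prob_space "gauss d \<theta>" by (rule prob_space_gauss)
  have gauss: "gauss d \<theta> = (\<Pi>\<^sub>M i\<in>{..<d}. G i)"
    unfolding G_def by (rule gauss_eq_PiM)
  define J where "J = {i. i < d \<and> v i \<noteq> 0}"
  have J: "finite J" "J \<subseteq> {..<d}" by (auto simp: J_def)
  have "J \<noteq> {}"
  proof
    assume "J = {}"
    then have "vnorm d v = 0" by (auto simp: J_def vnorm_def L2_set_eq_0_iff)
    with v show False by simp
  qed
  have comp: "distr (gauss d \<theta>) borel (\<lambda>x. x i) = G i" if "i < d" for i
  proof -
    have "distr (gauss d \<theta>) (G i) (\<lambda>x. x i) = G i"
      unfolding gauss using that pG by (intro distr_PiM_component) auto
    moreover have "distr (gauss d \<theta>) (G i) (\<lambda>x. x i) = distr (gauss d \<theta>) borel (\<lambda>x. x i)"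
      by (intro distr_cong) (simp_all add: G_def)
    ultimately show ?thesis by simp
  qed
  have meas: "(\<lambda>x. x i) \<in> borel_measurable (gauss d \<theta>)" if "i < d" for i
    using measurable_component_euclid[OF that] by (simp cong: measurable_cong_sets)
  have "indep_vars (\<lambda>_. borel) (\<lambda>i x. x i) {..<d}"
  proof (subst indep_vars_iff_distr_eq_PiM')
    show "{..<d} \<noteq> {}" using \<open>J \<noteq> {}\<close> J by auto
    show "random_variable borel (\<lambda>x. x i)" if "i \<in> {..<d}" for i using meas that by simp
    have sets: "sets (\<Pi>\<^sub>M i\<in>{..<d}. borel) = sets (gauss d \<theta>)"
      unfolding sets_gauss euclid_def by (intro sets_PiM_cong) simp_all
    have "distr (gauss d \<theta>) (\<Pi>\<^sub>M i\<in>{..<d}. borel) (\<lambda>x. \<lambda>i\<in>{..<d}. x i)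
        = distr (gauss d \<theta>) (gauss d \<theta>) (\<lambda>x. x)"
    proof (intro distr_cong sets refl)
      fix x assume "x \<in> space (gauss d \<theta>)"
      then show "(\<lambda>i\<in>{..<d}. x i) = x"
        by (auto simp: euclid_def space_PiM PiE_def extensional_restrict)
    qed
    also have "\<dots> = (\<Pi>\<^sub>M i\<in>{..<d}. distr (gauss d \<theta>) borel (\<lambda>x. x i))"
      unfolding distr_id gauss by (intro PiM_cong refl) (simp add: comp flip: gauss)
    finally show "distr (gauss d \<theta>) (\<Pi>\<^sub>M i\<in>{..<d}. borel) (\<lambda>x. \<lambda>i\<in>{..<d}. x i)
        = (\<Pi>\<^sub>M i\<in>{..<d}. distr (gauss d \<theta>) borel (\<lambda>x. x i))" .
  qed
  then have "indep_vars (\<lambda>_. borel) (\<lambda>i x. x i) J"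
    using J(2) by (rule indep_vars_subset)
  then have ind: "indep_vars (\<lambda>_. borel) (\<lambda>i x. v i * x i) J"
    by (rule indep_vars_compose2) simp
  have "distributed (gauss d \<theta>) lborel (\<lambda>x. x i) (\<lambda>y. ennreal (normal_density (\<theta> i) 1 y))" if "i < d" for i
    unfolding distributed_def
  proof (intro conjI)
    show "distr (gauss d \<theta>) lborel (\<lambda>x. x i) = density lborel (\<lambda>y. ennreal (normal_density (\<theta> i) 1 y))"
      using comp[OF that] by (simp add: G_def cong: distr_cong)
    show "(\<lambda>x. x i) \<in> gauss d \<theta> \<rightarrow>\<^sub>M lborel" using meas[OF that] by simp
  qed simp
  then have norm: "distributed (gauss d \<theta>) lborel (\<lambda>x. v i * x i)
      (\<lambda>y. ennreal (normal_density (v i * \<theta> i) \<bar>v i\<bar> y))" if "i \<in> J" for i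
    using normal_density_affine[of "\<lambda>x. x i" "\<theta> i" 1 "v i" 0] that by (simp add: J_def)
  have "distributed (gauss d \<theta>) lborel (\<lambda>x. \<Sum>i\<in>J. v i * x i)
      (\<lambda>y. ennreal (normal_density (\<Sum>i\<in>J. v i * \<theta> i) (sqrt (\<Sum>i\<in>J. \<bar>v i\<bar>\<^sup>2)) y))"
    using J \<open>J \<noteq> {}\<close> ind norm by (intro sum_indep_normal) (auto simp: J_def)
  moreover have "(\<Sum>i\<in>J. v i * x i) = vdot d v x" for x
    unfolding vdot_def by (intro sum.mono_neutral_left) (auto simp: J_def)
  moreover have "(\<Sum>i\<in>J. \<bar>v i\<bar>\<^sup>2) = (\<Sum>i<d. (v i)\<^sup>2)"
    by (simp, intro sum.mono_neutral_left) (auto simp: J_def)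
  ultimately show ?thesis
    by (simp add: vnorm_def L2_set_def fun_eq_iff[symmetric])
qed

lemma borel_measurable_cosh [measurable]: "(cosh :: real \<Rightarrow> real) \<in> borel_measurable borel"
  by (intro borel_measurable_continuous_onI continuous_intros)

lemma gauss_density_tilt:
  "exp (- (vnorm d (\<lambda>i. x i - \<theta> i))\<^sup>2 / 2) / sqrt (2 * pi) ^ d =
   exp (- (vnorm d x)\<^sup>2 / 2) / sqrt (2 * pi) ^ d * exp (vdot d \<theta> x - (vnorm d \<theta>)\<^sup>2 / 2)"
proof -
  have "(vnorm d (\<lambda>i. x i - \<theta> i))\<^sup>2 = (vnorm d x)\<^sup>2 - 2 * vdot d \<theta> x + (vnorm d \<theta>)\<^sup>2"
    by (simp flip: vdot_self add: vdot_diff_left vdot_diff_right vdot_commute[of d x \<theta>])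
  then have "- (vnorm d (\<lambda>i. x i - \<theta> i))\<^sup>2 / 2
      = - (vnorm d x)\<^sup>2 / 2 + (vdot d \<theta> x - (vnorm d \<theta>)\<^sup>2 / 2)" by simp
  then show ?thesis by (simp only: exp_add times_divide_eq_left)
qed

lemma borel_measurable_vnorm [measurable]: "vnorm d \<in> borel_measurable (euclid d)"
  unfolding vnorm_def[abs_def] L2_set_def
  by (intro measurable_compose[OF _ borel_measurable_sqrt] borel_measurable_sum borel_measurable_power) simp

lemma gauss_eq_tilt:
  "gauss d \<theta> = density (euclid d) (\<lambda>x. ennreal
     (exp (- (vnorm d x)\<^sup>2 / 2) / sqrt (2 * pi) ^ d * exp (vdot d \<theta> x - (vnorm d \<theta>)\<^sup>2 / 2)))"
  unfolding gauss_def gauss_density_tilt ..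

text \<open>
  Tilting the standard Gaussian by \<open>exp (\<plusminus>\<theta> \<bullet> x - \<parallel>\<theta>\<parallel>\<^sup>2 / 2)\<close> gives the two components, and averaging
  the two tilts produces the hyperbolic cosine. All likelihood ratios below come from this form.
\<close>

lemma gmix_eq_density_gauss0:
  "gmix d \<theta> = density (gauss d (\<lambda>_. 0)) (\<lambda>x. ennreal (exp (- (vnorm d \<theta>)\<^sup>2 / 2) * cosh (vdot d \<theta> x)))"
proof (rule measure_eqI)
  fix A assume "A \<in> sets (gmix d \<theta>)"
  then have [measurable]: "A \<in> sets (euclid d)" by simp
  define g where "g x = exp (- (vnorm d x)\<^sup>2 / 2) / sqrt (2 * pi) ^ d" for x
  have [measurable]: "g \<in> borel_measurable (euclid d)" unfolding g_def by measurable
  have g0: "0 \<le> g x" for x by (simp add: g_def)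
  have half: "(1 / 2 :: ennreal) = ennreal (1 / 2)"
    using divide_ennreal[of 1 2] by simp
  have gt: "gauss d t = density (euclid d) (\<lambda>x. ennreal (g x * exp (vdot d t x - (vnorm d t)\<^sup>2 / 2)))" for t
    unfolding gauss_eq_tilt g_def ..
  have em: "emeasure (gauss d t) A = (\<integral>\<^sup>+x. ennreal (g x * exp (vdot d t x - (vnorm d t)\<^sup>2 / 2)) * indicator A x \<partial>euclid d)" for t
    unfolding gt by (rule emeasure_density) measurable
  have m: "(\<lambda>x. ennreal (g x * exp (vdot d t x - c)) * indicator A x) \<in> borel_measurable (euclid d)" for t c
    by (intro borel_measurable_times_ennreal borel_measurable_indicator) measurable
  have gt0: "gauss d (\<lambda>_. 0) = density (euclid d) (\<lambda>x. ennreal (g x))"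
    unfolding gt by (simp add: vdot_def vnorm_def L2_set_0')
  have "emeasure (gmix d \<theta>) A
     = (\<integral>\<^sup>+x. ennreal (1 / 2) * (ennreal (g x * exp (vdot d (\<lambda>i. - \<theta> i) x - (vnorm d \<theta>)\<^sup>2 / 2)) * indicator A x) \<partial>euclid d)
     + (\<integral>\<^sup>+x. ennreal (1 / 2) * (ennreal (g x * exp (vdot d \<theta> x - (vnorm d \<theta>)\<^sup>2 / 2)) * indicator A x) \<partial>euclid d)"
    unfolding emeasure_gmix[OF \<open>A \<in> sets (euclid d)\<close>] em half vnorm_minus
    by (simp only: nn_integral_cmult[OF m])
  also have "\<dots> = (\<integral>\<^sup>+x. ennreal (1 / 2) * (ennreal (g x * exp (vdot d (\<lambda>i. - \<theta> i) x - (vnorm d \<theta>)\<^sup>2 / 2)) * indicator A x)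
      + ennreal (1 / 2) * (ennreal (g x * exp (vdot d \<theta> x - (vnorm d \<theta>)\<^sup>2 / 2)) * indicator A x) \<partial>euclid d)"
    by (rule nn_integral_add[symmetric]) (intro borel_measurable_times_ennreal m borel_measurable_const)+
  also have "\<dots> = (\<integral>\<^sup>+x. ennreal (g x) * (ennreal (exp (- (vnorm d \<theta>)\<^sup>2 / 2) * cosh (vdot d \<theta> x)) * indicator A x) \<partial>euclid d)"
  proof (rule nn_integral_cong)
    fix x
    have "1 / 2 * (g x * exp (vdot d (\<lambda>i. - \<theta> i) x - (vnorm d \<theta>)\<^sup>2 / 2))
        + 1 / 2 * (g x * exp (vdot d \<theta> x - (vnorm d \<theta>)\<^sup>2 / 2))
      = g x * (exp (- (vnorm d \<theta>)\<^sup>2 / 2) * cosh (vdot d \<theta> x))"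
    proof -
      have e: "exp (t - c) = exp (- c) * exp t" for t c :: real by (simp add: exp_diff exp_minus field_simps)
      show ?thesis unfolding vdot_minus_left cosh_field_def e by (simp add: field_simps)
    qed
    moreover have "ennreal (1 / 2) * (ennreal a * indicator A x) + ennreal (1 / 2) * (ennreal b * indicator A x)
        = ennreal p * (ennreal q * indicator A x)"
      if eq: "1 / 2 * a + 1 / 2 * b = p * q" and nn: "0 \<le> a" "0 \<le> b" "0 \<le> p" "0 \<le> q" for a b p q
    proof (cases "x \<in> A")
      case True
      have n: "0 \<le> 1 / 2 * a" "0 \<le> 1 / 2 * b" "(0::real) \<le> 1 / 2" using nn by simp_all
      have "ennreal (1 / 2) * ennreal a + ennreal (1 / 2) * ennreal b = ennreal p * ennreal q"
        unfolding ennreal_mult[OF n(3) nn(1), symmetric] ennreal_mult[OF n(3) nn(2), symmetric]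
          ennreal_plus[OF n(1,2), symmetric] eq by (rule ennreal_mult[OF nn(3,4)])
      with True show ?thesis by simp
    qed simp
    ultimately show "ennreal (1 / 2) * (ennreal (g x * exp (vdot d (\<lambda>i. - \<theta> i) x - (vnorm d \<theta>)\<^sup>2 / 2)) * indicator A x)
      + ennreal (1 / 2) * (ennreal (g x * exp (vdot d \<theta> x - (vnorm d \<theta>)\<^sup>2 / 2)) * indicator A x)
      = ennreal (g x) * (ennreal (exp (- (vnorm d \<theta>)\<^sup>2 / 2) * cosh (vdot d \<theta> x)) * indicator A x)"
      using g0[of x] by simp
  qed
  also have "\<dots> = emeasure (density (gauss d (\<lambda>_. 0))
      (\<lambda>x. ennreal (exp (- (vnorm d \<theta>)\<^sup>2 / 2) * cosh (vdot d \<theta> x)))) A"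
  proof -
    define f where "f x = ennreal (exp (- (vnorm d \<theta>)\<^sup>2 / 2) * cosh (vdot d \<theta> x))" for x
    have [measurable]: "f \<in> borel_measurable (euclid d)" unfolding f_def by measurable
    have "emeasure (density (density (euclid d) (\<lambda>x. ennreal (g x))) f) A
        = (\<integral>\<^sup>+x. f x * indicator A x \<partial>density (euclid d) (\<lambda>x. ennreal (g x)))"
      by (rule emeasure_density) simp_all
    also have "\<dots> = (\<integral>\<^sup>+x. ennreal (g x) * (f x * indicator A x) \<partial>euclid d)"
      by (rule nn_integral_density) measurable
    finally show ?thesis unfolding gt0 f_def ..
  qed
  finally show "emeasure (gmix d \<theta>) A = \<dots>" .
qed simp

lemma nn_integral_gmix:
  assumes [measurable]: "f \<in> borel_measurable (euclid d)"
  shows "(\<integral>\<^sup>+x. f x \<partial>gmix d \<theta>) =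
    (1 / 2) * (\<integral>\<^sup>+x. f x \<partial>gauss d (\<lambda>i. - \<theta> i)) + (1 / 2) * (\<integral>\<^sup>+x. f x \<partial>gauss d \<theta>)"
  using assms
proof (induction rule: borel_measurable_induct)
  case (cong f g)
  then have "integral\<^sup>N M f = integral\<^sup>N M g" if "space M = space (euclid d)" for M
    using that by (intro nn_integral_cong) auto
  then show ?case using cong by simp
next
  case (set A)
  then show ?case by (simp add: emeasure_gmix)
next
  case (mult u c)
  then have [measurable]: "u \<in> borel_measurable (euclid d)" by simp
  show ?case by (simp add: nn_integral_cmult mult.IH distrib_left mult.left_commute)
next
  case (add u v)
  then have [measurable]: "u \<in> borel_measurable (euclid d)" "v \<in> borel_measurable (euclid d)" by simp_all
  show ?case by (simp add: nn_integral_add add.IH distrib_left ac_simps)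
next
  case (seq U)
  then have [measurable]: "\<And>i. U i \<in> borel_measurable (euclid d)" by simp
  have inc: "incseq (\<lambda>i. c * integral\<^sup>N M (U i))" for c :: ennreal and M
    using seq.hyps(3) by (auto simp: incseq_def le_fun_def intro!: mult_left_mono nn_integral_mono)
  show ?case
    using seq
    by (simp add: SUP_apply[abs_def] nn_integral_monotone_convergence_SUP image_comp
        SUP_mult_left_ennreal ennreal_SUP_add[OF inc inc] cong: SUP_cong)
qed

section \<open>Exponential moments of the empirical second moments\<close>

text \<open>
  Completing the square: an exponential tilt by a square turns a normal density into a multiple of
  another one.
\<close>

lemma normal_density_times_exp_square:
  assumes \<sigma>: "\<sigma> > 0" and q: "q = 1 - 2 * l * \<sigma>\<^sup>2" "q > 0"
  shows "normal_density \<mu> \<sigma> y * exp (l * y\<^sup>2) =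
    exp (l * \<mu>\<^sup>2 / q) / sqrt q * normal_density (\<mu> / q) (\<sigma> / sqrt q) y"
proof -
  have l: "l = (1 - q) / (2 * \<sigma>\<^sup>2)" using \<sigma> q by (simp add: field_simps)
  have "- (y - \<mu>)\<^sup>2 / (2 * \<sigma>\<^sup>2) + l * y\<^sup>2 = l * \<mu>\<^sup>2 / q + - (y - \<mu> / q)\<^sup>2 / (2 * (\<sigma>\<^sup>2 / q))"
    unfolding l using \<sigma> q(2) by (simp add: divide_simps power2_eq_square) (simp add: algebra_simps)
  then have e: "exp (- (y - \<mu>)\<^sup>2 / (2 * \<sigma>\<^sup>2)) * exp (l * y\<^sup>2)
      = exp (l * \<mu>\<^sup>2 / q) * exp (- (y - \<mu> / q)\<^sup>2 / (2 * (\<sigma>\<^sup>2 / q)))"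
    by (simp only: flip: exp_add)
  have "normal_density \<mu> \<sigma> y * exp (l * y\<^sup>2)
      = 1 / sqrt (2 * pi * \<sigma>\<^sup>2) * (exp (- (y - \<mu>)\<^sup>2 / (2 * \<sigma>\<^sup>2)) * exp (l * y\<^sup>2))"
    by (simp add: normal_density_def)
  also have "1 / sqrt (2 * pi * \<sigma>\<^sup>2) = 1 / sqrt q * (1 / sqrt (2 * pi * (\<sigma>\<^sup>2 / q)))"
    using \<sigma> q(2) by (simp add: real_sqrt_mult real_sqrt_divide)
  finally have lhs: "normal_density \<mu> \<sigma> y * exp (l * y\<^sup>2)
      = 1 / sqrt q * (1 / sqrt (2 * pi * (\<sigma>\<^sup>2 / q)))
        * (exp (l * \<mu>\<^sup>2 / q) * exp (- (y - \<mu> / q)\<^sup>2 / (2 * (\<sigma>\<^sup>2 / q))))"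
    by (simp only: e)
  have "(\<sigma> / sqrt q)\<^sup>2 = \<sigma>\<^sup>2 / q" using q(2) by (simp add: power_divide)
  then have "normal_density (\<mu> / q) (\<sigma> / sqrt q) y
      = 1 / sqrt (2 * pi * (\<sigma>\<^sup>2 / q)) * exp (- (y - \<mu> / q)\<^sup>2 / (2 * (\<sigma>\<^sup>2 / q)))"
    by (simp only: normal_density_def)
  with lhs show ?thesis by simp
qed

lemma nn_integral_normal_exp_square:
  assumes \<sigma>: "\<sigma> > 0" and q: "2 * l * \<sigma>\<^sup>2 < 1"
  shows "(\<integral>\<^sup>+y. ennreal (normal_density \<mu> \<sigma> y) * ennreal (exp (l * y\<^sup>2)) \<partial>lborel) =
    ennreal (exp (l * \<mu>\<^sup>2 / (1 - 2 * l * \<sigma>\<^sup>2)) / sqrt (1 - 2 * l * \<sigma>\<^sup>2))"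
proof -
  define q where "q = 1 - 2 * l * \<sigma>\<^sup>2"
  have q0: "q > 0" using q by (simp add: q_def)
  have "(\<integral>\<^sup>+y. ennreal (normal_density \<mu> \<sigma> y) * ennreal (exp (l * y\<^sup>2)) \<partial>lborel)
    = (\<integral>\<^sup>+y. ennreal (exp (l * \<mu>\<^sup>2 / q) / sqrt q) * ennreal (normal_density (\<mu> / q) (\<sigma> / sqrt q) y) \<partial>lborel)"
    using q0 by (intro nn_integral_cong)
      (simp add: normal_density_times_exp_square[OF \<sigma> q_def q0] flip: ennreal_mult)
  also have "\<dots> = ennreal (exp (l * \<mu>\<^sup>2 / q) / sqrt q)"
    using \<sigma> q0 by (simp add: nn_integral_cmult nn_integral_eq_integral)
  finally show ?thesis by (simp add: q_def)
qed

text \<open>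
  The left-hand side is the moment generating function at \<open>l\<close> of \<open>X\<^sup>2 - \<sigma>\<^sup>2 - \<mu>\<^sup>2\<close> for a normal \<open>X\<close>
  with mean \<open>\<mu>\<close> and variance \<open>\<sigma>\<^sup>2\<close>. The terms linear in \<open>l\<close> cancel, so that the logarithm is
  quadratic near \<open>0\<close>.
\<close>

lemma centred_noncentral_chi_square_mgf_le:
  fixes l \<sigma> \<mu> s :: real
  assumes \<sigma>: "0 < \<sigma>" "\<sigma> \<le> 1" and l: "\<bar>l\<bar> \<le> 1 / 4" and \<mu>: "\<mu>\<^sup>2 \<le> s\<^sup>2"
  shows "exp (l * \<mu>\<^sup>2 / (1 - 2 * l * \<sigma>\<^sup>2)) / sqrt (1 - 2 * l * \<sigma>\<^sup>2) * exp (- (l * (\<sigma>\<^sup>2 + \<mu>\<^sup>2)))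
    \<le> exp (4 * l\<^sup>2 * (1 + s\<^sup>2))"
proof -
  define u where "u = 2 * l * \<sigma>\<^sup>2"
  have s1: "\<sigma>\<^sup>2 \<le> 1" using \<sigma> by (simp add: power_le_one)
  have "\<bar>u\<bar> = 2 * \<bar>l\<bar> * \<sigma>\<^sup>2" by (simp add: u_def abs_mult)
  also have "\<dots> \<le> 2 * (1 / 4) * 1" using l s1 by (intro mult_mono) auto
  finally have u: "\<bar>u\<bar> \<le> 1 / 2" by simp
  then have u1: "1 - u \<ge> 1 / 2" by linarith
  have "\<bar>ln (1 + - u) - - u\<bar> \<le> 2 * (- u)\<^sup>2"
    using u by (intro abs_ln_one_plus_x_minus_x_bound) simp
  then have ln: "- ln (1 - u) / 2 \<le> u / 2 + u\<^sup>2" by simp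
  have sq: "1 / sqrt (1 - u) = exp (- ln (1 - u) / 2)"
    using u1 by (simp add: exp_minus ln_sqrt[symmetric] inverse_eq_divide)
  have "l * \<mu>\<^sup>2 / (1 - u) - l * \<mu>\<^sup>2 = l * \<mu>\<^sup>2 * u / (1 - u)"
    using u1 by (simp add: field_simps)
  also have "\<dots> = 2 * l\<^sup>2 * (\<sigma>\<^sup>2 * \<mu>\<^sup>2) * (1 / (1 - u))"
    by (simp add: u_def power2_eq_square)
  also have "\<dots> \<le> 2 * l\<^sup>2 * (1 * s\<^sup>2) * 2"
    using u1 s1 \<mu> by (intro mult_mono) (auto simp: field_simps)
  finally have 1: "l * \<mu>\<^sup>2 / (1 - u) - l * \<mu>\<^sup>2 \<le> 4 * l\<^sup>2 * s\<^sup>2" by simp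
  have "u\<^sup>2 = 4 * l\<^sup>2 * (\<sigma>\<^sup>2)\<^sup>2" by (simp add: u_def power_mult_distrib)
  also have "\<dots> \<le> 4 * l\<^sup>2 * 1" using \<sigma> by (intro mult_left_mono) (auto simp: power_le_one simp flip: power_mult)
  finally have 2: "u\<^sup>2 \<le> 4 * l\<^sup>2" by simp
  have "exp (l * \<mu>\<^sup>2 / (1 - u)) / sqrt (1 - u) * exp (- (l * (\<sigma>\<^sup>2 + \<mu>\<^sup>2)))
    = exp (l * \<mu>\<^sup>2 / (1 - u)) * (1 / sqrt (1 - u)) * exp (- (l * (\<sigma>\<^sup>2 + \<mu>\<^sup>2)))" by simp
  also have "\<dots> = exp (l * \<mu>\<^sup>2 / (1 - u) + - ln (1 - u) / 2 + - (l * (\<sigma>\<^sup>2 + \<mu>\<^sup>2)))"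
    unfolding sq by (simp only: exp_add)
  also have "\<dots> \<le> exp (4 * l\<^sup>2 * (1 + s\<^sup>2))"
  proof -
    have "l * (\<sigma>\<^sup>2 + \<mu>\<^sup>2) = u / 2 + l * \<mu>\<^sup>2" by (simp add: u_def algebra_simps)
    then show ?thesis using ln 1 2 by (simp add: algebra_simps)
  qed
  finally show ?thesis by (simp add: u_def)
qed

text \<open>
  The minimiser of \<open>\<rho> / l + l (1 + s)\<^sup>2\<close> is \<open>\<surd>\<rho> / (1 + s)\<close>. When it exceeds \<open>1/4\<close>, the end of the
  range in which the moment generating function is controlled, \<open>1 + s\<^sup>2\<close> is dominated by \<open>\<rho>\<close> and
  \<open>l = 1/4\<close> is good enough.
\<close>

lemma optimal_tilt:
  fixes \<rho> s :: real
  assumes \<rho>: "\<rho> > 0" and s: "s \<ge> 0"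
  obtains l where "0 < l" "l \<le> 1 / 4" "12 * \<rho> / l + 4 * l * (1 + s\<^sup>2) \<le> 64 * (sqrt \<rho> * (1 + s) + \<rho>)"
proof (cases "sqrt \<rho> / (1 + s) \<le> 1 / 4")
  case True
  define l where "l = sqrt \<rho> / (1 + s)"
  have "\<rho> / l = (\<rho> / sqrt \<rho>) * (1 + s)" by (simp add: l_def)
  then have "\<rho> / l = sqrt \<rho> * (1 + s)" using real_div_sqrt[of \<rho>] \<rho> by simp
  then have 1: "12 * \<rho> / l = 12 * (sqrt \<rho> * (1 + s))" by simp
  have "l * (1 + s\<^sup>2) \<le> l * (1 + s)\<^sup>2"
    using \<rho> s by (intro mult_left_mono) (auto simp: l_def power2_eq_square algebra_simps)
  also have "\<dots> = sqrt \<rho> * (1 + s)" using s by (simp add: l_def power2_eq_square)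
  finally have "l * (1 + s\<^sup>2) \<le> sqrt \<rho> * (1 + s)" .
  moreover have "0 \<le> sqrt \<rho> * (1 + s)" using \<rho> s by simp
  ultimately have "12 * \<rho> / l + 4 * l * (1 + s\<^sup>2) \<le> 64 * (sqrt \<rho> * (1 + s) + \<rho>)"
    unfolding 1 using \<rho> by (simp add: mult.assoc)
  moreover have "0 < l" using \<rho> s by (simp add: l_def)
  ultimately show ?thesis using that True by (simp add: l_def)
next
  case False
  then have "1 + s \<le> 4 * sqrt \<rho>" using s by (simp add: field_simps)
  then have "(1 + s)\<^sup>2 \<le> (4 * sqrt \<rho>)\<^sup>2" using s by (intro power_mono) auto
  then have "1 + s\<^sup>2 \<le> 16 * \<rho>" using \<rho> s by (simp add: power_mult_distrib) (simp add: power2_eq_square algebra_simps)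
  then have "48 * \<rho> + (1 + s\<^sup>2) \<le> 64 * (X + \<rho>)" if "0 \<le> X" for X
    using that by simp
  from this[of "sqrt \<rho> * (1 + s)"]
  have "12 * \<rho> / (1 / 4) + 4 * (1 / 4) * (1 + s\<^sup>2) \<le> 64 * (sqrt \<rho> * (1 + s) + \<rho>)"
    using \<rho> s by simp
  then show ?thesis using that[of "1 / 4"] by simp
qed

lemma nn_integral_gauss_vdot:
  assumes "0 < vnorm d v" and [measurable]: "h \<in> borel_measurable borel"
  shows "(\<integral>\<^sup>+x. h (vdot d v x) \<partial>gauss d \<theta>) =
    (\<integral>\<^sup>+y. ennreal (normal_density (vdot d v \<theta>) (vnorm d v) y) * h y \<partial>lborel)"
  using distributed_nn_integral[OF distributed_vdot_gauss[OF assms(1)], of h] by simp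

lemma ennreal_half_plus_half: "1 / 2 * b + 1 / 2 * b = (b :: ennreal)"
proof -
  have "(1 / 2 + 1 / 2 :: ennreal) = 1" by (simp flip: add_divide_distrib_ennreal)
  then show ?thesis by (metis distrib_right mult_1)
qed

lemma gmix_centred_square_mgf_le:
  assumes v: "0 < vnorm d v" "vnorm d v \<le> 1" and l: "\<bar>l\<bar> \<le> 1 / 4"
  shows "(\<integral>\<^sup>+y. ennreal (exp (l * ((vdot d v y)\<^sup>2 - (vnorm d v)\<^sup>2 - (vdot d v \<theta>)\<^sup>2))) \<partial>gmix d \<theta>)
    \<le> ennreal (exp (4 * l\<^sup>2 * (1 + (vnorm d \<theta>)\<^sup>2)))"
proof -
  define \<sigma> \<mu> where "\<sigma> = vnorm d v" and "\<mu> = vdot d v \<theta>"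
  have "\<bar>\<mu>\<bar> \<le> vnorm d v * vnorm d \<theta>" unfolding \<mu>_def by (rule abs_vdot_le)
  also have "\<dots> \<le> 1 * vnorm d \<theta>" using v by (intro mult_right_mono) auto
  finally have \<mu>: "\<mu>\<^sup>2 \<le> (vnorm d \<theta>)\<^sup>2"
    by (metis abs_ge_zero mult_1 power2_abs power_mono)
  have "2 * l * \<sigma>\<^sup>2 \<le> 2 * \<bar>l\<bar> * \<sigma>\<^sup>2" by (intro mult_right_mono) auto
  also have "\<dots> \<le> 2 * (1 / 4) * 1"
    using v l unfolding \<sigma>_def by (intro mult_mono) (auto simp: power_le_one)
  finally have l1: "2 * l * \<sigma>\<^sup>2 < 1" by simp
  have bound: "(\<integral>\<^sup>+y. ennreal (exp (l * ((vdot d v y)\<^sup>2 - \<sigma>\<^sup>2 - \<mu>\<^sup>2))) \<partial>gauss d t)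
      \<le> ennreal (exp (4 * l\<^sup>2 * (1 + (vnorm d \<theta>)\<^sup>2)))"
    if t: "(vdot d v t)\<^sup>2 = \<mu>\<^sup>2" for t
  proof -
    have "(\<integral>\<^sup>+y. ennreal (exp (l * ((vdot d v y)\<^sup>2 - \<sigma>\<^sup>2 - \<mu>\<^sup>2))) \<partial>gauss d t)
      = (\<integral>\<^sup>+y. ennreal (exp (l * (vdot d v y)\<^sup>2)) * ennreal (exp (- (l * (\<sigma>\<^sup>2 + \<mu>\<^sup>2)))) \<partial>gauss d t)"
      by (intro nn_integral_cong) (simp add: algebra_simps flip: ennreal_mult exp_add)
    also have "\<dots> = (\<integral>\<^sup>+y. ennreal (exp (l * (vdot d v y)\<^sup>2)) \<partial>gauss d t) * ennreal (exp (- (l * (\<sigma>\<^sup>2 + \<mu>\<^sup>2))))"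
      by (rule nn_integral_multc) (simp cong: measurable_cong_sets)
    also have "\<dots> = ennreal (exp (l * \<mu>\<^sup>2 / (1 - 2 * l * \<sigma>\<^sup>2)) / sqrt (1 - 2 * l * \<sigma>\<^sup>2))
        * ennreal (exp (- (l * (\<sigma>\<^sup>2 + \<mu>\<^sup>2))))"
      using nn_integral_normal_exp_square[OF v(1), of l "vdot d v t"] l1 t
      by (subst nn_integral_gauss_vdot[OF v(1)]) (simp_all add: \<sigma>_def)
    also have "\<dots> = ennreal (exp (l * \<mu>\<^sup>2 / (1 - 2 * l * \<sigma>\<^sup>2)) / sqrt (1 - 2 * l * \<sigma>\<^sup>2)
        * exp (- (l * (\<sigma>\<^sup>2 + \<mu>\<^sup>2))))"
      using l1 by (subst ennreal_mult) auto
    also have "\<dots> \<le> ennreal (exp (4 * l\<^sup>2 * (1 + (vnorm d \<theta>)\<^sup>2)))"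
      using v l \<mu> unfolding \<sigma>_def
      by (intro ennreal_leI centred_noncentral_chi_square_mgf_le) auto
    finally show ?thesis .
  qed
  let ?b = "ennreal (exp (4 * l\<^sup>2 * (1 + (vnorm d \<theta>)\<^sup>2)))"
  have "(\<integral>\<^sup>+y. ennreal (exp (l * ((vdot d v y)\<^sup>2 - \<sigma>\<^sup>2 - \<mu>\<^sup>2))) \<partial>gmix d \<theta>)
      \<le> 1 / 2 * ?b + 1 / 2 * ?b"
  proof (subst nn_integral_gmix)
    have "(vdot d v (\<lambda>i. - \<theta> i))\<^sup>2 = \<mu>\<^sup>2" "(vdot d v \<theta>)\<^sup>2 = \<mu>\<^sup>2"
      by (simp_all add: vdot_minus_right \<mu>_def)
    then show "1 / 2 * (\<integral>\<^sup>+y. ennreal (exp (l * ((vdot d v y)\<^sup>2 - \<sigma>\<^sup>2 - \<mu>\<^sup>2))) \<partial>gauss d (\<lambda>i. - \<theta> i))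
        + 1 / 2 * (\<integral>\<^sup>+y. ennreal (exp (l * ((vdot d v y)\<^sup>2 - \<sigma>\<^sup>2 - \<mu>\<^sup>2))) \<partial>gauss d \<theta>)
        \<le> 1 / 2 * ?b + 1 / 2 * ?b"
      by (intro add_mono mult_left_mono bound) simp_all
  qed measurable
  also have "\<dots> = ?b"
    by (rule ennreal_half_plus_half)
  finally show ?thesis by (simp add: \<sigma>_def \<mu>_def)
qed

lemma sigma_finite_gmix: "sigma_finite_measure (gmix d \<theta>)"
  using prob_space_gmix by (rule prob_space_imp_sigma_finite)

lemma sets_sample: "sets (sample d n \<theta>) = sets (\<Pi>\<^sub>M j\<in>{..<n}. euclid d)"
  unfolding sample_def by (intro sets_PiM_cong) simp_all

lemma space_sample: "space (sample d n \<theta>) = space (\<Pi>\<^sub>M j\<in>{..<n}. euclid d)"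
  using sets_sample by (rule sets_eq_imp_space_eq)

lemma nn_integral_sample_prod:
  assumes [measurable]: "f \<in> borel_measurable (euclid d)"
  shows "(\<integral>\<^sup>+Y. (\<Prod>j<n. f (Y j)) \<partial>sample d n \<theta>) = (\<integral>\<^sup>+y. f y \<partial>gmix d \<theta>) ^ n"
proof -
  interpret product_sigma_finite "\<lambda>_::nat. gmix d \<theta>"
    using sigma_finite_gmix by (simp add: product_sigma_finite_def)
  show ?thesis
    unfolding sample_def by (subst product_nn_integral_prod) (simp_all cong: measurable_cong_sets)
qed

text \<open>
  The unbiased estimate of \<open>(v \<bullet> \<theta>)\<^sup>2\<close> given by the sample covariance matrix.
\<close>

definition emp_square :: "nat \<Rightarrow> nat \<Rightarrow> (nat \<Rightarrow> real) \<Rightarrow> (nat \<Rightarrow> nat \<Rightarrow> real) \<Rightarrow> real" where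
  "emp_square d n v Y = (\<Sum>j<n. (vdot d v (Y j))\<^sup>2 - (vnorm d v)\<^sup>2) / real n"

lemma borel_measurable_emp_square [measurable]:
  "emp_square d n v \<in> borel_measurable (\<Pi>\<^sub>M j\<in>{..<n}. euclid d)"
  unfolding emp_square_def[abs_def]
  by (intro borel_measurable_divide borel_measurable_sum borel_measurable_diff
      borel_measurable_power measurable_compose[OF _ borel_measurable_vdot]) auto

lemma emp_square_mgf_le:
  assumes v: "0 < vnorm d v" "vnorm d v \<le> 1" and l: "\<bar>l\<bar> \<le> 1 / 4" and n: "n \<ge> 1"
  shows "(\<integral>\<^sup>+Y. ennreal (exp (real n * l * (emp_square d n v Y - (vdot d v \<theta>)\<^sup>2))) \<partial>sample d n \<theta>)
    \<le> ennreal (exp (4 * real n * l\<^sup>2 * (1 + (vnorm d \<theta>)\<^sup>2)))"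
proof -
  have "real n * l * (emp_square d n v Y - (vdot d v \<theta>)\<^sup>2)
    = (\<Sum>j<n. l * ((vdot d v (Y j))\<^sup>2 - (vnorm d v)\<^sup>2 - (vdot d v \<theta>)\<^sup>2))" for Y
    using n by (simp add: emp_square_def sum_subtractf field_simps flip: sum_distrib_left)
  then have "(\<integral>\<^sup>+Y. ennreal (exp (real n * l * (emp_square d n v Y - (vdot d v \<theta>)\<^sup>2))) \<partial>sample d n \<theta>)
    = (\<integral>\<^sup>+Y. (\<Prod>j<n. ennreal (exp (l * ((vdot d v (Y j))\<^sup>2 - (vnorm d v)\<^sup>2 - (vdot d v \<theta>)\<^sup>2)))) \<partial>sample d n \<theta>)"
    by (simp add: exp_sum prod_ennreal)
  also have "\<dots> = (\<integral>\<^sup>+y. ennreal (exp (l * ((vdot d v y)\<^sup>2 - (vnorm d v)\<^sup>2 - (vdot d v \<theta>)\<^sup>2))) \<partial>gmix d \<theta>) ^ n"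
    by (rule nn_integral_sample_prod) measurable
  also have "\<dots> \<le> ennreal (exp (4 * l\<^sup>2 * (1 + (vnorm d \<theta>)\<^sup>2))) ^ n"
    by (intro power_mono_ennreal gmix_centred_square_mgf_le v l)
  also have "\<dots> = ennreal (exp (4 * real n * l\<^sup>2 * (1 + (vnorm d \<theta>)\<^sup>2)))"
    by (simp add: ennreal_power exp_of_nat_mult[symmetric] mult_ac)
  finally show ?thesis .
qed

text \<open>
  The maximum over the net is dominated pointwise by the soft maximum \<open>B\<close>: from
  \<open>x \<le> a + exp (x - a)\<close> with \<open>x = n l \<bar>X\<bar>\<close>, summed over the net and both signs. Integrating \<open>B\<close> only
  needs the moment generating functions. The constant \<open>a\<close> is chosen so that all exponentials together
  contribute at most \<open>1\<close>, and the tilt \<open>l\<close> balances the entropy \<open>\<rho> / l\<close> of the net against the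
  variance \<open>l (1 + s\<^sup>2)\<close>.
\<close>

lemma uniform_deviation_bound:
  assumes N: "sphere_net d N" "card N \<le> 768 ^ d" and d: "d \<ge> 1" and n: "n \<ge> 1"
  shows "\<exists>B. B \<in> borel_measurable (\<Pi>\<^sub>M j\<in>{..<n}. euclid d) \<and>
     (\<forall>Y. \<forall>v\<in>N. \<bar>emp_square d n v Y - (vdot d v \<theta>)\<^sup>2\<bar> \<le> B Y) \<and> (\<forall>Y. 0 \<le> B Y) \<and>
     (\<integral>\<^sup>+Y. ennreal (B Y) \<partial>sample d n \<theta>)
       \<le> ennreal (64 * (sqrt (real d / real n) * (1 + vnorm d \<theta>) + real d / real n))"
proof -
  define \<rho> where "\<rho> = real d / real n"
  define s where "s = vnorm d \<theta>"
  have \<rho>: "\<rho> > 0" using d n by (simp add: \<rho>_def)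
  obtain l where l: "0 < l" "l \<le> 1 / 4"
    and opt: "12 * \<rho> / l + 4 * l * (1 + s\<^sup>2) \<le> 64 * (sqrt \<rho> * (1 + s) + \<rho>)"
    using optimal_tilt[OF \<rho>, of s] by (auto simp: s_def)
  define e where "e = 4 * real n * l\<^sup>2 * (1 + s\<^sup>2)"
  define a where "a = ln (2 * 768 ^ d) + e"
  define X where "X v Y = emp_square d n v Y - (vdot d v \<theta>)\<^sup>2" for v Y
  define B where "B Y = (a + (\<Sum>v\<in>N. exp (real n * l * X v Y - a) + exp (real n * (- l) * X v Y - a))) / (real n * l)" for Y
  have nl: "real n * l > 0" using n l by simp
  have vN: "0 < vnorm d v" "vnorm d v \<le> 1" if "v \<in> N" for v
    using N(1) that by (auto simp: sphere_net_def)
  have fN: "finite N" using N(1) by (simp add: sphere_net_def)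
  have [measurable]: "X v \<in> borel_measurable (\<Pi>\<^sub>M j\<in>{..<n}. euclid d)" for v
    unfolding X_def by measurable
  have [measurable]: "X v \<in> borel_measurable (sample d n \<theta>)" for v
    by (simp cong: measurable_cong_sets[OF sets_sample refl])
  have e0: "0 \<le> e" by (simp add: e_def)
  have lnp: "0 \<le> ln (2 * 768 ^ d :: real)"
    using one_le_power[of "768::real" d] by (intro ln_ge_zero) linarith
  have a0: "0 \<le> a" using lnp e0 by (simp add: a_def)
  have B0: "0 \<le> B Y" for Y
    using nl a0 unfolding B_def by (intro divide_nonneg_nonneg add_nonneg_nonneg sum_nonneg) auto
  have dom: "\<bar>X v Y\<bar> \<le> B Y" if v: "v \<in> N" for v Y
  proof -
    have "real n * l * \<bar>X v Y\<bar> \<le> a + exp (real n * l * \<bar>X v Y\<bar> - a)"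
      using exp_ge_add_one_self[of "real n * l * \<bar>X v Y\<bar> - a"] by linarith
    also have "exp (real n * l * \<bar>X v Y\<bar> - a) \<le> exp (real n * l * X v Y - a) + exp (real n * (- l) * X v Y - a)"
      by (cases "X v Y \<ge> 0") auto
    also have "\<dots> \<le> (\<Sum>v\<in>N. exp (real n * l * X v Y - a) + exp (real n * (- l) * X v Y - a))"
      using v fN by (intro member_le_sum[of v N "\<lambda>v. exp (real n * l * X v Y - a) + exp (real n * (- l) * X v Y - a)"])
        (auto intro: add_nonneg_nonneg)
    finally show ?thesis using nl by (simp add: B_def field_simps)
  qed
  have mgf: "(\<integral>\<^sup>+Y. ennreal (exp (real n * k * X v Y - a)) \<partial>sample d n \<theta>) \<le> ennreal (1 / (2 * 768 ^ d))"
    if v: "v \<in> N" and k: "\<bar>k\<bar> = l" for v k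
  proof -
    have "(\<integral>\<^sup>+Y. ennreal (exp (real n * k * X v Y - a)) \<partial>sample d n \<theta>)
      = (\<integral>\<^sup>+Y. ennreal (exp (real n * k * X v Y)) * ennreal (exp (- a)) \<partial>sample d n \<theta>)"
      by (intro nn_integral_cong) (simp flip: ennreal_mult exp_add)
    also have "\<dots> = (\<integral>\<^sup>+Y. ennreal (exp (real n * k * X v Y)) \<partial>sample d n \<theta>) * ennreal (exp (- a))"
      by (rule nn_integral_multc) measurable
    also have "\<dots> \<le> ennreal (exp (4 * real n * k\<^sup>2 * (1 + (vnorm d \<theta>)\<^sup>2))) * ennreal (exp (- a))"
      unfolding X_def using v k l vN n by (intro mult_right_mono emp_square_mgf_le) auto
    also have "k\<^sup>2 = l\<^sup>2" using k by (metis power2_abs)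
    also have "ennreal (exp (4 * real n * l\<^sup>2 * (1 + (vnorm d \<theta>)\<^sup>2))) * ennreal (exp (- a))
      = ennreal (exp (e + - a))"
      by (simp add: e_def s_def flip: ennreal_mult exp_add)
    also have "exp (e + - a) = 1 / (2 * 768 ^ d)" by (simp add: a_def exp_minus exp_diff field_simps)
    finally show ?thesis .
  qed
  have "(\<integral>\<^sup>+Y. ennreal (B Y) \<partial>sample d n \<theta>)
    = (\<integral>\<^sup>+Y. ennreal (1 / (real n * l)) * (ennreal a + (\<Sum>v\<in>N. ennreal (exp (real n * l * X v Y - a))
        + ennreal (exp (real n * (- l) * X v Y - a)))) \<partial>sample d n \<theta>)"
  proof (rule nn_integral_cong)
    fix Y
    have "(\<Sum>v\<in>N. ennreal (exp (real n * l * X v Y - a)) + ennreal (exp (real n * (- l) * X v Y - a)))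
      = ennreal (\<Sum>v\<in>N. exp (real n * l * X v Y - a) + exp (real n * (- l) * X v Y - a))"
      by (subst sum_ennreal[symmetric]) (auto intro: add_nonneg_nonneg)
    then show "ennreal (B Y) = ennreal (1 / (real n * l)) * (ennreal a + (\<Sum>v\<in>N. ennreal (exp (real n * l * X v Y - a))
        + ennreal (exp (real n * (- l) * X v Y - a))))"
      using nl a0 by (simp add: B_def sum_nonneg add_nonneg_nonneg flip: ennreal_plus ennreal_mult)
  qed
  also have "\<dots> = ennreal (1 / (real n * l)) * (ennreal a + (\<Sum>v\<in>N.
      (\<integral>\<^sup>+Y. ennreal (exp (real n * l * X v Y - a)) \<partial>sample d n \<theta>) + (\<integral>\<^sup>+Y. ennreal (exp (real n * (- l) * X v Y - a)) \<partial>sample d n \<theta>)))"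
    using prob_space.emeasure_space_1[OF prob_space_sample, of d n \<theta>]
    by (simp add: nn_integral_cmult nn_integral_add nn_integral_sum)
  also have "\<dots> \<le> ennreal (1 / (real n * l)) * (ennreal a + (\<Sum>v\<in>N.
      ennreal (1 / (2 * 768 ^ d)) + ennreal (1 / (2 * 768 ^ d))))"
    using l by (intro mult_left_mono add_mono sum_mono mgf order_refl) auto
  also have "\<dots> = ennreal (1 / (real n * l)) * (ennreal a + ennreal (real (card N) / 768 ^ d))"
    by (simp add: ennreal_of_nat_eq_real_of_nat flip: ennreal_plus ennreal_mult) 
  also have "\<dots> \<le> ennreal (1 / (real n * l)) * (ennreal a + ennreal 1)"
    using N(2) of_nat_mono[OF N(2), where 'a = real]
    by (intro mult_left_mono add_mono ennreal_leI) auto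
  also have "\<dots> = ennreal ((a + 1) / (real n * l))"
    using nl a0 by (simp flip: ennreal_plus ennreal_mult ennreal_1)
  also have "\<dots> \<le> ennreal (64 * (sqrt \<rho> * (1 + s) + \<rho>))"
  proof (rule ennreal_leI)
    have ln2: "ln (2::real) \<le> 1" using ln_le_minus_one[of "2::real"] by simp
    have "ln (2 * 768 ^ d :: real) \<le> ln (2 * 1024 ^ d)"
      by (simp add: power_mono)
    \<comment> \<open>\<open>768\<close> is rounded up to a power of \<open>2\<close>, which avoids estimating its logarithm.\<close>
    also have "\<dots> = (1 + 10 * real d) * ln 2"
    proof -
      have "ln (1024::real) = 10 * ln 2" using ln_realpow[of "2::real" 10] by simp
      then show ?thesis by (simp add: ln_mult ln_realpow algebra_simps)
    qed
    also have "\<dots> \<le> (1 + 10 * real d) * 1" using ln2 by (intro mult_left_mono) auto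
    finally have "a + 1 \<le> 12 * real d + e" using d by (simp add: a_def)
    then have "(a + 1) / (real n * l) \<le> (12 * real d + e) / (real n * l)"
      using nl by (intro divide_right_mono) auto
    also have "\<dots> = 12 * \<rho> / l + 4 * l * (1 + s\<^sup>2)"
      using n l by (simp add: \<rho>_def e_def field_simps power2_eq_square)
    also note opt
    finally show "(a + 1) / (real n * l) \<le> 64 * (sqrt \<rho> * (1 + s) + \<rho>)" .
  qed
  finally have "(\<integral>\<^sup>+Y. ennreal (B Y) \<partial>sample d n \<theta>) \<le> ennreal (64 * (sqrt \<rho> * (1 + s) + \<rho>))" .
  moreover have "B \<in> borel_measurable (\<Pi>\<^sub>M j\<in>{..<n}. euclid d)"
    unfolding B_def by measurable
  ultimately show ?thesis
    using dom B0 by (intro exI[of _ B]) (auto simp: X_def \<rho>_def s_def)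
qed

section \<open>Least-deviation estimation and the upper bounds\<close>

text \<open>
  With finitely many candidates the minimiser can be selected by successive comparisons, which keeps
  it measurable.
\<close>

lemma measurable_argmin:
  fixes f :: "'b \<Rightarrow> 'a \<Rightarrow> real"
  assumes "finite F" "F \<noteq> {}" "F \<subseteq> space N" "\<And>t. t \<in> F \<Longrightarrow> f t \<in> borel_measurable M"
  shows "\<exists>est \<in> M \<rightarrow>\<^sub>M N. (\<lambda>Y. f (est Y) Y) \<in> borel_measurable M \<and>
    (\<forall>Y. est Y \<in> F \<and> (\<forall>t\<in>F. f (est Y) Y \<le> f t Y))"
  using assms
proof (induction F rule: finite_ne_induct)
  case (singleton x)
  have "f x \<in> borel_measurable M" "x \<in> space N"
    using singleton.prems by blast+
  then show ?case by (intro bexI[of _ "\<lambda>_. x"]) simp_all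
next
  case (insert x F)
  then obtain est where [measurable]: "est \<in> M \<rightarrow>\<^sub>M N" "(\<lambda>Y. f (est Y) Y) \<in> borel_measurable M"
    and est: "\<And>Y. est Y \<in> F" "\<And>Y t. t \<in> F \<Longrightarrow> f (est Y) Y \<le> f t Y" by blast
  have [measurable]: "f x \<in> borel_measurable M" and [simp]: "x \<in> space N" using insert.prems by auto
  define est' where "est' Y = (if f x Y < f (est Y) Y then x else est Y)" for Y
  have 1: "est' \<in> M \<rightarrow>\<^sub>M N" unfolding est'_def by measurable
  have "(\<lambda>Y. min (f x Y) (f (est Y) Y)) \<in> borel_measurable M" by measurable
  moreover have "(\<lambda>Y. min (f x Y) (f (est Y) Y)) = (\<lambda>Y. f (est' Y) Y)"
    by (auto simp: est'_def fun_eq_iff)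
  ultimately have 2: "(\<lambda>Y. f (est' Y) Y) \<in> borel_measurable M" by simp
  have 3: "est' Y \<in> insert x F" for Y using est(1) by (simp add: est'_def)
  have 4: "f (est' Y) Y \<le> f t Y" if "t \<in> insert x F" for t Y
    using that est(2)[of t Y] by (auto simp: est'_def)
  show ?case using 1 2 3 4 by (intro bexI[of _ est']) blast+
qed

text \<open>
  Rounding the coordinates of \<open>\<theta>\<close> to a fine grid changes the form \<open>v \<mapsto> (v \<bullet> \<theta>)\<^sup>2\<close> by little, uniformly
  over the unit ball; so restricting the candidates to finitely many points costs any prescribed
  amount \<open>\<eta>\<close> only.
\<close>

lemma finite_candidate_grid:
  assumes d: "d \<ge> 1" and r: "r \<ge> 0" and \<eta>: "\<eta> > 0"
  shows "\<exists>F. finite F \<and> F \<noteq> {} \<and> F \<subseteq> space (euclid d) \<and> (\<forall>\<theta>. vnorm d \<theta> \<le> r \<longrightarrow>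
      (\<exists>t\<in>F. \<forall>v. vnorm d v \<le> 1 \<longrightarrow> \<bar>(vdot d v t)\<^sup>2 - (vdot d v \<theta>)\<^sup>2\<bar> \<le> \<eta>))"
proof -
  define \<epsilon> where "\<epsilon> = \<eta> / (2 * r + 1 + \<eta>)"
  define h where "h = \<epsilon> / sqrt (real d)"
  have \<epsilon>: "0 < \<epsilon>" "\<epsilon> \<le> 1" "\<epsilon> * (2 * r + \<epsilon>) \<le> \<eta>"
  proof -
    show 1: "0 < \<epsilon>" "\<epsilon> \<le> 1" using r \<eta> by (auto simp: \<epsilon>_def)
    have "\<epsilon> * (2 * r + \<epsilon>) \<le> \<epsilon> * (2 * r + 1 + \<eta>)" using 1 \<eta> by (intro mult_left_mono) auto
    also have "\<dots> = \<eta>" using r \<eta> by (simp add: \<epsilon>_def)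
    finally show "\<epsilon> * (2 * r + \<epsilon>) \<le> \<eta>" .
  qed
  have h: "h > 0" "sqrt (real d) * h = \<epsilon>" using d \<epsilon> by (simp_all add: h_def)
  define K where "K = \<lfloor>r / h\<rfloor> + 1"
  define F where "F = (\<Pi>\<^sub>E i\<in>{..<d}. (\<lambda>k. h * real_of_int k) ` {-K..K})"
  have finF: "finite F" unfolding F_def by (intro finite_PiE) auto
  have F_sub: "F \<subseteq> space (euclid d)" by (auto simp: F_def euclid_def space_PiM PiE_def)
  have near: "\<exists>t\<in>F. \<forall>v. vnorm d v \<le> 1 \<longrightarrow> \<bar>(vdot d v t)\<^sup>2 - (vdot d v \<theta>)\<^sup>2\<bar> \<le> \<eta>"
    if \<theta>: "vnorm d \<theta> \<le> r" for \<theta>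
  proof -
    define t where "t = (\<lambda>i\<in>{..<d}. h * real_of_int \<lfloor>\<theta> i / h\<rfloor>)"
    have "\<lfloor>\<theta> i / h\<rfloor> \<in> {-K..K}" if "i < d" for i
    proof -
      have "\<bar>\<theta> i\<bar> \<le> r" using component_le_vnorm[OF that] \<theta> by (rule order_trans)
      then have "- r \<le> \<theta> i" "\<theta> i \<le> r" by auto
      from this[THEN divide_right_mono, of h]
      have "- (r / h) \<le> \<theta> i / h" "\<theta> i / h \<le> r / h" using h(1) by simp_all
      then show ?thesis unfolding K_def atLeastAtMost_iff by linarith
    qed
    then have tF: "t \<in> F" by (auto simp: F_def t_def)
    have dt: "vnorm d (\<lambda>i. t i - \<theta> i) \<le> \<epsilon>"
      unfolding h(2)[symmetric]
    proof (rule vnorm_le_componentwise)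
      fix i assume i: "i < d"
      have "t i - \<theta> i = h * (real_of_int \<lfloor>\<theta> i / h\<rfloor> - \<theta> i / h)"
        using h i by (simp add: t_def field_simps)
      moreover have "\<bar>real_of_int \<lfloor>\<theta> i / h\<rfloor> - \<theta> i / h\<bar> \<le> 1" by linarith
      ultimately show "\<bar>t i - \<theta> i\<bar> \<le> h" using h(1) by (simp add: abs_mult)
    qed (use h in simp)
    have st: "vnorm d (\<lambda>i. t i + \<theta> i) \<le> 2 * r + \<epsilon>"
      using vnorm_add_le[of d "\<lambda>i. t i - \<theta> i" "\<lambda>i. \<theta> i + \<theta> i"] vnorm_add_le[of d \<theta> \<theta>] dt \<theta>
      by (simp add: algebra_simps)
    have "\<bar>(vdot d v t)\<^sup>2 - (vdot d v \<theta>)\<^sup>2\<bar> \<le> \<eta>" if v: "vnorm d v \<le> 1" for v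
    proof -
      have "(vdot d v t)\<^sup>2 - (vdot d v \<theta>)\<^sup>2 = vdot d v (\<lambda>i. t i - \<theta> i) * vdot d v (\<lambda>i. t i + \<theta> i)"
        by (simp add: vdot_add_right vdot_diff_right power2_eq_square algebra_simps)
      also have "\<bar>\<dots>\<bar> \<le> (1 * \<epsilon>) * (1 * (2 * r + \<epsilon>))"
        unfolding abs_mult using v dt st \<epsilon> r
        by (intro mult_mono order_trans[OF abs_vdot_le]) auto
      finally show ?thesis using \<epsilon>(3) by simp
    qed
    then show ?thesis using tF by blast
  qed
  have "F \<noteq> {}" using near[of "\<lambda>_. 0"] r by (auto simp: vnorm_def L2_set_0')
  with finF F_sub near show ?thesis by blast
qed

lemma emeasure_sample_space [simp]: "emeasure (sample d n \<theta>) (space (sample d n \<theta>)) = 1"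
  by (rule prob_space.emeasure_space_1[OF prob_space_sample])

lemma ennreal_min: "ennreal (min x y) = min (ennreal x) (ennreal y)"
  by (rule min_of_mono[symmetric]) (simp add: monoI ennreal_leI)

text \<open>
  The estimator picks a grid point whose quadratic form fits the empirical one best on the net. The
  grid point near \<open>\<theta>\<close> fits up to the deviation \<open>B\<close> plus the tolerance \<open>\<rho>\<close>, hence so does the chosen
  one, and its form differs from that of \<open>\<theta>\<close> by at most \<open>2 B + \<rho>\<close> on the net.
\<close>

lemma least_deviation_estimator:
  assumes d: "d \<ge> 1" and n: "n \<ge> 1" and r: "r \<ge> 0"
  shows "\<exists>est\<in>estimators d n. \<forall>\<theta>. vnorm d \<theta> \<le> r \<longrightarrow> (\<exists>D.
     D \<in> borel_measurable (sample d n \<theta>) \<and>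
     (\<forall>Y. 0 \<le> D Y \<and> vnorm d \<theta> * loss d (est Y) \<theta> \<le> D Y \<and> (loss d (est Y) \<theta>)\<^sup>2 \<le> D Y) \<and>
     (\<integral>\<^sup>+Y. ennreal (D Y) \<partial>sample d n \<theta>)
       \<le> ennreal (516 * (sqrt (real d / real n) * (1 + vnorm d \<theta>) + real d / real n)))"
proof -
  define \<rho> where "\<rho> = real d / real n"
  have \<rho>: "\<rho> > 0" using d n by (simp add: \<rho>_def)
  let ?S = "\<Pi>\<^sub>M j\<in>{..<n}. euclid d"
  obtain N where N: "sphere_net d N" "card N \<le> 768 ^ d" using sphere_net_exists[OF d] by auto
  obtain F where F: "finite F" "F \<noteq> {}" "F \<subseteq> space (euclid d)"
    and near: "\<And>\<theta>. vnorm d \<theta> \<le> r \<Longrightarrow>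
      \<exists>t\<in>F. \<forall>v. vnorm d v \<le> 1 \<longrightarrow> \<bar>(vdot d v t)\<^sup>2 - (vdot d v \<theta>)\<^sup>2\<bar> \<le> \<rho>"
    using finite_candidate_grid[OF d r \<rho>] by blast
  have fN: "finite N" and vN: "\<And>v. v \<in> N \<Longrightarrow> vnorm d v \<le> 1"
    using N(1) by (auto simp: sphere_net_def)
  have "vnorm d (\<lambda>i. if i = 0 then 1 else 0) = 1"
    using d by (simp add: vnorm_def L2_set_def if_distrib[of "\<lambda>x. x\<^sup>2"] cong: if_cong)
  then have N0: "N \<noteq> {}" using N(1) unfolding sphere_net_def by blast
  define f where "f t Y = Max ((\<lambda>v. \<bar>emp_square d n v Y - (vdot d v t)\<^sup>2\<bar>) ` N)" for t Y
  have f_ge: "\<bar>emp_square d n v Y - (vdot d v t)\<^sup>2\<bar> \<le> f t Y" if "v \<in> N" for v t Y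
    unfolding f_def using fN that by (intro Max_ge) auto
  have f_le: "f t Y \<le> c" if "\<And>v. v \<in> N \<Longrightarrow> \<bar>emp_square d n v Y - (vdot d v t)\<^sup>2\<bar> \<le> c" for t Y c
    unfolding f_def using fN N0 that by (subst Max_le_iff) auto
  have fm: "f t \<in> borel_measurable ?S" for t
    unfolding f_def by (rule borel_measurable_Max[OF fN]) measurable
  obtain est where est: "est \<in> ?S \<rightarrow>\<^sub>M euclid d"
    and estF: "\<And>Y. est Y \<in> F" "\<And>Y t. t \<in> F \<Longrightarrow> f (est Y) Y \<le> f t Y"
    using measurable_argmin[where f = f, OF F fm] by blast
  have "\<exists>D. D \<in> borel_measurable (sample d n \<theta>) \<and>
     (\<forall>Y. 0 \<le> D Y \<and> vnorm d \<theta> * loss d (est Y) \<theta> \<le> D Y \<and> (loss d (est Y) \<theta>)\<^sup>2 \<le> D Y) \<and>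
     (\<integral>\<^sup>+Y. ennreal (D Y) \<partial>sample d n \<theta>) \<le> ennreal (516 * (sqrt \<rho> * (1 + vnorm d \<theta>) + \<rho>))"
    if \<theta>: "vnorm d \<theta> \<le> r" for \<theta>
  proof -
    obtain B where B: "B \<in> borel_measurable ?S" "\<And>Y v. v \<in> N \<Longrightarrow> \<bar>emp_square d n v Y - (vdot d v \<theta>)\<^sup>2\<bar> \<le> B Y"
      "\<And>Y. 0 \<le> B Y" "(\<integral>\<^sup>+Y. ennreal (B Y) \<partial>sample d n \<theta>) \<le> ennreal (64 * (sqrt \<rho> * (1 + vnorm d \<theta>) + \<rho>))"
      using uniform_deviation_bound[OF N d n, of \<theta>] unfolding \<rho>_def by blast
    obtain t where t: "t \<in> F" "\<And>v. vnorm d v \<le> 1 \<Longrightarrow> \<bar>(vdot d v t)\<^sup>2 - (vdot d v \<theta>)\<^sup>2\<bar> \<le> \<rho>"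
      using near[OF \<theta>] by blast
    have dev: "\<bar>(vdot d v (est Y))\<^sup>2 - (vdot d v \<theta>)\<^sup>2\<bar> \<le> 2 * B Y + \<rho>" if v: "v \<in> N" for v Y
    proof -
      have "f t Y \<le> B Y + \<rho>"
      proof (rule f_le)
        fix w assume w: "w \<in> N"
        show "\<bar>emp_square d n w Y - (vdot d w t)\<^sup>2\<bar> \<le> B Y + \<rho>"
          using B(2)[OF w, of Y] t(2)[OF vN[OF w]] by linarith
      qed
      then have "\<bar>emp_square d n v Y - (vdot d v (est Y))\<^sup>2\<bar> \<le> B Y + \<rho>"
        using f_ge[OF v, of Y "est Y"] estF(2)[OF t(1), of Y] by linarith
      then show ?thesis using B(2)[OF v, of Y] by linarith
    qed
    define D where "D Y = 4 * (2 * B Y + \<rho>)" for Y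
    have [measurable]: "B \<in> borel_measurable (sample d n \<theta>)"
      using B(1) by (simp cong: measurable_cong_sets[OF sets_sample refl])
    have meas: "D \<in> borel_measurable (sample d n \<theta>)" unfolding D_def by measurable
    have D0: "0 \<le> D Y" for Y using B(3)[of Y] \<rho> by (simp add: D_def)
    have b0: "0 \<le> 2 * B Y + \<rho>" for Y using B(3)[of Y] \<rho> by simp
    have "(\<integral>\<^sup>+Y. ennreal (D Y) \<partial>sample d n \<theta>) = (\<integral>\<^sup>+Y. ennreal 8 * ennreal (B Y) + ennreal (4 * \<rho>) \<partial>sample d n \<theta>)"
    proof (rule nn_integral_cong)
      fix Y
      have "D Y = 8 * B Y + 4 * \<rho>" by (simp add: D_def)
      moreover have "ennreal (8 * B Y + 4 * \<rho>) = ennreal (8 * B Y) + ennreal (4 * \<rho>)"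
        using B(3)[of Y] \<rho> by (intro ennreal_plus) auto
      moreover have "ennreal (8 * B Y) = ennreal 8 * ennreal (B Y)"
        using B(3)[of Y] by (intro ennreal_mult) auto
      ultimately show "ennreal (D Y) = ennreal 8 * ennreal (B Y) + ennreal (4 * \<rho>)" by metis
    qed
    also have "\<dots> = ennreal 8 * (\<integral>\<^sup>+Y. ennreal (B Y) \<partial>sample d n \<theta>) + ennreal (4 * \<rho>)"
      by (simp add: nn_integral_add nn_integral_cmult)
    also have "\<dots> \<le> ennreal 8 * ennreal (64 * (sqrt \<rho> * (1 + vnorm d \<theta>) + \<rho>)) + ennreal (4 * \<rho>)"
      by (intro add_mono mult_left_mono B(4)) auto
    also have "\<dots> = ennreal (8 * (64 * (sqrt \<rho> * (1 + vnorm d \<theta>) + \<rho>)) + 4 * \<rho>)"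
      using \<rho> by (subst ennreal_plus) (auto simp: ennreal_mult)
    also have "\<dots> \<le> ennreal (516 * (sqrt \<rho> * (1 + vnorm d \<theta>) + \<rho>))"
    proof (rule ennreal_leI)
      have "8 * (64 * (x + \<rho>)) + 4 * \<rho> \<le> 516 * (x + \<rho>)" if "0 \<le> x" for x using that by simp
      from this[of "sqrt \<rho> * (1 + vnorm d \<theta>)"]
      show "8 * (64 * (sqrt \<rho> * (1 + vnorm d \<theta>) + \<rho>)) + 4 * \<rho> \<le> 516 * (sqrt \<rho> * (1 + vnorm d \<theta>) + \<rho>)"
        using \<rho> by simp
    qed
    finally have int: "(\<integral>\<^sup>+Y. ennreal (D Y) \<partial>sample d n \<theta>) \<le> ennreal (516 * (sqrt \<rho> * (1 + vnorm d \<theta>) + \<rho>))" .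
    have "vnorm d \<theta> * loss d (est Y) \<theta> \<le> D Y \<and> (loss d (est Y) \<theta>)\<^sup>2 \<le> D Y" for Y
      unfolding D_def using loss_times_max_le[OF N(1) b0[of Y] dev] by simp
    with meas D0 int show ?thesis by (intro exI[of _ D]) simp
  qed
  note main = this
  show ?thesis
  proof (rule bexI[of _ est], intro allI impI)
    fix \<theta> assume "vnorm d \<theta> \<le> r"
    from main[OF this, unfolded \<rho>_def] show "\<exists>D.
     D \<in> borel_measurable (sample d n \<theta>) \<and>
     (\<forall>Y. 0 \<le> D Y \<and> vnorm d \<theta> * loss d (est Y) \<theta> \<le> D Y \<and> (loss d (est Y) \<theta>)\<^sup>2 \<le> D Y) \<and>
     (\<integral>\<^sup>+Y. ennreal (D Y) \<partial>sample d n \<theta>)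
       \<le> ennreal (516 * (sqrt (real d / real n) * (1 + vnorm d \<theta>) + real d / real n))" .
  next
    show "est \<in> estimators d n" using est by (simp add: estimators_def)
  qed
qed

lemma minimax_risk_le_radius:
  assumes "\<And>\<theta>. \<theta> \<in> T \<Longrightarrow> vnorm d \<theta> \<le> r"
  shows "minimax_risk d n T \<le> ennreal r"
proof -
  define z :: "nat \<Rightarrow> real" where "z = (\<lambda>i\<in>{..<d}. 0)"
  have "(\<lambda>_. z) \<in> estimators d n"
    by (auto simp: estimators_def z_def euclid_def space_PiM)
  moreover have "loss d z \<theta> = vnorm d \<theta>" for \<theta>
  proof -
    have "vnorm d (\<lambda>i. z i - \<theta> i) = vnorm d \<theta>" "vnorm d (\<lambda>i. z i + \<theta> i) = vnorm d \<theta>"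
      by (auto simp: vnorm_def z_def L2_set_def intro!: sum.cong)
    then show ?thesis by (simp add: loss_def)
  qed
  ultimately show ?thesis
    unfolding minimax_risk_def using assms
    by (intro INF_lower2[of "\<lambda>_. z"] SUP_least) (auto simp: intro: ennreal_leI)
qed

lemma sphere_rate_eq:
  assumes "s > 0"
  shows "sphere_rate d n s = ennreal
    (min ((real d / real n + sqrt (real d / real n)) / s + sqrt (real d / real n)) s)"
proof -
  define \<rho> where "\<rho> = real d / real n"
  have \<rho>: "0 \<le> \<rho>" by (simp add: \<rho>_def)
  have "1 / ennreal s * ennreal (\<rho> + sqrt \<rho>) + ennreal (sqrt \<rho>)
      = ennreal (1 / s * (\<rho> + sqrt \<rho>) + sqrt \<rho>)"
  proof -
    have "1 / ennreal s = ennreal (1 / s)" using divide_ennreal[of 1 s] assms by simp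
    moreover have "ennreal (1 / s) * ennreal (\<rho> + sqrt \<rho>) = ennreal (1 / s * (\<rho> + sqrt \<rho>))"
      using assms \<rho> by (intro ennreal_mult[symmetric]) auto
    ultimately show ?thesis using assms \<rho> by (simp add: ennreal_plus)
  qed
  then show ?thesis using assms \<rho>
    by (simp add: sphere_rate_def ennreal_min \<rho>_def)
qed

lemma minimax_risk_sphere_le:
  assumes d: "d \<ge> 1" and n: "n \<ge> 1" and s: "s \<ge> 0"
  shows "minimax_risk d n (vsphere d s) \<le> ennreal 516 * sphere_rate d n s"
proof (cases "s = 0")
  case True
  have "minimax_risk d n (vsphere d s) \<le> ennreal 0"
    using True by (intro minimax_risk_le_radius) (auto simp: vsphere_def)
  then show ?thesis by simp
next
  case False
  define \<rho> where "\<rho> = real d / real n"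
  have \<rho>: "\<rho> > 0" using d n by (simp add: \<rho>_def)
  have s0: "s > 0" using False s by simp
  obtain est where est: "est \<in> estimators d n" and D: "\<And>\<theta>. vnorm d \<theta> \<le> s \<Longrightarrow> (\<exists>D.
     D \<in> borel_measurable (sample d n \<theta>) \<and>
     (\<forall>Y. 0 \<le> D Y \<and> vnorm d \<theta> * loss d (est Y) \<theta> \<le> D Y \<and> (loss d (est Y) \<theta>)\<^sup>2 \<le> D Y) \<and>
     (\<integral>\<^sup>+Y. ennreal (D Y) \<partial>sample d n \<theta>) \<le> ennreal (516 * (sqrt \<rho> * (1 + vnorm d \<theta>) + \<rho>)))"
    using least_deviation_estimator[OF d n s] unfolding \<rho>_def by blast
  have "(\<integral>\<^sup>+Y. ennreal (loss d (est Y) \<theta>) \<partial>sample d n \<theta>) \<le> ennreal (516 * ((\<rho> + sqrt \<rho>) / s + sqrt \<rho>))"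
    if \<theta>: "vnorm d \<theta> = s" for \<theta>
  proof -
    obtain D where D: "D \<in> borel_measurable (sample d n \<theta>)" "\<And>Y. 0 \<le> D Y" "\<And>Y. s * loss d (est Y) \<theta> \<le> D Y"
      "(\<integral>\<^sup>+Y. ennreal (D Y) \<partial>sample d n \<theta>) \<le> ennreal (516 * (sqrt \<rho> * (1 + s) + \<rho>))"
      using D[of \<theta>] \<theta> by auto
    have "(\<integral>\<^sup>+Y. ennreal (loss d (est Y) \<theta>) \<partial>sample d n \<theta>) \<le> (\<integral>\<^sup>+Y. ennreal (1 / s) * ennreal (D Y) \<partial>sample d n \<theta>)"
    proof (rule nn_integral_mono)
      fix Y
      have "loss d (est Y) \<theta> \<le> 1 / s * D Y" using D(3)[of Y] s0 by (simp add: field_simps)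
      then show "ennreal (loss d (est Y) \<theta>) \<le> ennreal (1 / s) * ennreal (D Y)"
        using D(2)[of Y] s0 by (simp add: ennreal_leI flip: ennreal_mult)
    qed
    also have "\<dots> = ennreal (1 / s) * (\<integral>\<^sup>+Y. ennreal (D Y) \<partial>sample d n \<theta>)"
      using D(1) by (intro nn_integral_cmult) simp
    also have "\<dots> \<le> ennreal (1 / s) * ennreal (516 * (sqrt \<rho> * (1 + s) + \<rho>))"
      by (intro mult_left_mono D(4)) simp
    also have "\<dots> = ennreal (1 / s * (516 * (sqrt \<rho> * (1 + s) + \<rho>)))"
      using s0 \<rho> by (intro ennreal_mult[symmetric]) auto
    also have "1 / s * (516 * (sqrt \<rho> * (1 + s) + \<rho>)) = 516 * ((\<rho> + sqrt \<rho>) / s + sqrt \<rho>)"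
      using s0 by (simp add: field_simps)
    finally show ?thesis .
  qed
  then have 1: "minimax_risk d n (vsphere d s) \<le> ennreal (516 * ((\<rho> + sqrt \<rho>) / s + sqrt \<rho>))"
    unfolding minimax_risk_def using est by (intro INF_lower2[OF est] SUP_least) (auto simp: vsphere_def)
  have 2: "minimax_risk d n (vsphere d s) \<le> ennreal s"
    by (intro minimax_risk_le_radius) (auto simp: vsphere_def)
  have min_scale: "min (516 * x) (516 * y) = 516 * min x y" for x y :: real by (simp add: min_def)
  from 2 have "minimax_risk d n (vsphere d s) \<le> ennreal (516 * s)"
    by (rule order_trans) (use s in \<open>simp add: ennreal_leI\<close>)
  then have "minimax_risk d n (vsphere d s) \<le> ennreal (min (516 * ((\<rho> + sqrt \<rho>) / s + sqrt \<rho>)) (516 * s))"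
    using 1 by (auto simp: min_def)
  also have "min (516 * ((\<rho> + sqrt \<rho>) / s + sqrt \<rho>)) (516 * s) = 516 * min ((\<rho> + sqrt \<rho>) / s + sqrt \<rho>) s"
    by (rule min_scale)
  also have "ennreal \<dots> = ennreal 516 * ennreal (min ((\<rho> + sqrt \<rho>) / s + sqrt \<rho>) s)"
    using s0 \<rho> by (intro ennreal_mult) auto
  finally show ?thesis using sphere_rate_eq[OF s0, of d n] by (simp add: \<rho>_def)
qed

text \<open>
  If \<open>s \<surd>\<rho>\<close> dominates \<open>\<rho> + \<surd>\<rho>\<close>, the bound on \<open>s\<close> times the loss gives an error of order \<open>\<surd>\<rho>\<close>;
  otherwise the bound on the squared loss gives one of order \<open>\<surd>(\<rho> + \<surd>\<rho>)\<close>.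
\<close>

lemma minimax_risk_ball_le:
  assumes d: "d \<ge> 1" and n: "n \<ge> 1" and r: "r \<ge> 0"
  shows "minimax_risk d n (vball d r) \<le> ennreal 1033 * ball_rate d n r"
proof -
  define \<rho> where "\<rho> = real d / real n"
  have \<rho>: "\<rho> > 0" using d n by (simp add: \<rho>_def)
  define b where "b = \<rho> + sqrt \<rho>"
  have b: "b > 0" using \<rho> by (simp add: b_def add_pos_pos)
  define R where "R = \<rho> powr (1 / 4) + sqrt \<rho>"
  have R: "sqrt b \<le> R"
  proof -
    have "\<rho> powr (1 / 4) = sqrt (sqrt \<rho>)"
      using \<rho> by (simp add: powr_half_sqrt[symmetric] powr_powr)
    then show ?thesis
      using sqrt_add_le_add_sqrt[of \<rho> "sqrt \<rho>"] \<rho> by (simp add: b_def R_def)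
  qed
  have sR: "sqrt \<rho> \<le> R" by (simp add: R_def)
  have R0: "0 \<le> R" using R b by (meson order_trans real_sqrt_ge_zero less_imp_le)
  obtain est where est: "est \<in> estimators d n" and D: "\<And>\<theta>. vnorm d \<theta> \<le> r \<Longrightarrow> (\<exists>D.
     D \<in> borel_measurable (sample d n \<theta>) \<and>
     (\<forall>Y. 0 \<le> D Y \<and> vnorm d \<theta> * loss d (est Y) \<theta> \<le> D Y \<and> (loss d (est Y) \<theta>)\<^sup>2 \<le> D Y) \<and>
     (\<integral>\<^sup>+Y. ennreal (D Y) \<partial>sample d n \<theta>) \<le> ennreal (516 * (sqrt \<rho> * (1 + vnorm d \<theta>) + \<rho>)))"
    using least_deviation_estimator[OF d n r] unfolding \<rho>_def by blast
  have bound: "(\<integral>\<^sup>+Y. ennreal (loss d (est Y) \<theta>) \<partial>sample d n \<theta>) \<le> ennreal (1033 * R)"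
    if \<theta>: "vnorm d \<theta> \<le> r" for \<theta>
  proof -
    define s where "s = vnorm d \<theta>"
    have s: "s \<ge> 0" by (simp add: s_def)
    obtain D where D: "D \<in> borel_measurable (sample d n \<theta>)" "\<And>Y. 0 \<le> D Y" "\<And>Y. s * loss d (est Y) \<theta> \<le> D Y"
      "\<And>Y. (loss d (est Y) \<theta>)\<^sup>2 \<le> D Y"
      "(\<integral>\<^sup>+Y. ennreal (D Y) \<partial>sample d n \<theta>) \<le> ennreal (516 * (sqrt \<rho> * (1 + s) + \<rho>))"
      using D[of \<theta>] \<theta> unfolding s_def by auto
    \<comment> \<open>Both regimes bound the loss by an affine function of \<open>D\<close>.\<close>
    have affine: "(\<integral>\<^sup>+Y. ennreal (loss d (est Y) \<theta>) \<partial>sample d n \<theta>)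
        \<le> ennreal (p * (516 * (s * sqrt \<rho> + b)) + q)"
      if p: "0 \<le> p" and q: "0 \<le> q" and le: "\<And>Y. loss d (est Y) \<theta> \<le> p * D Y + q" for p q
    proof -
      have "(\<integral>\<^sup>+Y. ennreal (loss d (est Y) \<theta>) \<partial>sample d n \<theta>)
          \<le> (\<integral>\<^sup>+Y. ennreal p * ennreal (D Y) + ennreal q \<partial>sample d n \<theta>)"
        using le D(2) p q by (intro nn_integral_mono) (simp add: ennreal_leI flip: ennreal_mult ennreal_plus)
      also have "\<dots> = ennreal p * (\<integral>\<^sup>+Y. ennreal (D Y) \<partial>sample d n \<theta>) + ennreal q"
        using D(1) by (simp add: nn_integral_add nn_integral_cmult)
      also have "\<dots> \<le> ennreal p * ennreal (516 * (sqrt \<rho> * (1 + s) + \<rho>)) + ennreal q"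
        by (intro add_mono mult_left_mono D(5)) auto
      also have "\<dots> = ennreal (p * (516 * (sqrt \<rho> * (1 + s) + \<rho>)) + q)"
        using p q s \<rho> by (simp flip: ennreal_mult ennreal_plus)
      also have "sqrt \<rho> * (1 + s) + \<rho> = s * sqrt \<rho> + b" by (simp add: b_def algebra_simps)
      finally show ?thesis .
    qed
    show ?thesis
    proof (cases "b \<le> s * sqrt \<rho>")
      case True
      then have s0: "s > 0" using b s by (cases "s = 0") auto
      have "(\<integral>\<^sup>+Y. ennreal (loss d (est Y) \<theta>) \<partial>sample d n \<theta>) \<le> ennreal (1 / s * (516 * (s * sqrt \<rho> + b)) + 0)"
        using D(3) s0 by (intro affine) (auto simp: field_simps)
      also have "\<dots> \<le> ennreal (1 / s * (516 * (s * sqrt \<rho> + s * sqrt \<rho>)) + 0)"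
        using True s0 by (intro ennreal_leI add_right_mono mult_left_mono) auto
      also have "\<dots> = ennreal (1032 * sqrt \<rho>)" using s0 by (simp add: field_simps)
      also have "\<dots> \<le> ennreal (1033 * R)" using sR R0 by (intro ennreal_leI) linarith
      finally show ?thesis .
    next
      case False
      have t: "sqrt b > 0" using b by simp
      have "(\<integral>\<^sup>+Y. ennreal (loss d (est Y) \<theta>) \<partial>sample d n \<theta>)
          \<le> ennreal (1 / sqrt b * (516 * (s * sqrt \<rho> + b)) + sqrt b)"
      proof (rule affine)
        fix Y
        define L where "L = loss d (est Y) \<theta>"
        have L: "L \<ge> 0" "L\<^sup>2 \<le> D Y" using D(4)[of Y] by (simp_all add: L_def)
        \<comment> \<open>The level \<open>\<surd>b\<close> balances \<open>L\<^sup>2 / \<surd>b\<close> against \<open>\<surd>b\<close>.\<close>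
        have "L * sqrt b \<le> L\<^sup>2 + sqrt b * sqrt b"
        proof -
          have "2 * (L * sqrt b) \<le> L\<^sup>2 + (sqrt b)\<^sup>2" using sum_squares_bound[of L "sqrt b"] by simp
          moreover have "0 \<le> L * sqrt b" using L t by simp
          ultimately show ?thesis by (simp add: power2_eq_square)
        qed
        then have "L \<le> (L\<^sup>2 + sqrt b * sqrt b) / sqrt b" using t by (simp add: pos_le_divide_eq)
        also have "\<dots> = 1 / sqrt b * L\<^sup>2 + sqrt b"
        proof -
          have "(x + c * c) / c = 1 / c * x + c" if "c > 0" for x c :: real
            using that by (simp add: field_simps)
          from this[OF t] show ?thesis .
        qed
        also have "\<dots> \<le> 1 / sqrt b * D Y + sqrt b"
          using L(2) t by (intro add_right_mono mult_left_mono) auto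
        finally show "loss d (est Y) \<theta> \<le> 1 / sqrt b * D Y + sqrt b" by (simp add: L_def)
      qed (use t in auto)
      also have "\<dots> \<le> ennreal (1 / sqrt b * (516 * (b + b)) + sqrt b)"
        using False t by (intro ennreal_leI add_right_mono mult_left_mono) auto
      also have "1 / sqrt b * (516 * (b + b)) + sqrt b = 1032 * (b / sqrt b) + sqrt b" by simp
      also have "b / sqrt b = sqrt b" using b by (simp add: real_div_sqrt)
      also have "ennreal (1032 * sqrt b + sqrt b) \<le> ennreal (1033 * R)" using R by (intro ennreal_leI) simp
      finally show ?thesis .
    qed
  qed
  have 1: "minimax_risk d n (vball d r) \<le> ennreal (1033 * R)"
    unfolding minimax_risk_def using bound
    by (intro INF_lower2[OF est] SUP_least) (auto simp: vball_def)
  have 2: "minimax_risk d n (vball d r) \<le> ennreal r"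
    by (intro minimax_risk_le_radius) (auto simp: vball_def)
  also have "\<dots> \<le> ennreal (1033 * r)" using r by (intro ennreal_leI) simp
  finally have "minimax_risk d n (vball d r) \<le> ennreal (min (1033 * R) (1033 * r))"
    using 1 by (auto simp: min_def)
  also have "min (1033 * R) (1033 * r) = 1033 * min R r" by (simp add: min_def)
  also have "ennreal \<dots> = ennreal 1033 * ennreal (min R r)"
    using R0 r by (intro ennreal_mult) auto
  finally show ?thesis by (simp add: ball_rate_def R_def \<rho>_def)
qed

section \<open>Testing between two samples\<close>

lemma PiM_density_eq:
  assumes I: "finite I" and f [measurable]: "f \<in> borel_measurable M"
    and M: "prob_space M" and D: "prob_space (density M f)"
  shows "(\<Pi>\<^sub>M i\<in>I. density M f) = density (\<Pi>\<^sub>M i\<in>I. M) (\<lambda>x. \<Prod>i\<in>I. f (x i))"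
proof -
  interpret P: product_sigma_finite "\<lambda>_. M"
    using M by (simp add: product_sigma_finite_def prob_space_imp_sigma_finite)
  interpret Q: product_sigma_finite "\<lambda>_. density M f"
    using D by (simp add: product_sigma_finite_def prob_space_imp_sigma_finite)
  have fm [measurable]: "(\<lambda>x. \<Prod>i\<in>I. f (x i)) \<in> borel_measurable (\<Pi>\<^sub>M i\<in>I. M)"
    by (intro borel_measurable_prod_ennreal measurable_compose[OF _ f]) measurable
  show ?thesis
  proof (rule Q.PiM_eqI[symmetric, OF I])
    show "sets (density (\<Pi>\<^sub>M i\<in>I. M) (\<lambda>x. \<Prod>i\<in>I. f (x i))) = sets (\<Pi>\<^sub>M i\<in>I. density M f)"
      by (simp cong: sets_PiM_cong)
    fix A assume A: "\<And>i. i \<in> I \<Longrightarrow> A i \<in> sets (density M f)"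
    then have A': "\<And>i. i \<in> I \<Longrightarrow> A i \<in> sets M" by simp
    have PA: "Pi\<^sub>E I A \<in> sets (\<Pi>\<^sub>M i\<in>I. M)" using I A' by (intro sets_PiM_I_finite) auto
    have "emeasure (density (\<Pi>\<^sub>M i\<in>I. M) (\<lambda>x. \<Prod>i\<in>I. f (x i))) (Pi\<^sub>E I A)
      = (\<integral>\<^sup>+x. (\<Prod>i\<in>I. f (x i)) * indicator (Pi\<^sub>E I A) x \<partial>(\<Pi>\<^sub>M i\<in>I. M))"
      using PA fm by (simp add: emeasure_density)
    also have "\<dots> = (\<integral>\<^sup>+x. (\<Prod>i\<in>I. f (x i) * indicator (A i) (x i)) \<partial>(\<Pi>\<^sub>M i\<in>I. M))"
    proof (rule nn_integral_cong)
      fix x assume "x \<in> space (\<Pi>\<^sub>M i\<in>I. M)"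
      then have x: "x \<in> extensional I" by (auto simp: space_PiM PiE_def)
      have "indicator (Pi\<^sub>E I A) x = (\<Prod>i\<in>I. indicator (A i) (x i) :: ennreal)"
      proof (cases "x \<in> Pi\<^sub>E I A")
        case True
        then show ?thesis by (auto simp: PiE_def Pi_def intro!: prod.neutral[symmetric])
      next
        case False
        then obtain i where "i \<in> I" "x i \<notin> A i" using x by (auto simp: PiE_def)
        then have "(\<Prod>i\<in>I. indicator (A i) (x i) :: ennreal) = 0"
          using I by (intro prod_zero bexI[of _ i]) auto
        with False show ?thesis by simp
      qed
      then show "(\<Prod>i\<in>I. f (x i)) * indicator (Pi\<^sub>E I A) x = (\<Prod>i\<in>I. f (x i) * indicator (A i) (x i))"
        by (simp add: prod.distrib)
    qed
    also have "\<dots> = (\<Prod>i\<in>I. \<integral>\<^sup>+y. f y * indicator (A i) y \<partial>M)"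
      using A' I by (intro P.product_nn_integral_prod) auto
    also have "\<dots> = (\<Prod>i\<in>I. emeasure (density M f) (A i))"
      using A' by (intro prod.cong) (auto simp: emeasure_density)
    finally show "emeasure (density (\<Pi>\<^sub>M i\<in>I. M) (\<lambda>x. \<Prod>i\<in>I. f (x i))) (Pi\<^sub>E I A)
      = (\<Prod>i\<in>I. emeasure (density M f) (A i))" .
  qed
qed

text \<open>
  From \<open>R \<le> 1 + R\<^sup>2 / 4\<close>, integrated over \<open>A\<close>: the second event probability exceeds the first by at
  most a quarter of the second moment. Second moments are used as they are multiplicative over
  independent samples.
\<close>

lemma error_sum_of_second_moment:
  assumes P: "prob_space P" and Q: "prob_space Q" and QP: "Q = density P (\<lambda>x. ennreal (R x))"
    and R [measurable]: "R \<in> borel_measurable P" and R0: "\<And>x. 0 \<le> R x"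
    and K: "(\<integral>\<^sup>+x. ennreal ((R x)\<^sup>2) \<partial>P) \<le> 2" and A [measurable]: "A \<in> sets P"
  shows "measure P A + measure Q (space Q - A) \<ge> 1 / 2"
proof -
  interpret P: prob_space P by (rule P)
  interpret Q: prob_space Q by (rule Q)
  have "emeasure Q A = (\<integral>\<^sup>+x. ennreal (R x) * indicator A x \<partial>P)"
    unfolding QP by (rule emeasure_density) auto
  also have "\<dots> \<le> (\<integral>\<^sup>+x. indicator A x + ennreal (1 / 4) * ennreal ((R x)\<^sup>2) \<partial>P)"
  proof (rule nn_integral_mono)
    fix x
    have "0 \<le> (R x / 2 - 1)\<^sup>2" by simp
    then have "R x \<le> 1 + 1 / 4 * (R x)\<^sup>2" by (simp add: power2_eq_square algebra_simps)
    then have "ennreal (R x) \<le> ennreal (1 + 1 / 4 * (R x)\<^sup>2)" by (rule ennreal_leI)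
    also have "\<dots> = 1 + ennreal (1 / 4) * ennreal ((R x)\<^sup>2)"
    proof -
      have "ennreal (1 + 1 / 4 * (R x)\<^sup>2) = ennreal 1 + ennreal (1 / 4 * (R x)\<^sup>2)"
        by (rule ennreal_plus) auto
      also have "ennreal (1 / 4 * (R x)\<^sup>2) = ennreal (1 / 4) * ennreal ((R x)\<^sup>2)"
        by (rule ennreal_mult) auto
      finally show ?thesis by simp
    qed
    finally show "ennreal (R x) * indicator A x \<le> indicator A x + ennreal (1 / 4) * ennreal ((R x)\<^sup>2)"
      by (cases "x \<in> A") auto
  qed
  also have "\<dots> = emeasure P A + ennreal (1 / 4) * (\<integral>\<^sup>+x. ennreal ((R x)\<^sup>2) \<partial>P)"
    by (subst nn_integral_add) (auto simp: nn_integral_cmult)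
  also have "\<dots> \<le> ennreal (measure P A) + ennreal (1 / 4) * ennreal 2"
    using K by (intro add_mono mult_left_mono) (auto simp: P.emeasure_eq_measure)
  also have "\<dots> = ennreal (measure P A + 1 / 2)"
  proof -
    have "ennreal (1 / 4) * ennreal 2 = ennreal (1 / 4 * 2)" by (rule ennreal_mult[symmetric]) auto
    then show ?thesis by (subst ennreal_plus) simp_all
  qed
  finally have "ennreal (measure Q A) \<le> ennreal (measure P A + 1 / 2)"
    unfolding Q.emeasure_eq_measure .
  then have "measure Q A \<le> measure P A + 1 / 2" by (subst (asm) ennreal_le_iff) simp_all
  moreover have "measure Q (space Q - A) = 1 - measure Q A"
    using A by (intro Q.prob_compl) (simp add: QP)
  ultimately show ?thesis by simp
qed

lemma error_sum_samples:
  assumes q: "gmix d \<theta>' = density (gmix d \<theta>) (\<lambda>x. ennreal (f x))"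
    and f [measurable]: "f \<in> borel_measurable (euclid d)" and f0: "\<And>x. 0 \<le> f x"
    and K: "(\<integral>\<^sup>+x. ennreal ((f x)\<^sup>2) \<partial>gmix d \<theta>) ^ n \<le> 2"
    and A: "A \<in> sets (\<Pi>\<^sub>M j\<in>{..<n}. euclid d)"
  shows "measure (sample d n \<theta>) A + measure (sample d n \<theta>') (space (\<Pi>\<^sub>M j\<in>{..<n}. euclid d) - A) \<ge> 1 / 2"
proof -
  have [measurable]: "f \<in> borel_measurable (gmix d \<theta>)" by (simp cong: measurable_cong_sets)
  have D: "sample d n \<theta>' = density (sample d n \<theta>) (\<lambda>Y. ennreal (\<Prod>j<n. f (Y j)))"
  proof -
    have "sample d n \<theta>' = density (sample d n \<theta>) (\<lambda>Y. \<Prod>j<n. ennreal (f (Y j)))"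
      unfolding sample_def q
      using prob_space_gmix[of d \<theta>] prob_space_gmix[of d \<theta>', unfolded q]
      by (intro PiM_density_eq) auto
    then show ?thesis by (simp add: prod_ennreal f0)
  qed
  have K': "(\<integral>\<^sup>+Y. ennreal ((\<Prod>j<n. f (Y j))\<^sup>2) \<partial>sample d n \<theta>) \<le> 2"
  proof -
    have "(\<integral>\<^sup>+Y. ennreal ((\<Prod>j<n. f (Y j))\<^sup>2) \<partial>sample d n \<theta>)
      = (\<integral>\<^sup>+Y. (\<Prod>j<n. ennreal ((f (Y j))\<^sup>2)) \<partial>sample d n \<theta>)"
      by (simp add: prod_ennreal prod_power_distrib)
    also have "\<dots> = (\<integral>\<^sup>+x. ennreal ((f x)\<^sup>2) \<partial>gmix d \<theta>) ^ n"
      by (rule nn_integral_sample_prod) measurable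
    finally show ?thesis using K by simp
  qed
  have "(\<lambda>Y. \<Prod>j<n. f (Y j)) \<in> borel_measurable (\<Pi>\<^sub>M j\<in>{..<n}. euclid d)"
    by (intro borel_measurable_prod measurable_compose[OF _ f]) auto
  then have m: "(\<lambda>Y. \<Prod>j<n. f (Y j)) \<in> borel_measurable (sample d n \<theta>)"
    by (simp cong: measurable_cong_sets[OF sets_sample refl])
  show ?thesis
    using error_sum_of_second_moment[OF prob_space_sample prob_space_sample D m _ K', of A] A
    by (simp add: f0 prod_nonneg sets_sample space_sample)
qed

text \<open>
  Fubini with respect to the coordinate \<open>i\<close>. Functions on extensional vectors do not restrict well to
  fewer coordinates, so independence of the coordinate is expressed by invariance under updates.
\<close>

lemma nn_integral_gauss_coordinate_factor:
  assumes i: "i < d" and f [measurable]: "f \<in> borel_measurable (euclid d)"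
    and indep: "\<And>x y. f (x(i := y)) = f x" and g [measurable]: "g \<in> borel_measurable borel"
  shows "(\<integral>\<^sup>+x. f x * g (x i) \<partial>gauss d \<mu>) =
    (\<integral>\<^sup>+x. f x \<partial>gauss d \<mu>) * (\<integral>\<^sup>+y. ennreal (normal_density (\<mu> i) 1 y) * g y \<partial>lborel)"
proof -
  define G where "G j = density lborel (\<lambda>x. ennreal (normal_density (\<mu> j) 1 x))" for j
  have pG: "prob_space (G j)" for j unfolding G_def by (rule prob_space_normal_density) simp
  interpret product_sigma_finite G
    using pG by (simp add: product_sigma_finite_def prob_space_imp_sigma_finite)
  define I where "I = {..<d} - {i}"
  have I: "finite I" "i \<notin> I" "insert i I = {..<d}" using i by (auto simp: I_def)
  have gauss: "gauss d \<mu> = Pi\<^sub>M (insert i I) G"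
    unfolding I G_def by (rule gauss_eq_PiM)
  have sets: "sets (Pi\<^sub>M (insert i I) G) = sets (euclid d)"
    by (simp flip: gauss)
  have fm: "f \<in> borel_measurable (Pi\<^sub>M (insert i I) G)"
    by (simp cong: measurable_cong_sets[OF sets refl])
  have fgm: "(\<lambda>x. f x * g (x i)) \<in> borel_measurable (Pi\<^sub>M (insert i I) G)"
    using measurable_component_euclid[OF i] by (simp cong: measurable_cong_sets[OF sets refl])
  have one: "(\<integral>\<^sup>+y. 1 \<partial>G i) = 1" using prob_space.emeasure_space_1[OF pG, of i] by simp
  have g': "g \<in> borel_measurable (G i)" by (simp add: G_def)
  have "(\<lambda>x. x(i := 0)) \<in> Pi\<^sub>M I G \<rightarrow>\<^sub>M Pi\<^sub>M (insert i I) G"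
    by (rule measurable_fun_upd[where J = I]) (auto simp: G_def)
  then have "(\<lambda>x. f (x(i := 0))) \<in> borel_measurable (Pi\<^sub>M I G)"
    using fm by (rule measurable_compose)
  then have fI: "f \<in> borel_measurable (Pi\<^sub>M I G)" by (simp add: indep)
  have "(\<integral>\<^sup>+x. f x \<partial>gauss d \<mu>) = (\<integral>\<^sup>+x. f x \<partial>Pi\<^sub>M I G)"
    unfolding gauss using one by (subst product_nn_integral_insert[OF I(1,2) fm]) (simp add: indep nn_integral_cmult)
  moreover have "(\<integral>\<^sup>+x. f x * g (x i) \<partial>gauss d \<mu>) = (\<integral>\<^sup>+x. f x * (\<integral>\<^sup>+y. g y \<partial>G i) \<partial>Pi\<^sub>M I G)"
    unfolding gauss using g' by (subst product_nn_integral_insert[OF I(1,2) fgm]) (simp add: indep nn_integral_cmult)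
  moreover have "(\<integral>\<^sup>+y. g y \<partial>G i) = (\<integral>\<^sup>+y. ennreal (normal_density (\<mu> i) 1 y) * g y \<partial>lborel)"
    unfolding G_def by (rule nn_integral_density) auto
  ultimately show ?thesis using fI by (simp add: nn_integral_multc)
qed

section \<open>Chi-square divergence of mixtures with a flipped coordinate\<close>

text \<open>
  The derivative of \<open>x cosh x - sinh x\<close> is \<open>x sinh x\<close>, which is nonnegative.
\<close>

lemma abs_sinh_le: "\<bar>sinh x\<bar> \<le> \<bar>x\<bar> * cosh (x :: real)"
proof -
  have pos: "sinh y \<le> y * cosh y" if "0 \<le> y" for y :: real
  proof -
    have "(\<lambda>x. x * cosh x - sinh x) 0 \<le> (\<lambda>x. x * cosh x - sinh x) y"
    proof (rule DERIV_nonneg_imp_nondecreasing[OF that])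
      fix x :: real assume "0 \<le> x"
      moreover have "((\<lambda>x. x * cosh x - sinh x) has_real_derivative x * sinh x) (at x)"
        by (auto intro!: derivative_eq_intros)
      ultimately show "\<exists>d. ((\<lambda>x. x * cosh x - sinh x) has_real_derivative d) (at x) \<and> 0 \<le> d"
        by (intro exI[of _ "x * sinh x"]) auto
    qed
    then show ?thesis by simp
  qed
  show ?thesis using pos[of "\<bar>x\<bar>"] by simp
qed

lemma cosh_le_cosh_diff_times_exp: "cosh (a :: real) \<le> cosh (a - b) * exp \<bar>b\<bar>"
proof -
  have "cosh a = cosh (a - b) * cosh b + sinh (a - b) * sinh b"
    using cosh_add[of "a - b" b] by simp
  also have "sinh (a - b) * sinh b \<le> cosh (a - b) * \<bar>sinh b\<bar>"
  proof -
    have "\<bar>sinh (a - b)\<bar> \<le> cosh (a - b)"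
      using sinh_le_cosh_real[of "a - b"] sinh_le_cosh_real[of "- (a - b)"] by (auto simp: abs_if simp del: minus_diff_eq)
    then have "\<bar>sinh (a - b)\<bar> * \<bar>sinh b\<bar> \<le> cosh (a - b) * \<bar>sinh b\<bar>" by (rule mult_right_mono) simp
    then show ?thesis by (simp flip: abs_mult) 
  qed
  also have "cosh (a - b) * cosh b + cosh (a - b) * \<bar>sinh b\<bar> = cosh (a - b) * (cosh \<bar>b\<bar> + sinh \<bar>b\<bar>)"
    by (simp add: distrib_left)
  also have "cosh \<bar>b\<bar> + sinh \<bar>b\<bar> = exp \<bar>b\<bar>" by (rule cosh_plus_sinh)
  finally show ?thesis by simp
qed

lemma cosh_le_exp_abs: "cosh (x :: real) \<le> exp \<bar>x\<bar>"
  using cosh_plus_sinh[of "\<bar>x\<bar>"] by simp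

text \<open>
  With \<open>a = m \<bullet> x\<close> and \<open>b = h x\<^sub>i\<close> the left-hand side is, up to normalisation, the integrand of the
  chi-square divergence. The increment is \<open>2 sinh a sinh b\<close>; one factor \<open>cosh a\<close> is kept, because it turns
  the standard Gaussian into the mixture with mean \<open>m\<close>, and \<open>tanh\<^sup>2 a\<close> is bounded by both \<open>1\<close> and \<open>a\<^sup>2\<close>.
\<close>

lemma cosh_increment_square_le:
  fixes a b :: real
  shows "(cosh (a + b) - cosh (a - b))\<^sup>2 / cosh (a - b) \<le> 4 * min 1 (a\<^sup>2) * (b\<^sup>2 * exp (3 * \<bar>b\<bar>)) * cosh a"
proof -
  have "cosh (a + b) - cosh (a - b) = 2 * sinh a * sinh b"
    by (simp add: cosh_add cosh_diff)
  then have sq: "(cosh (a + b) - cosh (a - b))\<^sup>2 = 4 * (sinh a)\<^sup>2 * (sinh b)\<^sup>2"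
    by (simp add: power_mult_distrib)
  have sb: "(sinh b)\<^sup>2 \<le> b\<^sup>2 * exp (2 * \<bar>b\<bar>)"
  proof -
    have "\<bar>sinh b\<bar> \<le> \<bar>b\<bar> * exp \<bar>b\<bar>"
      using abs_sinh_le[of b] mult_left_mono[OF cosh_le_exp_abs[of b], of "\<bar>b\<bar>"] by linarith
    then have "\<bar>sinh b\<bar>\<^sup>2 \<le> (\<bar>b\<bar> * exp \<bar>b\<bar>)\<^sup>2" by (intro power_mono) auto
    then show ?thesis by (simp add: power_mult_distrib exp_double[symmetric])
  qed
  have sa: "(sinh a)\<^sup>2 \<le> min 1 (a\<^sup>2) * (cosh a)\<^sup>2"
  proof -
    have "\<bar>sinh a\<bar>\<^sup>2 \<le> (\<bar>a\<bar> * cosh a)\<^sup>2" by (intro power_mono abs_sinh_le) auto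
    then have "(sinh a)\<^sup>2 \<le> a\<^sup>2 * (cosh a)\<^sup>2" by (simp add: power_mult_distrib)
    moreover have "(sinh a)\<^sup>2 \<le> 1 * (cosh a)\<^sup>2" by (simp add: cosh_square_eq)
    ultimately show ?thesis by (auto simp: min_def)
  qed
  have inv: "1 / cosh (a - b) \<le> exp \<bar>b\<bar> / cosh a"
    using cosh_le_cosh_diff_times_exp[of a b] by (simp add: field_simps)
  have "(cosh (a + b) - cosh (a - b))\<^sup>2 / cosh (a - b) = 4 * (sinh a)\<^sup>2 * (sinh b)\<^sup>2 * (1 / cosh (a - b))"
    by (simp add: sq)
  also have "\<dots> \<le> 4 * (min 1 (a\<^sup>2) * (cosh a)\<^sup>2) * (b\<^sup>2 * exp (2 * \<bar>b\<bar>)) * (exp \<bar>b\<bar> / cosh a)"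
    by (intro mult_mono sa sb inv) auto
  also have "\<dots> = 4 * min 1 (a\<^sup>2) * (b\<^sup>2 * (exp (2 * \<bar>b\<bar>) * exp \<bar>b\<bar>)) * cosh a"
    by (simp add: power2_eq_square)
  also have "exp (2 * \<bar>b\<bar>) * exp \<bar>b\<bar> = exp (3 * \<bar>b\<bar>)" by (simp flip: exp_add)
  finally show ?thesis .
qed

text \<open>
  The integrand is dominated by a multiple of \<open>exp (y\<^sup>2 / 4)\<close>, whose Gaussian integral is known
  explicitly from \<open>nn_integral_normal_exp_square\<close>.
\<close>

lemma nn_integral_normal_square_exp_le:
  "(\<integral>\<^sup>+y. ennreal (normal_density 0 1 y) * ennreal (y\<^sup>2 * exp (3 * \<bar>y\<bar>)) \<partial>lborel) \<le> ennreal (4 * exp 16)"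
proof -
  have pt: "y\<^sup>2 * exp (3 * \<bar>y\<bar>) \<le> 2 * exp 16 * exp (1 / 4 * y\<^sup>2)" for y :: real
  proof -
    have "1 + \<bar>y\<bar> + \<bar>y\<bar>\<^sup>2 / 2 \<le> exp \<bar>y\<bar>" by (rule exp_lower_Taylor_quadratic) simp
    then have "y\<^sup>2 \<le> 2 * exp \<bar>y\<bar>" by simp
    then have "y\<^sup>2 * exp (3 * \<bar>y\<bar>) \<le> 2 * exp \<bar>y\<bar> * exp (3 * \<bar>y\<bar>)" by (rule mult_right_mono) simp
    also have "\<dots> = 2 * exp (4 * \<bar>y\<bar>)" by (simp flip: exp_add)
    also have "\<dots> \<le> 2 * exp (16 + 1 / 4 * y\<^sup>2)"
    proof -
      \<comment> \<open>AM--GM in the form \<open>4 \<bar>y\<bar> \<le> 16 + y\<^sup>2 / 4\<close>.\<close>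
      have "0 \<le> (\<bar>y\<bar> / 2 - 4)\<^sup>2" by simp
      then have "4 * \<bar>y\<bar> \<le> 16 + 1 / 4 * \<bar>y\<bar>\<^sup>2" by (simp add: power2_diff power_divide)
      then show ?thesis by simp
    qed
    finally show ?thesis by (simp add: exp_add)
  qed
  have "(\<integral>\<^sup>+y. ennreal (normal_density 0 1 y) * ennreal (y\<^sup>2 * exp (3 * \<bar>y\<bar>)) \<partial>lborel)
    \<le> (\<integral>\<^sup>+y. ennreal (2 * exp 16) * (ennreal (normal_density 0 1 y) * ennreal (exp (1 / 4 * y\<^sup>2))) \<partial>lborel)"
  proof (rule nn_integral_mono)
    fix y :: real
    have "ennreal (y\<^sup>2 * exp (3 * \<bar>y\<bar>)) \<le> ennreal (2 * exp 16) * ennreal (exp (1 / 4 * y\<^sup>2))"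
      using ennreal_leI[OF pt[of y]] by (simp add: ennreal_mult)
    then have "ennreal (normal_density 0 1 y) * ennreal (y\<^sup>2 * exp (3 * \<bar>y\<bar>))
      \<le> ennreal (normal_density 0 1 y) * (ennreal (2 * exp 16) * ennreal (exp (1 / 4 * y\<^sup>2)))"
      by (rule mult_left_mono) simp
    then show "ennreal (normal_density 0 1 y) * ennreal (y\<^sup>2 * exp (3 * \<bar>y\<bar>))
      \<le> ennreal (2 * exp 16) * (ennreal (normal_density 0 1 y) * ennreal (exp (1 / 4 * y\<^sup>2)))"
      by (simp only: mult.left_commute)
  qed
  also have "\<dots> = ennreal (2 * exp 16) * (\<integral>\<^sup>+y. ennreal (normal_density 0 1 y) * ennreal (exp (1 / 4 * y\<^sup>2)) \<partial>lborel)"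
    by (rule nn_integral_cmult) simp
  also have "\<dots> = ennreal (2 * exp 16) * ennreal (1 / sqrt (1 / 2))"
    using nn_integral_normal_exp_square[of 1 "1/4" 0] by simp
  also have "\<dots> = ennreal (2 * exp 16 * (1 / sqrt (1 / 2)))" by (rule ennreal_mult[symmetric]) auto
  also have "\<dots> \<le> ennreal (4 * exp 16)"
  proof (rule ennreal_leI)
    have "1 / sqrt (1 / 2) = sqrt (2::real)" by (simp add: real_sqrt_divide)
    also have "\<dots> \<le> 2" by (simp add: real_sqrt_le_iff' )
    finally have "2 * exp 16 * (1 / sqrt (1 / 2)) \<le> 2 * exp 16 * (2::real)" by (intro mult_left_mono) auto
    then show "2 * exp 16 * (1 / sqrt (1 / 2)) \<le> 4 * exp (16::real)" by simp
  qed
  finally show ?thesis .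
qed

text \<open>
  Applied to \<open>\<mu> = \<plusminus>m\<close>: then \<open>m \<bullet> x\<close> has mean \<open>\<plusminus>\<parallel>m\<parallel>\<^sup>2\<close> and variance \<open>\<parallel>m\<parallel>\<^sup>2\<close>, so for \<open>\<parallel>m\<parallel> \<le> 1\<close> its second
  moment is of order \<open>\<parallel>m\<parallel>\<^sup>2\<close>.
\<close>

lemma nn_integral_gauss_truncated_square_le:
  assumes \<mu>: "\<bar>vdot d m \<mu>\<bar> = (vnorm d m)\<^sup>2"
  shows "(\<integral>\<^sup>+x. ennreal (min 1 ((vdot d m x)\<^sup>2)) \<partial>gauss d \<mu>) \<le> ennreal (4 * min 1 ((vnorm d m)\<^sup>2))"
proof (cases "vnorm d m \<le> 1 \<and> 0 < vnorm d m")
  case True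
  define \<sigma> where "\<sigma> = vnorm d m"
  define t where "t = vdot d m \<mu>"
  have \<sigma>: "0 < \<sigma>" "\<sigma> \<le> 1" using True by (simp_all add: \<sigma>_def)
  have t2: "t\<^sup>2 \<le> \<sigma>\<^sup>2"
  proof -
    have "t\<^sup>2 = (\<sigma>\<^sup>2)\<^sup>2" using \<mu> by (metis \<sigma>_def t_def power2_abs)
    also have "\<dots> = \<sigma>\<^sup>2 * \<sigma>\<^sup>2" by (simp add: power2_eq_square)
    also have "\<dots> \<le> 1 * \<sigma>\<^sup>2" using \<sigma> by (intro mult_right_mono) (auto simp: power_le_one)
    finally show ?thesis by simp
  qed
  have "(\<integral>\<^sup>+x. ennreal (min 1 ((vdot d m x)\<^sup>2)) \<partial>gauss d \<mu>) \<le> (\<integral>\<^sup>+x. ennreal ((vdot d m x)\<^sup>2) \<partial>gauss d \<mu>)"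
    by (intro nn_integral_mono ennreal_leI) auto
  also have "\<dots> = (\<integral>\<^sup>+y. ennreal (normal_density t \<sigma> y) * ennreal (y\<^sup>2) \<partial>lborel)"
    unfolding t_def \<sigma>_def using True by (intro nn_integral_gauss_vdot) auto
  also have "\<dots> \<le> (\<integral>\<^sup>+y. ennreal (2 * (normal_density t \<sigma> y * (y - t)\<^sup>2) + 2 * t\<^sup>2 * normal_density t \<sigma> y) \<partial>lborel)"
  proof (rule nn_integral_mono)
    fix y
    have "y\<^sup>2 \<le> 2 * (y - t)\<^sup>2 + 2 * t\<^sup>2"
      using zero_le_power2[of "y - 2 * t"] by (simp add: power2_eq_square algebra_simps)
    then have "normal_density t \<sigma> y * y\<^sup>2 \<le> normal_density t \<sigma> y * (2 * (y - t)\<^sup>2 + 2 * t\<^sup>2)"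
      by (rule mult_left_mono) simp
    also have "\<dots> = 2 * (normal_density t \<sigma> y * (y - t)\<^sup>2) + 2 * t\<^sup>2 * normal_density t \<sigma> y"
      by (simp add: algebra_simps)
    finally have "ennreal (normal_density t \<sigma> y * y\<^sup>2)
      \<le> ennreal (2 * (normal_density t \<sigma> y * (y - t)\<^sup>2) + 2 * t\<^sup>2 * normal_density t \<sigma> y)"
      by (rule ennreal_leI)
    then show "ennreal (normal_density t \<sigma> y) * ennreal (y\<^sup>2)
      \<le> ennreal (2 * (normal_density t \<sigma> y * (y - t)\<^sup>2) + 2 * t\<^sup>2 * normal_density t \<sigma> y)"
      by (simp add: ennreal_mult)
  qed
  also have "\<dots> = ennreal (2 * \<sigma>\<^sup>2 + 2 * t\<^sup>2)"
  proof -
    have 1: "has_bochner_integral lborel (\<lambda>y. normal_density t \<sigma> y * (y - t)\<^sup>2) (\<sigma>\<^sup>2)"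
      using normal_moment_even[OF \<sigma>(1), of t 1] by (simp add: numeral_2_eq_2)
    have 2: "has_bochner_integral lborel (normal_density t \<sigma>) 1"
      using \<sigma> by (simp add: has_bochner_integral_iff)
    have "has_bochner_integral lborel
        (\<lambda>y. 2 * (normal_density t \<sigma> y * (y - t)\<^sup>2) + 2 * t\<^sup>2 * normal_density t \<sigma> y) (2 * \<sigma>\<^sup>2 + 2 * t\<^sup>2 * 1)"
      by (intro has_bochner_integral_add has_bochner_integral_mult_right 1 2)
    then show ?thesis
      by (subst nn_integral_eq_integral) (auto simp: has_bochner_integral_iff intro!: add_nonneg_nonneg mult_nonneg_nonneg)
  qed
  also have "\<dots> \<le> ennreal (4 * \<sigma>\<^sup>2)" using t2 by (intro ennreal_leI) simp
  also have "\<sigma>\<^sup>2 = min 1 (\<sigma>\<^sup>2)" using \<sigma> power_le_one[of \<sigma> 2] by simp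
  finally show ?thesis by (simp add: \<sigma>_def)
next
  case False
  consider "vnorm d m = 0" | "vnorm d m > 1" using False vnorm_nonneg[of d m] by linarith
  then show ?thesis
  proof cases
    case 1
    have "vdot d m x = 0" for x using abs_vdot_le[of d m x] 1 by simp
    then show ?thesis by simp
  next
    case 2
    have "(\<integral>\<^sup>+x. ennreal (min 1 ((vdot d m x)\<^sup>2)) \<partial>gauss d \<mu>) \<le> (\<integral>\<^sup>+x. 1 \<partial>gauss d \<mu>)"
      by (intro nn_integral_mono) (simp add: min_def)
    also have "\<dots> = 1" using prob_space.emeasure_space_1[OF prob_space_gauss, of d \<mu>] by simp
    also have "\<dots> \<le> ennreal (4 * min 1 ((vnorm d m)\<^sup>2))"
    proof -
      have "1 \<le> (vnorm d m)\<^sup>2" using 2 by (simp add: one_le_power)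
      then show ?thesis by (simp add: min_def)
    qed
    finally show ?thesis .
  qed
qed

lemma borel_measurable_gmix_iff: "borel_measurable (gmix d \<theta>) = borel_measurable (euclid d)"
  and borel_measurable_gauss_iff: "borel_measurable (gauss d \<theta>) = borel_measurable (euclid d)"
  by (rule measurable_cong_sets, simp, simp)+

lemma vdot_single: "i < d \<Longrightarrow> vdot d (\<lambda>j. if j = i then h else 0) x = h * x i"
  by (simp add: vdot_def if_distrib[of "\<lambda>y. y * _"] cong: if_cong)

lemma flipped_mean_norms:
  assumes i: "i < d" and m: "m i = 0"
  shows "(vnorm d (\<lambda>j. m j - (if j = i then h else 0)))\<^sup>2 = (vnorm d m)\<^sup>2 + h\<^sup>2"
    and "(vnorm d (\<lambda>j. m j + (if j = i then h else 0)))\<^sup>2 = (vnorm d m)\<^sup>2 + h\<^sup>2"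
proof -
  define e where "e = (\<lambda>j. if j = i then h else 0)"
  have "vdot d e m = 0" "vdot d e e = h\<^sup>2"
    unfolding e_def vdot_single[OF i] by (simp_all add: m power2_eq_square)
  moreover have "vdot d m e = vdot d e m" by (rule vdot_commute)
  ultimately show "(vnorm d (\<lambda>j. m j - (if j = i then h else 0)))\<^sup>2 = (vnorm d m)\<^sup>2 + h\<^sup>2"
    and "(vnorm d (\<lambda>j. m j + (if j = i then h else 0)))\<^sup>2 = (vnorm d m)\<^sup>2 + h\<^sup>2"
    unfolding vdot_self[symmetric] vdot_add_left vdot_add_right vdot_diff_left vdot_diff_right
      e_def[symmetric] by simp_all
qed

text \<open>
  For means of equal norm the normalising constants in \<open>gmix_eq_density_gauss0\<close> cancel.
\<close>

lemma flipped_gmix_density: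
  assumes "(vnorm d \<theta>')\<^sup>2 = (vnorm d \<theta>)\<^sup>2"
  shows "gmix d \<theta>' = density (gmix d \<theta>) (\<lambda>x. ennreal (cosh (vdot d \<theta>' x) / cosh (vdot d \<theta> x)))"
proof -
  define c where "c = exp (- (vnorm d \<theta>)\<^sup>2 / 2)"
  have c: "c > 0" by (simp add: c_def)
  define p where "p x = ennreal (c * cosh (vdot d \<theta> x))" for x
  define r where "r x = ennreal (cosh (vdot d \<theta>' x) / cosh (vdot d \<theta> x))" for x
  have [measurable]: "p \<in> borel_measurable (euclid d)" "r \<in> borel_measurable (euclid d)"
    unfolding p_def r_def by measurable
  have "density (gmix d \<theta>) r = density (density (gauss d (\<lambda>_. 0)) p) r"
    unfolding gmix_eq_density_gauss0[of d \<theta>] p_def c_def ..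
  also have "\<dots> = density (gauss d (\<lambda>_. 0)) (\<lambda>x. p x * r x)"
    by (rule density_density_eq) (simp_all add: borel_measurable_gauss_iff)
  also have "(\<lambda>x. p x * r x) = (\<lambda>x. ennreal (exp (- (vnorm d \<theta>')\<^sup>2 / 2) * cosh (vdot d \<theta>' x)))"
  proof
    fix x
    have "p x * r x = ennreal (c * cosh (vdot d \<theta> x) * (cosh (vdot d \<theta>' x) / cosh (vdot d \<theta> x)))"
      unfolding p_def r_def using c by (intro ennreal_mult[symmetric]) auto
    also have "c * cosh (vdot d \<theta> x) * (cosh (vdot d \<theta>' x) / cosh (vdot d \<theta> x)) = c * cosh (vdot d \<theta>' x)"
      by simp
    finally show "p x * r x = ennreal (exp (- (vnorm d \<theta>')\<^sup>2 / 2) * cosh (vdot d \<theta>' x))"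
      by (simp add: c_def assms)
  qed
  also have "density (gauss d (\<lambda>_. 0)) \<dots> = gmix d \<theta>'" by (rule gmix_eq_density_gauss0[symmetric])
  finally show ?thesis unfolding r_def by (rule sym)
qed

text \<open>
  Integrate \<open>1 + f\<^sup>2 = 2 f + (f - 1)\<^sup>2\<close>; written with sums only, the identity can be integrated in the
  extended nonnegative reals.
\<close>

lemma second_moment_le_of_chi_square:
  assumes P: "prob_space P" and f [measurable]: "f \<in> borel_measurable P" and f0: "\<And>x. 0 \<le> f x"
    and one: "(\<integral>\<^sup>+x. ennreal (f x) \<partial>P) = 1"
    and X: "(\<integral>\<^sup>+x. ennreal ((f x - 1)\<^sup>2) \<partial>P) \<le> ennreal c" and c: "0 \<le> c"
  shows "(\<integral>\<^sup>+x. ennreal ((f x)\<^sup>2) \<partial>P) \<le> ennreal (1 + c)"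
proof -
  interpret prob_space P by (rule P)
  have "1 + (\<integral>\<^sup>+x. ennreal ((f x)\<^sup>2) \<partial>P) = (\<integral>\<^sup>+x. 1 + ennreal ((f x)\<^sup>2) \<partial>P)"
    by (subst nn_integral_add) (simp_all add: emeasure_space_1)
  also have "\<dots> = (\<integral>\<^sup>+x. (ennreal (f x) + ennreal (f x)) + ennreal ((f x - 1)\<^sup>2) \<partial>P)"
  proof (rule nn_integral_cong)
    fix x
    have "1 + (f x)\<^sup>2 = (f x + f x) + (f x - 1)\<^sup>2" by (simp add: power2_eq_square algebra_simps)
    moreover have "1 + ennreal ((f x)\<^sup>2) = ennreal (1 + (f x)\<^sup>2)" by (subst ennreal_plus) auto
    moreover have "ennreal (f x + f x + (f x - 1)\<^sup>2) = ennreal (f x + f x) + ennreal ((f x - 1)\<^sup>2)"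
      using f0[of x] by (intro ennreal_plus) auto
    moreover have "ennreal (f x + f x) = ennreal (f x) + ennreal (f x)"
      using f0[of x] by (intro ennreal_plus) auto
    ultimately show "1 + ennreal ((f x)\<^sup>2) = (ennreal (f x) + ennreal (f x)) + ennreal ((f x - 1)\<^sup>2)" by metis
  qed
  also have "\<dots> = (1 + 1) + (\<integral>\<^sup>+x. ennreal ((f x - 1)\<^sup>2) \<partial>P)"
    by (simp add: nn_integral_add one)
  also have "\<dots> \<le> (1 + 1) + ennreal c" using X by (intro add_mono) auto
  also have "\<dots> = 1 + ennreal (1 + c)" using c by (simp add: ennreal_plus add.assoc)
  finally show ?thesis by (simp add: ennreal_add_left_cancel_le)
qed

text \<open>
  The divergence is an integral against the density \<open>exp (- \<parallel>\<theta>\<parallel>\<^sup>2 / 2) cosh (\<theta> \<bullet> x)\<close>. After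
  \<open>cosh_increment_square_le\<close> it becomes an integral against the mixture with mean \<open>m\<close> of a function of
  \<open>m \<bullet> x\<close> times a function of \<open>x\<^sub>i\<close>. As \<open>m\<^sub>i = 0\<close>, these are independent under either component, and the
  two factors contribute \<open>min {1, \<parallel>m\<parallel>\<^sup>2}\<close> and \<open>h\<^sup>2\<close>.
\<close>

lemma likelihood_ratio_second_moment_le:
  assumes i: "i < d" and m: "m i = 0" and h: "0 \<le> h" "h \<le> 1"
    and \<theta>: "\<theta> = (\<lambda>j. m j - (if j = i then h else 0))"
    and \<theta>': "\<theta>' = (\<lambda>j. m j + (if j = i then h else 0))"
  shows "(\<integral>\<^sup>+x. ennreal ((cosh (vdot d \<theta>' x) / cosh (vdot d \<theta> x))\<^sup>2) \<partial>gmix d \<theta>)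
    \<le> ennreal (1 + 64 * exp 16 * h\<^sup>2 * min 1 ((vnorm d m)\<^sup>2))"
proof (rule second_moment_le_of_chi_square[OF prob_space_gmix])
  define f where "f x = cosh (vdot d \<theta>' x) / cosh (vdot d \<theta> x)" for x
  have fm [measurable]: "f \<in> borel_measurable (euclid d)" unfolding f_def by measurable
  show "(\<lambda>x. cosh (vdot d \<theta>' x) / cosh (vdot d \<theta> x)) \<in> borel_measurable (gmix d \<theta>)"
    using fm unfolding f_def borel_measurable_gmix_iff .
  have norms: "(vnorm d \<theta>)\<^sup>2 = (vnorm d m)\<^sup>2 + h\<^sup>2" "(vnorm d \<theta>')\<^sup>2 = (vnorm d m)\<^sup>2 + h\<^sup>2"
    unfolding \<theta> \<theta>' using flipped_mean_norms[OF i, of m h] m by auto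
  have dots: "vdot d \<theta> x = vdot d m x - h * x i" "vdot d \<theta>' x = vdot d m x + h * x i" for x
    unfolding \<theta> \<theta>' vdot_add_left vdot_diff_left vdot_single[OF i] by simp_all
  have "(\<integral>\<^sup>+x. ennreal (f x) \<partial>gmix d \<theta>) = emeasure (gmix d \<theta>') (space (gmix d \<theta>'))"
  proof -
    have "gmix d \<theta>' = density (gmix d \<theta>) (\<lambda>x. ennreal (f x))"
      unfolding f_def by (rule flipped_gmix_density) (simp add: norms)
    moreover have "emeasure (density (gmix d \<theta>) (\<lambda>x. ennreal (f x))) (space (gmix d \<theta>))
        = (\<integral>\<^sup>+x. ennreal (f x) * indicator (space (gmix d \<theta>)) x \<partial>gmix d \<theta>)"
    proof (rule emeasure_density)
      show "(\<lambda>x. ennreal (f x)) \<in> borel_measurable (gmix d \<theta>)"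
        unfolding borel_measurable_gmix_iff by measurable
    qed (rule sets.top)
    moreover have "\<dots> = (\<integral>\<^sup>+x. ennreal (f x) \<partial>gmix d \<theta>)"
      by (intro nn_integral_cong) simp
    moreover have "space (gmix d \<theta>') = space (gmix d \<theta>)" by simp
    ultimately show ?thesis by metis
  qed
  then show "(\<integral>\<^sup>+x. ennreal (cosh (vdot d \<theta>' x) / cosh (vdot d \<theta> x)) \<partial>gmix d \<theta>) = 1"
    using prob_space.emeasure_space_1[OF prob_space_gmix, of d \<theta>'] by (simp add: f_def)
  define c where "c t = exp (- (vnorm d t)\<^sup>2 / 2)" for t
  define F where "F x = ennreal (4 * h\<^sup>2) * ennreal (min 1 ((vdot d m x)\<^sup>2))" for x
  define G where "G y = ennreal (y\<^sup>2 * exp (3 * \<bar>y\<bar>))" for y :: real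
  have [measurable]: "F \<in> borel_measurable (euclid d)" unfolding F_def by measurable
  have Gm [measurable]: "G \<in> borel_measurable borel" unfolding G_def by simp
  have Gi: "(\<lambda>x. G (x i)) \<in> borel_measurable (euclid d)"
    by (rule measurable_compose[OF measurable_component_euclid[OF i] Gm])
  have Fm: "F \<in> borel_measurable (euclid d)" by measurable
  have FG: "(\<lambda>x. F x * G (x i)) \<in> borel_measurable (euclid d)"
    using Fm Gi by (rule borel_measurable_times_ennreal)
  have dens: "(\<integral>\<^sup>+x. H x \<partial>gmix d t) = (\<integral>\<^sup>+x. ennreal (c t * cosh (vdot d t x)) * H x \<partial>gauss d (\<lambda>_. 0))"
    if "H \<in> borel_measurable (euclid d)" for H t
    unfolding gmix_eq_density_gauss0 c_def using that
    by (intro nn_integral_density) (simp_all add: borel_measurable_gauss_iff)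
  have "(\<integral>\<^sup>+x. ennreal ((f x - 1)\<^sup>2) \<partial>gmix d \<theta>)
    = (\<integral>\<^sup>+x. ennreal (c \<theta> * cosh (vdot d \<theta> x)) * ennreal ((f x - 1)\<^sup>2) \<partial>gauss d (\<lambda>_. 0))"
    by (rule dens) measurable
  also have "\<dots> \<le> (\<integral>\<^sup>+x. ennreal (c m * cosh (vdot d m x)) * (F x * G (x i)) \<partial>gauss d (\<lambda>_. 0))"
  proof (rule nn_integral_mono)
    fix x
    define a b where "a = vdot d m x" and "b = h * x i"
    have cm: "c \<theta> \<le> c m" by (simp add: c_def norms)
    have c0: "0 \<le> c t" for t by (simp add: c_def)
    have "\<bar>b\<bar> \<le> \<bar>x i\<bar>" using h by (simp add: b_def abs_mult mult_left_le_one_le)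
    then have "b\<^sup>2 * exp (3 * \<bar>b\<bar>) \<le> b\<^sup>2 * exp (3 * \<bar>x i\<bar>)"
      by (intro mult_left_mono) auto
    also have "\<dots> = h\<^sup>2 * ((x i)\<^sup>2 * exp (3 * \<bar>x i\<bar>))"
      by (simp add: b_def power_mult_distrib)
    finally have bG: "b\<^sup>2 * exp (3 * \<bar>b\<bar>) \<le> h\<^sup>2 * ((x i)\<^sup>2 * exp (3 * \<bar>x i\<bar>))" .
    have "c \<theta> * cosh (a - b) * (cosh (a + b) / cosh (a - b) - 1)\<^sup>2
      = c \<theta> * ((cosh (a + b) - cosh (a - b))\<^sup>2 / cosh (a - b))"
      by (simp add: field_simps power2_eq_square)
    also have "\<dots> \<le> c m * (4 * min 1 (a\<^sup>2) * (b\<^sup>2 * exp (3 * \<bar>b\<bar>)) * cosh a)"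
      by (intro mult_mono cm cosh_increment_square_le c0) auto
    also have "\<dots> \<le> c m * (4 * min 1 (a\<^sup>2) * (h\<^sup>2 * ((x i)\<^sup>2 * exp (3 * \<bar>x i\<bar>))) * cosh a)"
      by (intro mult_left_mono mult_right_mono bG c0) auto
    also have "\<dots> = c m * cosh a * (4 * h\<^sup>2 * min 1 (a\<^sup>2) * ((x i)\<^sup>2 * exp (3 * \<bar>x i\<bar>)))"
      by (simp only: mult_ac)
    finally have "ennreal (c \<theta> * cosh (a - b) * (cosh (a + b) / cosh (a - b) - 1)\<^sup>2) \<le> ennreal \<dots>"
      by (rule ennreal_leI)
    also have "\<dots> = ennreal (c m * cosh a) * (ennreal (4 * h\<^sup>2) * ennreal (min 1 (a\<^sup>2)) * ennreal ((x i)\<^sup>2 * exp (3 * \<bar>x i\<bar>)))"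
      by (simp add: ennreal_mult c0)
    also have "ennreal (c \<theta> * cosh (a - b) * (cosh (a + b) / cosh (a - b) - 1)\<^sup>2)
      = ennreal (c \<theta> * cosh (a - b)) * ennreal ((cosh (a + b) / cosh (a - b) - 1)\<^sup>2)"
      using c0[of \<theta>] by (intro ennreal_mult) auto
    finally show "ennreal (c \<theta> * cosh (vdot d \<theta> x)) * ennreal ((f x - 1)\<^sup>2) \<le> ennreal (c m * cosh (vdot d m x)) * (F x * G (x i))"
      by (simp only: f_def F_def G_def dots a_def b_def)
  qed
  also have "\<dots> = (\<integral>\<^sup>+x. F x * G (x i) \<partial>gmix d m)"
    by (rule dens[OF FG, symmetric])
  also have "\<dots> \<le> ennreal (64 * exp 16 * h\<^sup>2 * min 1 ((vnorm d m)\<^sup>2))"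
  proof -
    let ?b = "ennreal (64 * exp 16 * h\<^sup>2 * min 1 ((vnorm d m)\<^sup>2))"
    have part: "(\<integral>\<^sup>+x. F x * G (x i) \<partial>gauss d \<mu>) \<le> ?b"
      if \<mu>: "\<mu> i = 0" "\<bar>vdot d m \<mu>\<bar> = (vnorm d m)\<^sup>2" for \<mu>
    proof -
      have indep: "F (x(i := y)) = F x" for x y
      proof -
        have "vdot d m (x(i := y)) = vdot d m x"
          unfolding vdot_def using m by (intro sum.cong) auto
        then show ?thesis by (simp add: F_def)
      qed
      have "(\<integral>\<^sup>+x. F x * G (x i) \<partial>gauss d \<mu>)
        = (\<integral>\<^sup>+x. F x \<partial>gauss d \<mu>) * (\<integral>\<^sup>+y. ennreal (normal_density (\<mu> i) 1 y) * G y \<partial>lborel)"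
        by (rule nn_integral_gauss_coordinate_factor[OF i Fm indep Gm])
      also have "(\<integral>\<^sup>+x. F x \<partial>gauss d \<mu>)
          = ennreal (4 * h\<^sup>2) * (\<integral>\<^sup>+x. ennreal (min 1 ((vdot d m x)\<^sup>2)) \<partial>gauss d \<mu>)"
        unfolding F_def by (rule nn_integral_cmult) (simp add: borel_measurable_gauss_iff)
      also have "ennreal (4 * h\<^sup>2) * (\<integral>\<^sup>+x. ennreal (min 1 ((vdot d m x)\<^sup>2)) \<partial>gauss d \<mu>)
          * (\<integral>\<^sup>+y. ennreal (normal_density (\<mu> i) 1 y) * G y \<partial>lborel)
        \<le> ennreal (4 * h\<^sup>2) * ennreal (4 * min 1 ((vnorm d m)\<^sup>2)) * ennreal (4 * exp 16)"
        unfolding \<mu>(1) G_def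
        by (intro mult_mono nn_integral_gauss_truncated_square_le[OF \<mu>(2)] nn_integral_normal_square_exp_le) auto
      also have "\<dots> = ennreal (4 * h\<^sup>2 * (4 * min 1 ((vnorm d m)\<^sup>2)) * (4 * exp 16))"
      proof -
        have "ennreal x * ennreal y * ennreal z = ennreal (x * y * z)" if "0 \<le> x" "0 \<le> y" "0 \<le> z" for x y z
          using that by (simp add: ennreal_mult)
        then show ?thesis by this auto
      qed
      also have "4 * h\<^sup>2 * (4 * min 1 ((vnorm d m)\<^sup>2)) * (4 * exp 16) = 64 * exp 16 * h\<^sup>2 * min 1 ((vnorm d m)\<^sup>2)"
        by (simp add: mult_ac)
      finally show ?thesis .
    qed
    have "(\<integral>\<^sup>+x. F x * G (x i) \<partial>gmix d m)
      = 1 / 2 * (\<integral>\<^sup>+x. F x * G (x i) \<partial>gauss d (\<lambda>j. - m j)) + 1 / 2 * (\<integral>\<^sup>+x. F x * G (x i) \<partial>gauss d m)"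
      by (rule nn_integral_gmix[OF FG])
    also have "\<dots> \<le> 1 / 2 * ?b + 1 / 2 * ?b"
      using m by (intro add_mono mult_left_mono part) (simp_all add: vdot_minus_right vdot_self)
    also have "\<dots> = ?b" by (rule ennreal_half_plus_half)
    finally show ?thesis .
  qed
  finally show "(\<integral>\<^sup>+x. ennreal ((cosh (vdot d \<theta>' x) / cosh (vdot d \<theta> x) - 1)\<^sup>2) \<partial>gmix d \<theta>)
    \<le> ennreal (64 * exp 16 * h\<^sup>2 * min 1 ((vnorm d m)\<^sup>2))" by (simp add: f_def)
qed auto

lemma flipped_sample_error_sum:
  assumes i: "i < d" and m: "m i = 0" and h: "0 \<le> h" "h \<le> 1"
    and \<theta>: "\<theta> = (\<lambda>j. m j - (if j = i then h else 0))"
    and \<theta>': "\<theta>' = (\<lambda>j. m j + (if j = i then h else 0))"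
    and s: "vnorm d m \<le> s" and budget: "real n * (64 * exp 16 * h\<^sup>2 * min 1 (s\<^sup>2)) \<le> 1 / 2"
    and A: "A \<in> sets (\<Pi>\<^sub>M j\<in>{..<n}. euclid d)"
  shows "measure (sample d n \<theta>) A + measure (sample d n \<theta>') (space (\<Pi>\<^sub>M j\<in>{..<n}. euclid d) - A) \<ge> 1 / 2"
proof (rule error_sum_samples[OF flipped_gmix_density _ _ _ A])
  show "(vnorm d \<theta>')\<^sup>2 = (vnorm d \<theta>)\<^sup>2"
    unfolding \<theta> \<theta>' using flipped_mean_norms[OF i, of m h] m by simp
  define c where "c = 64 * exp 16 * h\<^sup>2 * min 1 ((vnorm d m)\<^sup>2)"
  have c0: "0 \<le> c" by (simp add: c_def)
  have "c \<le> 64 * exp 16 * h\<^sup>2 * min 1 (s\<^sup>2)"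
    unfolding c_def using s by (intro mult_left_mono min.mono power_mono) auto
  then have "real n * c \<le> real n * (64 * exp 16 * h\<^sup>2 * min 1 (s\<^sup>2))" by (rule mult_left_mono) simp
  then have nc: "real n * c \<le> 1 / 2" using budget by simp
  have "(\<integral>\<^sup>+x. ennreal ((cosh (vdot d \<theta>' x) / cosh (vdot d \<theta> x))\<^sup>2) \<partial>gmix d \<theta>) ^ n \<le> ennreal (1 + c) ^ n"
    unfolding c_def by (intro power_mono_ennreal likelihood_ratio_second_moment_le[OF i m h \<theta> \<theta>'])
  also have "\<dots> = ennreal ((1 + c) ^ n)" using c0 by (intro ennreal_power) simp
  also have "\<dots> \<le> ennreal 2"
  proof (rule ennreal_leI)
    have "(1 + c) ^ n \<le> exp c ^ n" using c0 by (intro power_mono) auto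
    also have "\<dots> = exp (real n * c)" by (simp add: exp_of_nat_mult)
    also have "\<dots> \<le> exp (1 / 2)" using nc by simp
    also have "\<dots> \<le> 1 + 1 / 2 + (1 / 2)\<^sup>2" by (rule exp_bound) auto
    also have "\<dots> \<le> (2::real)" by (simp add: power2_eq_square)
    finally show "(1 + c) ^ n \<le> 2" .
  qed
  finally show "(\<integral>\<^sup>+x. ennreal ((cosh (vdot d \<theta>' x) / cosh (vdot d \<theta> x))\<^sup>2) \<partial>gmix d \<theta>) ^ n \<le> 2" by simp
qed auto

section \<open>Assouad's lemma for the cube of sign patterns\<close>

lemma sum_Pow_split:
  assumes "finite J" "i \<in> J"
  shows "(\<Sum>S\<in>Pow J. f S) = (\<Sum>S\<in>Pow (J - {i}). f S + f (insert i S))"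
proof -
  have "Pow J = Pow (J - {i}) \<union> insert i ` Pow (J - {i})"
    using assms(2) Pow_insert[of i "J - {i}"] by (simp add: insert_absorb)
  moreover have "Pow (J - {i}) \<inter> insert i ` Pow (J - {i}) = {}" by auto
  moreover have "inj_on (insert i) (Pow (J - {i}))" by (rule inj_onI) blast
  ultimately show ?thesis
    using assms(1) by (simp add: sum.union_disjoint sum.reindex sum.distrib)
qed

text \<open>
  Summed over all \<open>S\<close>, each coordinate contributes at least \<open>1/2\<close> for every pair of sets that differ by
  this coordinate; so the average over \<open>S\<close> of the total error is at least \<open>card J / 4\<close>, and some \<open>S\<close> is no
  better than the average.
\<close>

lemma assouad:
  fixes f :: "nat set \<Rightarrow> nat \<Rightarrow> real"
  assumes J: "finite J" and pair: "\<And>S i. i \<in> J \<Longrightarrow> S \<subseteq> J - {i} \<Longrightarrow> f S i + f (insert i S) i \<ge> 1 / 2"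
  shows "\<exists>S\<subseteq>J. (\<Sum>i\<in>J. f S i) \<ge> real (card J) / 4"
proof (rule ccontr)
  assume "\<not> ?thesis"
  then have less: "(\<Sum>i\<in>J. f S i) < real (card J) / 4" if "S \<in> Pow J" for S
    using that by (auto simp: not_le)
  have upper: "(\<Sum>S\<in>Pow J. \<Sum>i\<in>J. f S i) < (\<Sum>S\<in>Pow J. real (card J) / 4)"
    using J by (intro sum_strict_mono less) auto
  have const: "(\<Sum>S\<in>Pow J. real (card J) / 4) = (\<Sum>i\<in>J. 2 ^ card J / 4)"
    unfolding sum_constant card_Pow[OF J] by simp
  have lower: "(\<Sum>i\<in>J. 2 ^ card J / 4) \<le> (\<Sum>i\<in>J. \<Sum>S\<in>Pow J. f S i)"
  proof (rule sum_mono)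
    fix i assume i: "i \<in> J"
    have "card J = Suc (card (J - {i}))" using J i by (rule card.remove)
    then have "(2 ^ card J / 4 :: real) = 2 ^ card (J - {i}) * (1 / 2)" by simp
    moreover have "(\<Sum>S\<in>Pow (J - {i}). 1 / 2 :: real) = 2 ^ card (J - {i}) * (1 / 2)"
      unfolding sum_constant card_Pow[OF finite_Diff[OF J]] by simp
    moreover have "(\<Sum>S\<in>Pow (J - {i}). 1 / 2) \<le> (\<Sum>S\<in>Pow (J - {i}). f S i + f (insert i S) i)"
      using i by (intro sum_mono pair) auto
    moreover have "\<dots> = (\<Sum>S\<in>Pow J. f S i)" using J i by (rule sum_Pow_split[symmetric])
    ultimately show "2 ^ card J / 4 \<le> (\<Sum>S\<in>Pow J. f S i)" by linarith
  qed
  have "(\<Sum>i\<in>J. \<Sum>S\<in>Pow J. f S i) = (\<Sum>S\<in>Pow J. \<Sum>i\<in>J. f S i)" by (rule sum.swap)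
  with upper const lower show False by linarith
qed

definition cube_mean :: "nat \<Rightarrow> real \<Rightarrow> real \<Rightarrow> nat set \<Rightarrow> nat \<Rightarrow> real" where
  "cube_mean d \<alpha> h S = (\<lambda>i\<in>{..<d}. if i = 0 then \<alpha> else if i \<in> S then h else - h)"

text \<open>The sign of the first coordinate serves to remove the ambiguity between \<open>t\<close> and \<open>-t\<close>.\<close>

definition oriented :: "(nat \<Rightarrow> real) \<Rightarrow> nat \<Rightarrow> real" where
  "oriented t i = (if 0 \<le> t 0 then t i else - t i)"

lemma vnorm_cube_mean:
  assumes "d \<ge> 1"
  shows "(vnorm d (cube_mean d \<alpha> h S))\<^sup>2 = \<alpha>\<^sup>2 + real (d - 1) * h\<^sup>2"
proof -
  have "{..<d} = insert 0 {1..<d}" using assms by auto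
  then have "(\<Sum>i<d. (cube_mean d \<alpha> h S i)\<^sup>2)
      = (cube_mean d \<alpha> h S 0)\<^sup>2 + (\<Sum>i\<in>{1..<d}. (cube_mean d \<alpha> h S i)\<^sup>2)" by simp
  also have "(\<Sum>i\<in>{1..<d}. (cube_mean d \<alpha> h S i)\<^sup>2) = (\<Sum>i\<in>{1..<d}. h\<^sup>2)"
    by (intro sum.cong) (auto simp: cube_mean_def)
  finally show ?thesis using assms by (simp add: vnorm_power2 cube_mean_def)
qed

lemma loss_oriented: "loss d (oriented t) \<theta> = loss d t \<theta>"
proof (cases "0 \<le> t 0")
  case False
  have "vnorm d (\<lambda>i. oriented t i - \<theta> i) = vnorm d (\<lambda>i. t i + \<theta> i)"
    using vnorm_minus[of d "\<lambda>i. t i + \<theta> i"] False by (simp add: oriented_def)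
  moreover have "vnorm d (\<lambda>i. oriented t i + \<theta> i) = vnorm d (\<lambda>i. t i - \<theta> i)"
    using vnorm_minus[of d "\<lambda>i. t i - \<theta> i"] False by (simp add: oriented_def)
  ultimately show ?thesis by (simp add: loss_def min.commute)
next
  case True
  then have "oriented t = t" by (simp add: oriented_def fun_eq_iff)
  then show ?thesis by simp
qed

text \<open>
  Each wrongly guessed sign costs \<open>h\<^sup>2\<close> in \<open>\<parallel>t - \<theta>\<parallel>\<^sup>2\<close> if \<open>t\<close> is oriented, while \<open>\<parallel>t + \<theta>\<parallel>\<close> is at least the first
  coordinate \<open>\<alpha>\<close> and hence never smaller than the cost of all signs together. With at most \<open>d - 1\<close>
  mistakes, the square root of their number is at least the number divided by \<open>\<surd>(d - 1)\<close>.
\<close>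

lemma loss_cube_mean_ge:
  assumes d: "d \<ge> 2" and h: "h \<ge> 0" and \<alpha>: "\<alpha> \<ge> 0" "real (d - 1) * h\<^sup>2 \<le> \<alpha>\<^sup>2"
  shows "h / sqrt (real (d - 1)) * real (card {i \<in> {1..<d}. (i \<in> S) \<noteq> (0 \<le> oriented t i)})
    \<le> loss d t (cube_mean d \<alpha> h S)"
proof -
  define H where "H = {i \<in> {1..<d}. (i \<in> S) \<noteq> (0 \<le> oriented t i)}"
  define D where "D = real (d - 1)"
  have D: "D \<ge> 1" using d by (simp add: D_def)
  define \<theta> where "\<theta> = cube_mean d \<alpha> h S"
  define u where "u = oriented t"
  have fH: "finite H" "H \<subseteq> {1..<d}" by (auto simp: H_def)
  have "card H \<le> card {1..<d}" using fH by (intro card_mono) auto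
  then have HD: "real (card H) \<le> D" by (simp add: D_def)
  have mismatch: "h\<^sup>2 \<le> (u i - \<theta> i)\<^sup>2" if "i \<in> H" for i
  proof -
    have "i < d" "i \<noteq> 0" using that by (auto simp: H_def)
    then have "h \<le> \<bar>u i - \<theta> i\<bar>"
      using that h by (cases "i \<in> S") (auto simp: H_def u_def \<theta>_def cube_mean_def)
    then show ?thesis using h by (metis power2_abs power_mono)
  qed
  have "real (card H) * h\<^sup>2 = (\<Sum>i\<in>H. h\<^sup>2)" by simp
  also have "\<dots> \<le> (\<Sum>i\<in>H. (u i - \<theta> i)\<^sup>2)" by (intro sum_mono mismatch)
  also have "\<dots> \<le> (\<Sum>i<d. (u i - \<theta> i)\<^sup>2)" using fH by (intro sum_mono2) auto
  finally have minus: "real (card H) * h\<^sup>2 \<le> (vnorm d (\<lambda>i. u i - \<theta> i))\<^sup>2" by (simp add: vnorm_power2)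
  have "real (card H) * h\<^sup>2 \<le> \<alpha>\<^sup>2"
    using HD \<alpha>(2) mult_right_mono[OF HD, of "h\<^sup>2"] by (simp add: D_def)
  also have "\<alpha>\<^sup>2 \<le> (u 0 + \<theta> 0)\<^sup>2"
    using \<alpha>(1) d by (intro power_mono) (auto simp: u_def \<theta>_def oriented_def cube_mean_def)
  also have "(u 0 + \<theta> 0)\<^sup>2 \<le> (\<Sum>i<d. (u i + \<theta> i)\<^sup>2)"
    using d by (intro member_le_sum[of 0 "{..<d}" "\<lambda>i. (u i + \<theta> i)\<^sup>2"]) auto
  finally have plus: "real (card H) * h\<^sup>2 \<le> (vnorm d (\<lambda>i. u i + \<theta> i))\<^sup>2" by (simp add: vnorm_power2)
  have "(h / sqrt D * real (card H))\<^sup>2 = h\<^sup>2 * (real (card H) * (real (card H) / D))"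
    using D by (simp add: power_mult_distrib power_divide power2_eq_square[of "real (card H)"])
  also have "\<dots> \<le> h\<^sup>2 * (real (card H) * 1)"
    using D HD by (intro mult_left_mono) auto
  finally have sq: "(h / sqrt D * real (card H))\<^sup>2 \<le> real (card H) * h\<^sup>2" by (simp add: mult.commute)
  have "h / sqrt D * real (card H) \<le> loss d u \<theta>"
    unfolding loss_def
  proof (rule min.boundedI)
    show "h / sqrt D * real (card H) \<le> vnorm d (\<lambda>i. u i - \<theta> i)"
      using order_trans[OF sq minus] by (rule power2_le_imp_le) simp
    show "h / sqrt D * real (card H) \<le> vnorm d (\<lambda>i. u i + \<theta> i)"
      using order_trans[OF sq plus] by (rule power2_le_imp_le) simp
  qed
  then show ?thesis by (simp add: u_def loss_oriented \<theta>_def H_def D_def)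
qed

text \<open>
  An estimator yields a guess of every sign, namely that of the oriented estimate. By
  \<open>loss_cube_mean_ge\<close> its risk dominates the sum of the error probabilities of these tests, which
  \<open>assouad\<close> bounds from below for some vertex of the cube.
\<close>

lemma minimax_risk_ge_of_cube:
  assumes d: "d \<ge> 2" and h: "h \<ge> 0" and \<alpha>: "\<alpha> \<ge> 0" "real (d - 1) * h\<^sup>2 \<le> \<alpha>\<^sup>2"
    and T: "\<And>S. S \<subseteq> {1..<d} \<Longrightarrow> cube_mean d \<alpha> h S \<in> T"
    and pair: "\<And>S i A. i \<in> {1..<d} \<Longrightarrow> S \<subseteq> {1..<d} - {i} \<Longrightarrow> A \<in> sets (\<Pi>\<^sub>M j\<in>{..<n}. euclid d) \<Longrightarrow>
      measure (sample d n (cube_mean d \<alpha> h S)) A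
      + measure (sample d n (cube_mean d \<alpha> h (insert i S))) (space (\<Pi>\<^sub>M j\<in>{..<n}. euclid d) - A) \<ge> 1 / 2"
  shows "ennreal (h * sqrt (real (d - 1)) / 4) \<le> minimax_risk d n T"
  unfolding minimax_risk_def
proof (rule INF_greatest)
  fix est assume est: "est \<in> estimators d n"
  let ?M = "\<Pi>\<^sub>M j\<in>{..<n}. euclid d"
  have [measurable]: "est \<in> ?M \<rightarrow>\<^sub>M euclid d" using est by (simp add: estimators_def)
  have comp [measurable]: "(\<lambda>Y. est Y i) \<in> borel_measurable ?M" if "i < d" for i
    by (rule measurable_compose[OF _ measurable_component_euclid[OF that]]) measurable
  have or [measurable]: "(\<lambda>Y. oriented (est Y) i) \<in> borel_measurable ?M" if "i < d" for i
  proof -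
    have [measurable]: "(\<lambda>Y. est Y 0) \<in> borel_measurable ?M" "(\<lambda>Y. est Y i) \<in> borel_measurable ?M"
      using comp that d by auto
    show ?thesis unfolding oriented_def by measurable
  qed
  define A where "A i = {Y \<in> space ?M. 0 \<le> oriented (est Y) i}" for i
  have A: "A i \<in> sets ?M" if "i < d" for i
  proof -
    have [measurable]: "(\<lambda>Y. oriented (est Y) i) \<in> borel_measurable ?M" using or that .
    show ?thesis unfolding A_def by measurable
  qed
  define \<theta> where "\<theta> S = cube_mean d \<alpha> h S" for S
  define E where "E S i = (if i \<in> S then space ?M - A i else A i)" for S i
  have E: "E S i \<in> sets ?M" if "i < d" for S i using A[OF that] by (simp add: E_def)
  have "\<exists>S\<subseteq>{1..<d}. (\<Sum>i\<in>{1..<d}. measure (sample d n (\<theta> S)) (E S i)) \<ge> real (card {1..<d}) / 4"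
  proof (rule assouad)
    fix S i assume i: "i \<in> {1..<d}" and S: "S \<subseteq> {1..<d} - {i}"
    then have "i \<notin> S" by auto
    then show "measure (sample d n (\<theta> S)) (E S i) + measure (sample d n (\<theta> (insert i S))) (E (insert i S) i) \<ge> 1 / 2"
      using pair[OF i S A] i by (simp add: \<theta>_def E_def)
  qed simp
  then obtain S where S: "S \<subseteq> {1..<d}" "(\<Sum>i\<in>{1..<d}. measure (sample d n (\<theta> S)) (E S i)) \<ge> real (d - 1) / 4"
    by auto
  interpret prob_space "sample d n (\<theta> S)" by (rule prob_space_sample)
  define \<kappa> where "\<kappa> = h / sqrt (real (d - 1))"
  have \<kappa>: "\<kappa> \<ge> 0" using h by (simp add: \<kappa>_def)
  have ES: "E S i \<in> events" if "i \<in> {1..<d}" for i using E that by (simp add: sets_sample)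
  have "h * sqrt (real (d - 1)) / 4 = \<kappa> * (real (d - 1) / 4)"
  proof -
    have "h * sqrt x / 4 = h / sqrt x * (x / 4)" if "0 \<le> x" for x
    proof -
      have "h / sqrt x * (x / 4) = h * (x / sqrt x) / 4" by simp
      then show ?thesis using that by (simp only: real_div_sqrt)
    qed
    from this[of "real (d - 1)"] show ?thesis unfolding \<kappa>_def by simp
  qed
  also have "\<dots> \<le> \<kappa> * (\<Sum>i\<in>{1..<d}. prob (E S i))" using S(2) \<kappa> by (rule mult_left_mono)
  finally have "ennreal (h * sqrt (real (d - 1)) / 4) \<le> ennreal (\<kappa> * (\<Sum>i\<in>{1..<d}. prob (E S i)))"
    by (rule ennreal_leI)
  also have "\<dots> = ennreal \<kappa> * ennreal (\<Sum>i\<in>{1..<d}. prob (E S i))"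
    using \<kappa> by (intro ennreal_mult sum_nonneg) auto
  also have "ennreal (\<Sum>i\<in>{1..<d}. prob (E S i)) = (\<Sum>i\<in>{1..<d}. emeasure (sample d n (\<theta> S)) (E S i))"
    by (simp add: emeasure_eq_measure sum_ennreal)
  also have "\<dots> = (\<integral>\<^sup>+Y. (\<Sum>i\<in>{1..<d}. indicator (E S i) Y) \<partial>sample d n (\<theta> S))"
    using ES by (subst nn_integral_sum) auto
  also have "ennreal \<kappa> * \<dots> = (\<integral>\<^sup>+Y. ennreal \<kappa> * (\<Sum>i\<in>{1..<d}. indicator (E S i) Y) \<partial>sample d n (\<theta> S))"
    using ES by (intro nn_integral_cmult[symmetric] borel_measurable_sum borel_measurable_indicator) auto
  also have "\<dots> \<le> (\<integral>\<^sup>+Y. ennreal (loss d (est Y) (\<theta> S)) \<partial>sample d n (\<theta> S))"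
  proof (rule nn_integral_mono)
    fix Y assume "Y \<in> space (sample d n (\<theta> S))"
    then have Y: "Y \<in> space ?M" by (simp add: space_sample)
    have "(\<Sum>i\<in>{1..<d}. indicator (E S i) Y :: ennreal)
      = (\<Sum>i\<in>{1..<d}. if (i \<in> S) \<noteq> (0 \<le> oriented (est Y) i) then 1 else 0)"
      using Y by (intro sum.cong) (auto simp: E_def A_def indicator_def)
    also have "\<dots> = of_nat (card {i \<in> {1..<d}. (i \<in> S) \<noteq> (0 \<le> oriented (est Y) i)})"
      by (simp add: sum.If_cases Int_def)
    finally have "ennreal \<kappa> * (\<Sum>i\<in>{1..<d}. indicator (E S i) Y)
      = ennreal (\<kappa> * real (card {i \<in> {1..<d}. (i \<in> S) \<noteq> (0 \<le> oriented (est Y) i)}))"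
      using \<kappa> by (simp add: ennreal_of_nat_eq_real_of_nat ennreal_mult)
    also have "\<dots> \<le> ennreal (loss d (est Y) (\<theta> S))"
      unfolding \<kappa>_def \<theta>_def by (intro ennreal_leI loss_cube_mean_ge d h \<alpha>)
    finally show "ennreal \<kappa> * (\<Sum>i\<in>{1..<d}. indicator (E S i) Y) \<le> ennreal (loss d (est Y) (\<theta> S))" .
  qed
  also have "\<dots> \<le> (SUP \<theta>\<in>T. \<integral>\<^sup>+Y. ennreal (loss d (est Y) \<theta>) \<partial>sample d n \<theta>)"
    using T[OF S(1)] by (intro SUP_upper) (simp add: \<theta>_def)
  finally show "ennreal (h * sqrt (real (d - 1)) / 4) \<le> (SUP \<theta>\<in>T. \<integral>\<^sup>+Y. ennreal (loss d (est Y) \<theta>) \<partial>sample d n \<theta>)" .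
qed

section \<open>Lower bounds\<close>

text \<open>
  Up to a constant the sphere rate is at most \<open>min {s, \<surd>\<rho> max {1, 1 / s}}\<close>, the form in which the lower bound
  arises: the term \<open>\<rho> / s\<close> never matters, being below \<open>\<surd>\<rho>\<close> for \<open>s \<ge> \<surd>\<rho>\<close>.
\<close>

lemma sphere_rate_square_le:
  fixes \<rho> s :: real
  assumes \<rho>: "\<rho> > 0" and s: "s > 0"
  shows "(min ((\<rho> + sqrt \<rho>) / s + sqrt \<rho>) s)\<^sup>2 \<le> 9 * min (s\<^sup>2) (\<rho> / min 1 (s\<^sup>2))"
proof -
  define q where "q = sqrt \<rho>"
  have q: "q > 0" "q\<^sup>2 = \<rho>" using \<rho> by (simp_all add: q_def)
  define R where "R = min ((\<rho> + q) / s + q) s"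
  have R0: "0 \<le> R" using \<rho> q s by (simp add: R_def)
  have Rs: "R \<le> s" by (simp add: R_def)
  have R1: "R \<le> (\<rho> + q) / s + q" by (simp add: R_def)
  have "R\<^sup>2 \<le> s\<^sup>2" using Rs R0 by (intro power_mono) auto
  moreover have "R\<^sup>2 \<le> 9 * (\<rho> / min 1 (s\<^sup>2))"
  proof (cases "s \<le> 1")
    case True
    have "R \<le> 3 * (q / s)"
    proof (cases "q \<le> 1")
      case q1: True
      have "\<rho> \<le> q" using q q1 mult_left_le[of q q] by (simp add: power2_eq_square)
      then have "(\<rho> + q) / s \<le> (q + q) / s" using s by (intro divide_right_mono) auto
      moreover have "q \<le> q / s" using True s q(1) by (simp add: field_simps)
      ultimately show ?thesis using R1 by (simp add: add_divide_distrib)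
    next
      case False
      then have "1 * 1 \<le> q * (1 / s)" using True s by (intro mult_mono) auto
      then show ?thesis using Rs True by simp
    qed
    then have "R\<^sup>2 \<le> (3 * (q / s))\<^sup>2" using R0 by (intro power_mono) auto
    also have "\<dots> = 9 * (\<rho> / s\<^sup>2)" by (simp add: power_mult_distrib power_divide q)
    also have "s\<^sup>2 = min 1 (s\<^sup>2)" using True s power_le_one[of s 2] by simp
    finally show ?thesis .
  next
    case False
    have "R \<le> 3 * q"
    proof (cases "q \<le> s")
      case qs: True
      have "\<rho> / s \<le> q" using qs q s by (simp add: field_simps flip: q(2)) (simp add: power2_eq_square)
      moreover have "q / s \<le> q" using False q s by (simp add: field_simps)
      ultimately show ?thesis using R1 by (simp add: add_divide_distrib)
    next
      case False
      then show ?thesis using Rs q by simp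
    qed
    then have "R\<^sup>2 \<le> (3 * q)\<^sup>2" using R0 by (intro power_mono) auto
    also have "\<dots> = 9 * \<rho>" by (simp add: power_mult_distrib q)
    also have "\<rho> = \<rho> / min 1 (s\<^sup>2)" using False by (simp add: one_le_power)
    finally show ?thesis .
  qed
  moreover have "9 * min x y = min (9 * x) (9 * y)" for x y :: real by (simp add: min_def)
  moreover have "R\<^sup>2 \<le> 9 * s\<^sup>2" using \<open>R\<^sup>2 \<le> s\<^sup>2\<close> zero_le_power2[of s] by linarith
  ultimately have "R\<^sup>2 \<le> 9 * min (s\<^sup>2) (\<rho> / min 1 (s\<^sup>2))" by simp
  then show ?thesis by (simp only: R_def q_def)
qed

text \<open>
  The perturbation \<open>h = \<surd>b\<close> is limited by two constraints: the \<open>d - 1\<close> small coordinates may use at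
  most half of \<open>s\<^sup>2\<close>, and the divergence of \<open>n\<close> samples at adjacent vertices must stay bounded.
\<close>

lemma minimax_risk_sphere_ge:
  assumes d: "d \<ge> 2" and n: "n \<ge> 1" and s: "s \<ge> 0"
  shows "ennreal (1 / (24 * sqrt (64 * exp 16))) * sphere_rate d n s \<le> minimax_risk d n (vsphere d s)"
proof (cases "s = 0")
  case True
  then show ?thesis by (simp add: sphere_rate_def)
next
  case False
  then have s0: "s > 0" using s by simp
  define \<rho> where "\<rho> = real d / real n"
  have \<rho>: "\<rho> > 0" using d n by (simp add: \<rho>_def)
  define C where "C = (64 * exp 16 :: real)"
  have C: "C \<ge> 1"
    using exp_ge_add_one_self[of "16::real"] by (simp add: C_def)
  define M where "M = min 1 (s\<^sup>2)"
  have M: "M > 0" "M \<le> 1" "M \<le> s\<^sup>2" using s0 by (auto simp: M_def)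
  define D where "D = real (d - 1)"
  have D: "D \<ge> 1" "D \<ge> real d / 2" using d by (auto simp: D_def)
  have n0: "real n \<ge> 1" using n by simp
  define b where "b = min (s\<^sup>2 / (2 * D)) (1 / (2 * C * real n * M))"
  have b0: "b > 0" using s0 D C M n0 by (auto simp: b_def intro!: mult_pos_pos)
  define h where "h = sqrt b"
  have h: "h > 0" "h\<^sup>2 = b" using b0 by (simp_all add: h_def)
  have Db: "D * b \<le> s\<^sup>2 / 2"
  proof -
    have "D * b \<le> D * (s\<^sup>2 / (2 * D))" using D by (intro mult_left_mono) (auto simp: b_def)
    then show ?thesis using D by simp
  qed
  have nb: "real n * (C * b * M) \<le> 1 / 2"
  proof -
    have "real n * C * M * b \<le> real n * C * M * (1 / (2 * C * real n * M))"
      using C M n0 by (intro mult_left_mono) (auto simp: b_def)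
    also have "\<dots> = 1 / 2" using C M n0 by simp
    finally show ?thesis by (simp add: mult_ac)
  qed
  have "b \<le> 1"
  proof (cases "s \<le> 1")
    case True
    have "b \<le> s\<^sup>2 / (2 * D)" by (simp add: b_def)
    also have "\<dots> \<le> 1 / (2 * 1)" using True s0 D by (intro frac_le) (auto simp: power_le_one)
    finally show ?thesis by simp
  next
    case False
    then have "M = 1" by (simp add: M_def one_le_power)
    then have "C * real n * b \<le> 1 / 2" using nb by (simp add: mult_ac)
    moreover have "1 * b \<le> (C * real n) * b"
      using mult_mono[of 1 C 1 "real n"] C n0 b0 by (intro mult_right_mono) auto
    ultimately show ?thesis by simp
  qed
  then have h1: "h \<le> 1" by (simp add: h_def)
  define \<alpha> where "\<alpha> = sqrt (s\<^sup>2 - D * b)"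
  have Db': "D * b \<le> s\<^sup>2 - D * b" "0 \<le> D * b" using Db D b0 by simp_all
  then have pos: "0 \<le> s\<^sup>2 - D * b" by linarith
  have \<alpha>: "\<alpha> \<ge> 0" "\<alpha>\<^sup>2 = s\<^sup>2 - D * b" using pos by (simp_all add: \<alpha>_def)
  have \<alpha>': "D * h\<^sup>2 \<le> \<alpha>\<^sup>2" using Db' unfolding \<alpha>(2) h(2) by simp
  have norm: "vnorm d (cube_mean d \<alpha> h S) = s" for S
  proof -
    have "(vnorm d (cube_mean d \<alpha> h S))\<^sup>2 = \<alpha>\<^sup>2 + D * h\<^sup>2"
      unfolding D_def using d by (intro vnorm_cube_mean) simp
    then have "(vnorm d (cube_mean d \<alpha> h S))\<^sup>2 = s\<^sup>2" unfolding \<alpha>(2) h(2) by simp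
    then show ?thesis using s by (simp add: power2_eq_iff_nonneg)
  qed
  have "ennreal (h * sqrt D / 4) \<le> minimax_risk d n (vsphere d s)"
    unfolding D_def
  proof (rule minimax_risk_ge_of_cube[OF d _ \<alpha>(1) \<alpha>'[unfolded D_def]])
    show "0 \<le> h" using h by simp
    show "cube_mean d \<alpha> h S \<in> vsphere d s" for S
      using norm[of S] by (auto simp: vsphere_def euclid_def space_PiM cube_mean_def)
    fix S i A assume i: "i \<in> {1..<d}" and S: "S \<subseteq> {1..<d} - {i}"
      and A: "A \<in> sets (\<Pi>\<^sub>M j\<in>{..<n}. euclid d)"
    \<comment> \<open>The midpoint of the two adjacent vertices.\<close>
    define m where "m = (cube_mean d \<alpha> h S)(i := 0)"
    have iS: "i \<notin> S" "i < d" "i \<noteq> 0" using i S by auto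
    have m0: "m i = 0" by (simp add: m_def)
    have t: "cube_mean d \<alpha> h S = (\<lambda>j. m j - (if j = i then h else 0))"
      using iS by (auto simp: m_def cube_mean_def fun_eq_iff)
    have t': "cube_mean d \<alpha> h (insert i S) = (\<lambda>j. m j + (if j = i then h else 0))"
      using iS by (auto simp: m_def cube_mean_def fun_eq_iff)
    have "s\<^sup>2 = (vnorm d m)\<^sup>2 + h\<^sup>2"
      using flipped_mean_norms(1)[where m = m and i = i, OF iS(2) m0, of h] norm[of S] by (simp add: t)
    then have "(vnorm d m)\<^sup>2 \<le> s\<^sup>2" by simp
    then have ms: "vnorm d m \<le> s" using s by (rule power2_le_imp_le)
    show "1 / 2 \<le> measure (sample d n (cube_mean d \<alpha> h S)) A
      + measure (sample d n (cube_mean d \<alpha> h (insert i S))) (space (\<Pi>\<^sub>M j\<in>{..<n}. euclid d) - A)"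
      using nb h h1 by (intro flipped_sample_error_sum[where m = m and i = i, OF iS(2) m0 _ _ t t' ms _ A]) (simp_all add: C_def M_def)
  qed
  moreover have "ennreal (1 / (24 * sqrt C)) * sphere_rate d n s \<le> ennreal (h * sqrt D / 4)"
  proof -
    define R where "R = min ((\<rho> + sqrt \<rho>) / s + sqrt \<rho>) s"
    have R0: "0 \<le> R" using \<rho> s0 by (simp add: R_def)
    have lower: "min (s\<^sup>2) (\<rho> / M) \<le> 4 * C * (D * b)"
    proof -
      have "\<rho> / M \<le> 4 * C * (D * (1 / (2 * C * real n * M)))"
      proof -
        have "\<rho> / M = real d / (real n * M)" by (simp add: \<rho>_def)
        also have "\<dots> \<le> (2 * D) / (real n * M)" using D M n0 by (intro divide_right_mono) auto
        also have "\<dots> = 4 * C * (D * (1 / (2 * C * real n * M)))" using C by simp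
        finally show ?thesis .
      qed
      moreover have "s\<^sup>2 \<le> 4 * C * (D * (s\<^sup>2 / (2 * D)))"
      proof -
        have "4 * C * (D * (s\<^sup>2 / (2 * D))) = 2 * C * s\<^sup>2" using D by simp
        moreover have "1 * s\<^sup>2 \<le> (2 * C) * s\<^sup>2" using C by (intro mult_right_mono) auto
        ultimately show ?thesis by (metis mult_1)
      qed
      ultimately show ?thesis unfolding b_def by (auto simp: min_def)
    qed
    have "R\<^sup>2 \<le> 9 * min (s\<^sup>2) (\<rho> / M)"
      unfolding R_def M_def by (rule sphere_rate_square_le[OF \<rho> s0])
    also have "\<dots> \<le> 9 * (4 * C * (D * b))" using lower by simp
    also have "\<dots> = (6 * sqrt C * (h * sqrt D))\<^sup>2"
      using C D h by (simp add: power_mult_distrib)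
    finally have "R \<le> 6 * sqrt C * (h * sqrt D)"
      by (rule power2_le_imp_le) (use C D h in simp)
    then have "1 / (24 * sqrt C) * R \<le> 1 / (24 * sqrt C) * (6 * sqrt C * (h * sqrt D))"
      using C by (intro mult_left_mono) auto
    also have "\<dots> = h * sqrt D / 4" using C by simp
    finally have "ennreal (1 / (24 * sqrt C) * R) \<le> ennreal (h * sqrt D / 4)" by (rule ennreal_leI)
    moreover have "ennreal (1 / (24 * sqrt C) * R) = ennreal (1 / (24 * sqrt C)) * ennreal R"
      using C R0 by (intro ennreal_mult) auto
    moreover have "sphere_rate d n s = ennreal R"
      using sphere_rate_eq[OF s0, of d n] by (simp add: R_def \<rho>_def)
    ultimately show ?thesis by simp
  qed
  ultimately show ?thesis unfolding C_def by (metis order_trans)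
qed

lemma minimax_risk_mono:
  assumes "S \<subseteq> T"
  shows "minimax_risk d n S \<le> minimax_risk d n T"
  unfolding minimax_risk_def using assms by (intro INF_mono bexI SUP_subset_mono) auto

text \<open>
  This restates that \<open>gmix d \<theta>\<close>, whose density is a multiple of this hyperbolic cosine, has mass
  \<open>1\<close>.
\<close>

lemma nn_integral_gauss0_cosh:
  "(\<integral>\<^sup>+x. ennreal (cosh (vdot d \<theta> x)) \<partial>gauss d (\<lambda>_. 0)) = ennreal (exp ((vnorm d \<theta>)\<^sup>2 / 2))"
proof -
  define c where "c = exp (- (vnorm d \<theta>)\<^sup>2 / 2)"
  define I where "I = (\<integral>\<^sup>+x. ennreal (cosh (vdot d \<theta> x)) \<partial>gauss d (\<lambda>_. 0))"
  have m: "(\<lambda>x. ennreal (c * cosh (vdot d \<theta> x))) \<in> borel_measurable (gauss d (\<lambda>_. 0))"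
    unfolding borel_measurable_gauss_iff by measurable
  have m': "(\<lambda>x. ennreal (cosh (vdot d \<theta> x))) \<in> borel_measurable (gauss d (\<lambda>_. 0))"
    unfolding borel_measurable_gauss_iff by measurable
  have "1 = emeasure (gmix d \<theta>) (space (gauss d (\<lambda>_. 0)))"
    using prob_space.emeasure_space_1[OF prob_space_gmix, of d \<theta>] by simp
  also have "\<dots> = (\<integral>\<^sup>+x. ennreal (c * cosh (vdot d \<theta> x)) * indicator (space (gauss d (\<lambda>_. 0))) x \<partial>gauss d (\<lambda>_. 0))"
    unfolding gmix_eq_density_gauss0 c_def[symmetric] by (rule emeasure_density[OF m sets.top])
  also have "\<dots> = (\<integral>\<^sup>+x. ennreal c * ennreal (cosh (vdot d \<theta> x)) \<partial>gauss d (\<lambda>_. 0))"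
    by (intro nn_integral_cong) (simp add: ennreal_mult c_def)
  also have "\<dots> = ennreal c * I" unfolding I_def by (rule nn_integral_cmult[OF m'])
  finally have "1 = ennreal c * I" .
  then have "ennreal (1 / c) * 1 = ennreal (1 / c) * (ennreal c * I)" by simp
  also have "\<dots> = ennreal (1 / c * c) * I"
    by (simp only: mult.assoc[symmetric] ennreal_mult[symmetric] c_def exp_ge_zero zero_le_divide_1_iff)
  finally have "I = ennreal (1 / c)" by (simp add: c_def)
  also have "1 / c = exp ((vnorm d \<theta>)\<^sup>2 / 2)" by (simp add: c_def exp_minus inverse_eq_divide)
  finally show ?thesis by (simp add: I_def)
qed

lemma cosh_le_one_plus_square:
  fixes x :: real
  assumes "0 \<le> x" "x \<le> 1"
  shows "cosh x \<le> 1 + x\<^sup>2"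
proof -
  have 1: "exp x \<le> 1 + x + x\<^sup>2" using assms by (rule exp_bound)
  have "1 \<le> (1 - x + x\<^sup>2) * (1 + x)"
    using assms by (simp add: algebra_simps power2_eq_square)
  also have "\<dots> \<le> (1 - x + x\<^sup>2) * exp x"
    using assms by (intro mult_left_mono exp_ge_add_one_self) auto
  finally have "exp (- x) \<le> 1 - x + x\<^sup>2" by (simp add: exp_minus field_simps)
  with 1 show ?thesis by (simp add: cosh_field_def)
qed

text \<open>
  Testing \<open>0\<close> against one mean of norm \<open>s\<close>. The likelihood ratio has second moment \<open>cosh (s\<^sup>2)\<close>, and
  \<open>cosh (s\<^sup>2) \<le> 1 + s\<^sup>4\<close> keeps its \<open>n\<close>-th power bounded. An estimate of norm below \<open>s / 2\<close> is wrong at the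
  second point, any other one at the first.
\<close>

lemma minimax_risk_ge_two_points:
  assumes d: "d \<ge> 1" and s: "0 \<le> s" "s \<le> 1" and n: "real n * s ^ 4 \<le> 1 / 2"
  shows "ennreal (s / 8) \<le> minimax_risk d n (vball d s)"
  unfolding minimax_risk_def
proof (rule INF_greatest)
  fix est assume est: "est \<in> estimators d n"
  let ?M = "\<Pi>\<^sub>M j\<in>{..<n}. euclid d"
  define z where "z = (\<lambda>i\<in>{..<d}. 0 :: real)"
  define \<theta> where "\<theta> = (\<lambda>i\<in>{..<d}. if i = 0 then s else 0)"
  have z: "vnorm d z = 0" "vdot d z x = 0" for x
    by (auto simp: z_def vnorm_def L2_set_0' vdot_def)
  have \<theta>s: "vnorm d \<theta> = s"
  proof -
    have "(vnorm d \<theta>)\<^sup>2 = (\<Sum>i<d. if i = 0 then s\<^sup>2 else 0)"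
      unfolding vnorm_power2 by (intro sum.cong) (auto simp: \<theta>_def)
    also have "\<dots> = s\<^sup>2" using d by simp
    finally show ?thesis using s by (simp add: power2_eq_iff_nonneg)
  qed
  have mem: "z \<in> vball d s" "\<theta> \<in> vball d s"
    using z \<theta>s s by (auto simp: vball_def z_def \<theta>_def euclid_def space_PiM)
  define f where "f x = exp (- s\<^sup>2 / 2) * cosh (vdot d \<theta> x)" for x
  have fm [measurable]: "f \<in> borel_measurable (euclid d)" unfolding f_def by measurable
  have gz: "gmix d z = gauss d (\<lambda>_. 0)"
    unfolding gmix_eq_density_gauss0 z by (simp add: density_1)
  have g\<theta>: "gmix d \<theta> = density (gmix d z) (\<lambda>x. ennreal (f x))"
    unfolding gz unfolding gmix_eq_density_gauss0 f_def \<theta>s ..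
  have second: "(\<integral>\<^sup>+x. ennreal ((f x)\<^sup>2) \<partial>gmix d z) = ennreal (cosh (s\<^sup>2))"
  proof -
    define e where "e = exp (- s\<^sup>2) / 2"
    have e: "0 \<le> e" by (simp add: e_def)
    have "(f x)\<^sup>2 = e * (1 + cosh (vdot d (\<lambda>i. 2 * \<theta> i) x))" for x
    proof -
      have "vdot d (\<lambda>i. 2 * \<theta> i) x = 2 * vdot d \<theta> x" by (simp add: vdot_def sum_distrib_left mult.assoc)
      then show ?thesis
        by (simp add: f_def e_def power_mult_distrib cosh_double_cosh exp_double[symmetric])
    qed
    then have "(\<integral>\<^sup>+x. ennreal ((f x)\<^sup>2) \<partial>gmix d z)
      = (\<integral>\<^sup>+x. ennreal e * (1 + ennreal (cosh (vdot d (\<lambda>i. 2 * \<theta> i) x))) \<partial>gauss d (\<lambda>_. 0))"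
      unfolding gz using e by (intro nn_integral_cong) (simp add: ennreal_mult ennreal_plus)
    also have "\<dots> = ennreal e * (1 + (\<integral>\<^sup>+x. ennreal (cosh (vdot d (\<lambda>i. 2 * \<theta> i) x)) \<partial>gauss d (\<lambda>_. 0)))"
    proof -
      have m: "(\<lambda>x. ennreal (cosh (vdot d (\<lambda>i. 2 * \<theta> i) x))) \<in> borel_measurable (gauss d (\<lambda>_. 0))"
        unfolding borel_measurable_gauss_iff by measurable
      have one: "(\<integral>\<^sup>+x. 1 \<partial>gauss d (\<lambda>_. 0)) = 1"
        using prob_space.emeasure_space_1[OF prob_space_gauss, of d "\<lambda>_. 0"] by simp
      show ?thesis
        using m by (simp only: nn_integral_cmult nn_integral_add one borel_measurable_const borel_measurable_add)
    qed
    also have "\<dots> = ennreal e * (1 + ennreal (exp (2 * s\<^sup>2)))"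
    proof -
      have "vnorm d (\<lambda>i. 2 * \<theta> i) = 2 * s"
        using vnorm_divide[of d \<theta> "1 / 2"] \<theta>s by (simp add: mult.commute)
      then show ?thesis unfolding nn_integral_gauss0_cosh by (simp add: power_mult_distrib)
    qed
    also have "\<dots> = ennreal (e * (1 + exp (2 * s\<^sup>2)))"
      using e by (simp add: ennreal_mult ennreal_plus)
    also have "e * (1 + exp (2 * s\<^sup>2)) = cosh (s\<^sup>2)"
      by (simp add: e_def cosh_field_def distrib_left flip: exp_add)
    finally show ?thesis .
  qed
  have budget: "(\<integral>\<^sup>+x. ennreal ((f x)\<^sup>2) \<partial>gmix d z) ^ n \<le> 2"
  proof -
    have "cosh (s\<^sup>2) \<le> 1 + (s\<^sup>2)\<^sup>2" using s by (intro cosh_le_one_plus_square) (auto simp: power_le_one)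
    also have "\<dots> \<le> exp (s ^ 4)" using exp_ge_add_one_self[of "s ^ 4"] by simp
    finally have "cosh (s\<^sup>2) ^ n \<le> exp (s ^ 4) ^ n" by (rule power_mono) simp
    also have "\<dots> = exp (real n * s ^ 4)" by (simp add: exp_of_nat_mult)
    also have "\<dots> \<le> exp (1 / 2)" using n by simp
    also have "\<dots> \<le> 1 + 1 / 2 + (1 / 2)\<^sup>2" by (rule exp_bound) auto
    also have "\<dots> \<le> (2::real)" by (simp add: power2_eq_square)
    finally have "ennreal (cosh (s\<^sup>2) ^ n) \<le> ennreal 2" by (rule ennreal_leI)
    moreover have "ennreal (cosh (s\<^sup>2)) ^ n = ennreal (cosh (s\<^sup>2) ^ n)" by (rule ennreal_power) simp
    ultimately show ?thesis unfolding second by simp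
  qed
  have [measurable]: "est \<in> ?M \<rightarrow>\<^sub>M euclid d" using est by (simp add: estimators_def)
  define A where "A = {Y \<in> space ?M. s / 2 \<le> vnorm d (est Y)}"
  have A [measurable]: "A \<in> sets ?M" unfolding A_def by measurable
  have err: "measure (sample d n z) A + measure (sample d n \<theta>) (space ?M - A) \<ge> 1 / 2"
    using error_sum_samples[OF g\<theta> fm _ budget A] by (simp add: f_def)
  have loss_z: "s / 2 \<le> loss d (est Y) z" if "Y \<in> A" for Y
  proof -
    have "vnorm d (\<lambda>i. est Y i - z i) = vnorm d (est Y)" "vnorm d (\<lambda>i. est Y i + z i) = vnorm d (est Y)"
      by (auto simp: vnorm_def L2_set_def z_def intro!: sum.cong)
    then show ?thesis using that by (simp add: loss_def A_def)
  qed
  have loss_\<theta>: "s / 2 \<le> loss d (est Y) \<theta>" if "Y \<in> space ?M - A" for Y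
  proof -
    have "vnorm d (est Y) \<le> s / 2" using that by (auto simp: A_def)
    moreover have "s \<le> vnorm d (est Y) + vnorm d (\<lambda>i. est Y i - \<theta> i)"
      using vnorm_diff_le[of d "est Y" "\<lambda>i. est Y i - \<theta> i"] \<theta>s by simp
    moreover have "s \<le> vnorm d (\<lambda>i. est Y i + \<theta> i) + vnorm d (est Y)"
      using vnorm_diff_le[of d "\<lambda>i. est Y i + \<theta> i" "est Y"] \<theta>s by simp
    ultimately show ?thesis by (auto simp: loss_def)
  qed
  have risk: "ennreal (s / 8) \<le> (SUP \<theta>\<in>vball d s. \<integral>\<^sup>+Y. ennreal (loss d (est Y) \<theta>) \<partial>sample d n \<theta>)"
    if t: "t \<in> vball d s" and B: "B \<in> sets ?M" and p: "1 / 4 \<le> measure (sample d n t) B"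
      and le: "\<And>Y. Y \<in> B \<Longrightarrow> s / 2 \<le> loss d (est Y) t" for t B
  proof -
    interpret prob_space "sample d n t" by (rule prob_space_sample)
    have "s / 2 * (1 / 4) \<le> s / 2 * prob B" using p s by (intro mult_left_mono) auto
    then have "ennreal (s / 8) \<le> ennreal (s / 2 * prob B)" by (intro ennreal_leI) simp
    also have "\<dots> = ennreal (s / 2) * emeasure (sample d n t) B"
      unfolding emeasure_eq_measure using s by (intro ennreal_mult) auto
    also have "\<dots> = (\<integral>\<^sup>+Y. ennreal (s / 2) * indicator B Y \<partial>sample d n t)"
      using B by (intro nn_integral_cmult_indicator[symmetric]) (simp add: sets_sample)
    also have "\<dots> \<le> (\<integral>\<^sup>+Y. ennreal (loss d (est Y) t) \<partial>sample d n t)"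
    proof (rule nn_integral_mono)
      fix Y
      show "ennreal (s / 2) * indicator B Y \<le> ennreal (loss d (est Y) t)"
        using ennreal_leI[OF le[of Y]] by (cases "Y \<in> B") auto
    qed
    also have "\<dots> \<le> (SUP \<theta>\<in>vball d s. \<integral>\<^sup>+Y. ennreal (loss d (est Y) \<theta>) \<partial>sample d n \<theta>)"
      using t by (rule SUP_upper)
    finally show ?thesis .
  qed
  show "ennreal (s / 8) \<le> (SUP \<theta>\<in>vball d s. \<integral>\<^sup>+Y. ennreal (loss d (est Y) \<theta>) \<partial>sample d n \<theta>)"
  proof (cases "1 / 4 \<le> measure (sample d n z) A")
    case True
    then show ?thesis by (rule risk[OF mem(1) A _ loss_z])
  next
    case False
    then have "1 / 4 \<le> measure (sample d n \<theta>) (space ?M - A)" using err by simp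
    then show ?thesis by (intro risk[OF mem(2) _ _ loss_\<theta>]) auto
  qed
qed

text \<open>
  Up to the radius \<open>R = \<rho>\<^bsup>1/4\<^esup> + \<surd>\<rho>\<close> the sphere rate is of order \<open>s\<close>, because \<open>R\<^sup>2 \<le> 2 (\<rho> + \<surd>\<rho>)\<close>; so the
  sphere of radius \<open>min {R, r}\<close> is hard enough when \<open>d \<ge> 2\<close>.
\<close>

lemma minimax_risk_ball_ge:
  assumes d: "d \<ge> 1" and n: "n \<ge> 1" and r: "r \<ge> 0"
  shows "ennreal (1 / (48 * sqrt (64 * exp 16))) * ball_rate d n r \<le> minimax_risk d n (vball d r)"
proof -
  define \<rho> where "\<rho> = real d / real n"
  have \<rho>: "\<rho> > 0" using d n by (simp add: \<rho>_def)
  define p where "p = \<rho> powr (1 / 4)"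
  have p: "p > 0" "p\<^sup>2 = sqrt \<rho>"
    using \<rho> by (simp_all add: p_def powr_power powr_half_sqrt)
  define R where "R = p + sqrt \<rho>"
  have R: "R > 0" "R\<^sup>2 \<le> 2 * (\<rho> + sqrt \<rho>)"
  proof -
    show "R > 0" using p \<rho> by (simp add: R_def add_pos_nonneg)
    have "R\<^sup>2 \<le> 2 * p\<^sup>2 + 2 * (sqrt \<rho>)\<^sup>2"
      using zero_le_power2[of "p - sqrt \<rho>"] unfolding R_def power2_sum power2_diff by linarith
    then show "R\<^sup>2 \<le> 2 * (\<rho> + sqrt \<rho>)" using p \<rho> by simp
  qed
  define s where "s = min R r"
  define c where "c = 1 / (24 * sqrt (64 * exp 16 :: real))"
  have c: "0 < c" "c \<le> 1 / 24"
  proof -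
    have "1 \<le> sqrt (64 * exp 16 :: real)" using exp_ge_add_one_self[of "16::real"] by simp
    then show "0 < c" "c \<le> 1 / 24" by (simp_all add: c_def field_simps)
  qed
  have rate: "ball_rate d n r = ennreal s" by (simp add: ball_rate_def s_def R_def p_def \<rho>_def)
  have c2: "1 / (48 * sqrt (64 * exp 16 :: real)) = c / 2" by (simp add: c_def)
  have goal: "ennreal (c / 2) * ennreal s \<le> minimax_risk d n (vball d r)"
  proof (cases "r = 0")
    case True
    then show ?thesis using R by (simp add: s_def)
  next
    case False
    then have s0: "s > 0" using r R by (simp add: s_def)
    have sr: "s \<le> r" "s \<le> R" by (simp_all add: s_def)
    show ?thesis
    proof (cases "d \<ge> 2")
      case True
      have "s / 2 \<le> (\<rho> + sqrt \<rho>) / s + sqrt \<rho>"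
      proof -
        have "s * s \<le> R * R" using sr s0 by (intro mult_mono) auto
        then have "s * s \<le> 2 * (\<rho> + sqrt \<rho>)" using R by (simp add: power2_eq_square)
        then have "s / 2 \<le> (\<rho> + sqrt \<rho>) / s" using s0 by (simp add: field_simps)
        moreover have "0 \<le> sqrt \<rho>" using \<rho> by simp
        ultimately show ?thesis by linarith
      qed
      then have "ennreal (s / 2) \<le> sphere_rate d n s"
        unfolding sphere_rate_eq[OF s0] using s0 by (intro ennreal_leI) (simp add: \<rho>_def)
      then have "ennreal c * ennreal (s / 2) \<le> ennreal c * sphere_rate d n s"
        by (rule mult_left_mono) simp
      also have "\<dots> \<le> minimax_risk d n (vsphere d s)"
        unfolding c_def using True n s0 by (intro minimax_risk_sphere_ge) auto
      also have "\<dots> \<le> minimax_risk d n (vball d r)"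
        using sr by (intro minimax_risk_mono) (auto simp: vsphere_def vball_def)
      finally show ?thesis using c s0 by (simp flip: ennreal_mult)
    next
      case False
      then have d1: "d = 1" using d by simp
      have n0: "real n \<ge> 1" using n by simp
      have \<rho>1: "\<rho> \<le> 1" "real n * \<rho> = 1" using n0 by (simp_all add: \<rho>_def d1)
      have "p \<le> 1" using \<rho> \<rho>1 by (simp add: p_def powr_le1)
      have "sqrt \<rho> \<le> p" using p \<open>p \<le> 1\<close> mult_left_le[of p p] by (simp add: power2_eq_square flip: p(2))
      then have R2: "R \<le> 2 * p" by (simp add: R_def)
      \<comment> \<open>The point at distance \<open>s / 4\<close> satisfies \<open>n (s / 4)\<^sup>4 \<le> 1 / 16\<close> since \<open>p\<^sup>4 = 1 / n\<close>.\<close>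
      have s4: "s / 4 \<le> p / 2" using sr R2 by simp
      have "ennreal (s / 4 / 8) \<le> minimax_risk d n (vball d (s / 4))"
      proof (rule minimax_risk_ge_two_points[OF d])
        have "(s / 4) ^ 4 \<le> (p / 2) ^ 4" using s4 s0 by (intro power_mono) auto
        also have "\<dots> = (p\<^sup>2)\<^sup>2 / 16" by (simp add: power_divide)
        also have "\<dots> = \<rho> / 16" using \<rho> by (simp add: p(2))
        finally have "real n * (s / 4) ^ 4 \<le> real n * (\<rho> / 16)" by (rule mult_left_mono) simp
        then show "real n * (s / 4) ^ 4 \<le> 1 / 2" using \<rho>1 by simp
      qed (use s0 s4 \<open>p \<le> 1\<close> in auto)
      also have "\<dots> \<le> minimax_risk d n (vball d r)"
        using sr s0 by (intro minimax_risk_mono) (auto simp: vball_def)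
      finally have "ennreal (s / 32) \<le> minimax_risk d n (vball d r)" by simp
      moreover have "ennreal (c / 2) * ennreal s \<le> ennreal (s / 32)"
      proof -
        have "c / 2 * s \<le> 1 / 32 * s" using c s0 by (intro mult_right_mono) auto
        then have "ennreal (c / 2 * s) \<le> ennreal (s / 32)" by (intro ennreal_leI) simp
        moreover have "ennreal (c / 2 * s) = ennreal (c / 2) * ennreal s"
          using c s0 by (intro ennreal_mult) auto
        ultimately show ?thesis by simp
      qed
      ultimately show ?thesis by (rule order_trans[rotated])
    qed
  qed
  then show ?thesis unfolding rate c2 .
qed

theorem theorem10:
  shows "(\<exists>c c' :: real. 0 < c \<and> c \<le> c' \<and>
           (\<forall>(d::nat) (n::nat) (s::real). d \<ge> 2 \<longrightarrow> n \<ge> 1 \<longrightarrow> s \<ge> 0 \<longrightarrow>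
              ennreal c * sphere_rate d n s \<le> minimax_risk d n (vsphere d s) \<and>
              minimax_risk d n (vsphere d s) \<le> ennreal c' * sphere_rate d n s))
       \<and> (\<exists>c c' :: real. 0 < c \<and> c \<le> c' \<and>
           (\<forall>(d::nat) (n::nat) (r::real). d \<ge> 1 \<longrightarrow> n \<ge> 1 \<longrightarrow> r \<ge> 0 \<longrightarrow>
              ennreal c * ball_rate d n r \<le> minimax_risk d n (vball d r) \<and>
              minimax_risk d n (vball d r) \<le> ennreal c' * ball_rate d n r))"
proof -
  have k: "1 \<le> sqrt (64 * exp 16 :: real)" using exp_ge_add_one_self[of "16::real"] by simp
  have "0 < 1 / (a * sqrt (64 * exp 16 :: real)) \<and> 1 / (a * sqrt (64 * exp 16)) \<le> 1" if "1 \<le> a" for a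
    using mult_mono[OF that k] that by simp
  then have const: "0 < 1 / (24 * sqrt (64 * exp 16 :: real))" "1 / (24 * sqrt (64 * exp 16 :: real)) \<le> 1"
    "0 < 1 / (48 * sqrt (64 * exp 16 :: real))" "1 / (48 * sqrt (64 * exp 16 :: real)) \<le> 1" by auto
  show ?thesis
  proof (rule conjI; (rule exI)+; intro conjI allI impI)
    show "0 < 1 / (24 * sqrt (64 * exp 16 :: real))" "1 / (24 * sqrt (64 * exp 16)) \<le> (516 :: real)"
      "0 < 1 / (48 * sqrt (64 * exp 16 :: real))" "1 / (48 * sqrt (64 * exp 16)) \<le> (1033 :: real)"
      using const by linarith+
  next
    fix d n :: nat and s :: real assume "d \<ge> 2" "n \<ge> 1" "s \<ge> 0"
    then show "ennreal (1 / (24 * sqrt (64 * exp 16))) * sphere_rate d n s \<le> minimax_risk d n (vsphere d s)"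
      "minimax_risk d n (vsphere d s) \<le> ennreal 516 * sphere_rate d n s"
      by (auto intro!: minimax_risk_sphere_ge minimax_risk_sphere_le simp del: ennreal_numeral)
  next
    fix d n :: nat and r :: real assume "d \<ge> 1" "n \<ge> 1" "r \<ge> 0"
    then show "ennreal (1 / (48 * sqrt (64 * exp 16))) * ball_rate d n r \<le> minimax_risk d n (vball d r)"
      "minimax_risk d n (vball d r) \<le> ennreal 1033 * ball_rate d n r"
      by (auto intro!: minimax_risk_ball_ge minimax_risk_ball_le simp del: ennreal_numeral)
  qed
qed

end
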